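(* Let $(X,\mathscr{T},\mathcal{X},\mu)$ be a locally compact Polish Radon-measure space, $(Z,\mathcal{Z},\nu)$ a separable countably generated probability space, and $s\colon(X,\mathcal{X}^\mu)\to(Z,\mathcal{Z})$ a measurable map. For $i=1,2$ let $(\mu^i_\zeta)_{\zeta\in Z}$ be an $s$-separated pseudo-disintegration of $\mu$ over $(Z,\mathcal{Z},\nu)$, and let $\zeta\mapsto(E^i_\zeta,\mathscr{D}(E^i_\zeta))$ be a $\nu$-measurable field of Dirichlet forms on $L^2(\mu^i_\zeta)$ compatible with the disintegration $(\mu^i_\zeta)_{\zeta\in Z}$, with semigroups $(T^{(i)}_{\zeta,t})_{t\ge0}$. Assume further that there exists a $\nu$-measurable field $\zeta\mapsto U_\zeta$ of unitary order isomorphisms $U_\zeta\colon L^2(\mu^1_\zeta)\to L^2(\mu^2_\zeta)$ intertwining these semigroups, i.e. $$T^{(2)}_{\zeta,t}\circ U_\zeta=U_\zeta\circ T^{(1)}_{\zeta,t},\qquad t>0 .$$ Then the direct integral forms $E^i=\int_Z^\oplus E^i_\zeta\,d\nu(\zeta)$, $i=1,2$, are intertwined by the unitary order isomorphism $U=\int_Z^\oplus U_\zeta\,d\nu(\zeta)$; that is, $U$ is a unitary order isomorphism of $L^2(\mu)$ intertwining the semigroups of $E^1$ and $E^2$.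
   Context: **Measure spaces.** $\mathcal{X}^\mu$ and $\hat\mu$ denote the completed $\sigma$-algebra and measure; "$\mu$-measurable" means $\mathcal{X}^\mu$-measurable. A measurable space is *separable* if its $\sigma$-algebra contains all singletons; *countably generated* if its $\sigma$-algebra is generated by a countable family. A Hausdorff topological measure space is a *Radon-measure space* if $\mathcal{X}^\mu$ is the $\mu$-completion of the Borel $\sigma$-algebra and $\hat\mu$ is locally finite and inner regular with respect to compact sets. **Direct integrals.** All Hilbert spaces are real and separable. $\zeta\mapsto H_\zeta$ is a *$\nu$-measurable field of Hilbert spaces with underlying space $S$* if $S$ is a linear subspace of $\prod_\zeta H_\zeta$ such that: (a) $\zeta\mapsto\|u_\zeta\|$ is $\nu$-measurable for all $u\in S$; (b) if $v\in\prod_\zeta H_\zeta$ and $\zeta\mapsto\langle u_\zeta,v_\zeta\rangle$ is $\nu$-measurable for all $u\in S$, then $v\in S$; (c) there is a sequence $(u_n)\subset S$ with $(u_{n,\zeta})_n$ total (dense linear span) in $H_\zeta$ for every $\zeta$. Elements of $S$ are the $\nu$-measurable vector fields. A family satisfying (a) and (c) is contained in exactly one such $S$, said to be generated by it. The *direct integral* $\int_Z^\oplus H_\zeta\,d\nu(\zeta)$ is the Hilbert space of classes, modulo $\nu$-a.e. equality, of $u\in S$ with $\|u\|^2=\int_Z\|u_\zeta\|^2d\nu<\infty$. A field of bounded operators $B_\zeta\colon H^1_\zeta\to H^2_\zeta$ is *$\nu$-measurable* if it maps $\nu$-measurable vector fields to $\nu$-measurable vector fields; if $\nu$-$\mathrm{esssup}\,\|B_\zeta\|<\infty$,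 it defines the bounded operator $B=\int_Z^\oplus B_\zeta\,d\nu(\zeta)$ by $(Bu)_\zeta=B_\zeta u_\zeta$. **Quadratic forms.** A quadratic form on $H$ is a map $Q\colon H\to[0,\infty]$ satisfying the parallelogram identity with dense domain $\mathscr{D}(Q)=\{Q<\infty\}$; the same letter denotes the bilinear form; $Q_1(u)=Q(u)+\|u\|^2$; $\mathscr{D}(Q)_1$ is the domain of a closed form with the norm $Q_1^{1/2}$. The semigroup of a closed form $Q$ is $T_t=e^{tL}$, with $-L\ge0$ the self-adjoint operator associated with $Q$. Closed forms $\zeta\mapsto(Q_\zeta,\mathscr{D}(Q_\zeta))$ on $H_\zeta$ are a *$\nu$-measurable field of quadratic forms* if $\zeta\mapsto H_\zeta$ and $\zeta\mapsto\mathscr{D}(Q_\zeta)_1$ are $\nu$-measurable fields of Hilbert spaces with underlying spaces $S_H$, $S_Q$, and $S_Q\subset S_H$ is a linear subspace. Their direct integral $Q=\int_Z^\oplus Q_\zeta\,d\nu$ has domain the classes of $u\in S_Q$ with $\int_ZQ_{\zeta,1}(u_\zeta)\,d\nu<\infty$, and $Q(u,v)=\int_ZQ_\zeta(u_\zeta,v_\zeta)\,d\nu$. **Disintegrations.** A *pseudo-disintegration* of $\mu$ over $\nu$ is a family $(\mu_\zeta)_{\zeta\in Z}$ of non-zero measures on $(X,\mathcal{X})$ with $\zeta\mapsto\mu_\zeta A$ $\nu$-measurable and $\mu A=\int_Z\mu_\zeta A\,d\nu(\zeta)$ for all $A\in\mathcal{X}$. It is *$s$-separated* if $s^{-1}(\zeta)$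 is $\mu_\zeta$-conegligible for $\nu$-a.e. $\zeta$. **$L^2$ as a direct integral; compatibility.** Let $\mathcal{L}^2(\mu)$ be the space of $\mu$-measurable square-integrable functions. For $f\in\mathcal{L}^2(\mu)$ let $\delta(f)_\zeta$ be the class of $f$ in $L^2(\mu_\zeta)$ if $f\in\mathcal{L}^2(\mu_\zeta)$, and $0$ otherwise. If $\mathcal{A}\subset\mathcal{L}^2(\mu)$ is a linear subspace with classes dense in $L^2(\mu)$, $S_{\mathcal{A}}$ is the space of $\nu$-measurable vector fields generated by $\delta(\mathcal{A})$. Since the pseudo-disintegration is separated, $[f]\mapsto[\delta(f)]$ is a unitary order-preserving identification $L^2(\mu)=\int_Z^\oplus L^2(\mu_\zeta)\,d\nu(\zeta)$ (underlying space $S_{\mathcal{A}}$); through these identifications for $(\mu^1_\zeta)$ and $(\mu^2_\zeta)$, $E^1,E^2$ are forms on $L^2(\mu)$ and $U$ is an operator on $L^2(\mu)$. A field $\zeta\mapsto E_\zeta$ with direct integral $E$ is *compatible* with $(\mu_\zeta)$ if the space $S_Q$ underlying $\zeta\mapsto\mathscr{D}(E_\zeta)_1$ is of the form $S_{\mathcal{A}}$ (i.e. generated by $\delta(\mathcal{A})$) for some linear subspace $\mathcal{A}\subset\mathcal{L}^2(\mu)$ with classes dense in $L^2(\mu)$ and with $\mathcal{A}\subset\mathscr{D}(E)$. **Dirichlet forms, order isomorphisms.** A *Dirichlet form* on $L^2(m)$ is a closed quadratic form with $f\in\mathscr{D}(E)\Rightarrow f^+\wedge1\in\mathscr{D}(E)$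 and $E(f^+\wedge1)\le E(f)$. A linear operator is *order-preserving* if $f\ge0$ implies $Uf\ge0$; an *order isomorphism* is an invertible order-preserving linear operator with order-preserving inverse. $U$ *intertwines* two semigroups if $UT^{(1)}_t=T^{(2)}_tU$ for all $t$. *)

theory Defs
  imports "HOL-Probability.Probability"
begin

section \<open>Real Hilbert spaces with explicit carriers\<close>

text \<open>The fibres of a field of Hilbert spaces vary with the base point, so Hilbert spaces are
  records over a fixed type of elements. As in the source, Hilbert spaces are real and separable.\<close>

record 'h hspace =
  hcarrier :: "'h set"
  hzero :: 'h
  hadd :: "'h \<Rightarrow> 'h \<Rightarrow> 'h"
  hscale :: "real \<Rightarrow> 'h \<Rightarrow> 'h"
  hinner :: "'h \<Rightarrow> 'h \<Rightarrow> real"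

definition hdiff :: "'h hspace \<Rightarrow> 'h \<Rightarrow> 'h \<Rightarrow> 'h" where
  "hdiff H u v = hadd H u (hscale H (- 1) v)"

definition hnorm :: "'h hspace \<Rightarrow> 'h \<Rightarrow> real" where
  "hnorm H u = sqrt (hinner H u u)"

definition hdist :: "'h hspace \<Rightarrow> 'h \<Rightarrow> 'h \<Rightarrow> real" where
  "hdist H u v = hnorm H (hdiff H u v)"

definition hsubspace :: "'h hspace \<Rightarrow> 'h set \<Rightarrow> bool" where
  "hsubspace H V \<longleftrightarrow> V \<subseteq> hcarrier H \<and> hzero H \<in> V \<and>
     (\<forall>u\<in>V. \<forall>v\<in>V. hadd H u v \<in> V) \<and> (\<forall>c. \<forall>u\<in>V. hscale H c u \<in> V)"

definition hdense :: "'h hspace \<Rightarrow> 'h set \<Rightarrow> bool" where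
  "hdense H D \<longleftrightarrow> D \<subseteq> hcarrier H \<and> (\<forall>u\<in>hcarrier H. \<forall>e>0. \<exists>v\<in>D. hdist H u v < e)"

definition htotal :: "'h hspace \<Rightarrow> 'h set \<Rightarrow> bool" where
  "htotal H A \<longleftrightarrow> hdense H (hsubspace H hull A)"

locale real_hilbert =
  fixes H :: "'h hspace"
  assumes zero_closed: "hzero H \<in> hcarrier H"
    and add_closed: "\<lbrakk>u \<in> hcarrier H; v \<in> hcarrier H\<rbrakk> \<Longrightarrow> hadd H u v \<in> hcarrier H"
    and scale_closed: "u \<in> hcarrier H \<Longrightarrow> hscale H c u \<in> hcarrier H"
    and add_assoc: "\<lbrakk>u \<in> hcarrier H; v \<in> hcarrier H; w \<in> hcarrier H\<rbrakk>
      \<Longrightarrow> hadd H (hadd H u v) w = hadd H u (hadd H v w)"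
    and add_commute: "\<lbrakk>u \<in> hcarrier H; v \<in> hcarrier H\<rbrakk> \<Longrightarrow> hadd H u v = hadd H v u"
    and add_zero: "u \<in> hcarrier H \<Longrightarrow> hadd H u (hzero H) = u"
    and add_inverse: "u \<in> hcarrier H \<Longrightarrow> hadd H u (hscale H (- 1) u) = hzero H"
    and scale_add_right: "\<lbrakk>u \<in> hcarrier H; v \<in> hcarrier H\<rbrakk>
      \<Longrightarrow> hscale H c (hadd H u v) = hadd H (hscale H c u) (hscale H c v)"
    and scale_add_left: "u \<in> hcarrier H
      \<Longrightarrow> hscale H (c + d) u = hadd H (hscale H c u) (hscale H d u)"
    and scale_scale: "u \<in> hcarrier H \<Longrightarrow> hscale H c (hscale H d u) = hscale H (c * d) u"
    and scale_one: "u \<in> hcarrier H \<Longrightarrow> hscale H 1 u = u"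
    and inner_commute: "\<lbrakk>u \<in> hcarrier H; v \<in> hcarrier H\<rbrakk> \<Longrightarrow> hinner H u v = hinner H v u"
    and inner_add_left: "\<lbrakk>u \<in> hcarrier H; v \<in> hcarrier H; w \<in> hcarrier H\<rbrakk>
      \<Longrightarrow> hinner H (hadd H u v) w = hinner H u w + hinner H v w"
    and inner_scale_left: "\<lbrakk>u \<in> hcarrier H; v \<in> hcarrier H\<rbrakk>
      \<Longrightarrow> hinner H (hscale H c u) v = c * hinner H u v"
    and inner_nonneg: "u \<in> hcarrier H \<Longrightarrow> 0 \<le> hinner H u u"
    and inner_eq_zero: "\<lbrakk>u \<in> hcarrier H; hinner H u u = 0\<rbrakk> \<Longrightarrow> u = hzero H"
    and complete: "\<lbrakk>\<And>n. x n \<in> hcarrier H;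
        \<forall>e>0. \<exists>k. \<forall>m\<ge>k. \<forall>n\<ge>k. hdist H (x m) (x n) < e\<rbrakk>
      \<Longrightarrow> \<exists>u\<in>hcarrier H. (\<lambda>n. hdist H (x n) u) \<longlonglongrightarrow> 0"
    and separable: "\<exists>D. countable D \<and> hdense H D"

definition hlinear :: "'h hspace \<Rightarrow> 'k hspace \<Rightarrow> ('h \<Rightarrow> 'k) \<Rightarrow> bool" where
  "hlinear H K B \<longleftrightarrow> B \<in> hcarrier H \<rightarrow> hcarrier K \<and>
     (\<forall>u\<in>hcarrier H. \<forall>v\<in>hcarrier H. B (hadd H u v) = hadd K (B u) (B v)) \<and>
     (\<forall>c. \<forall>u\<in>hcarrier H. B (hscale H c u) = hscale K c (B u))"

definition hbounded :: "'h hspace \<Rightarrow> 'k hspace \<Rightarrow> ('h \<Rightarrow> 'k) \<Rightarrow> bool" where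
  "hbounded H K B \<longleftrightarrow> hlinear H K B \<and> (\<exists>C. \<forall>u\<in>hcarrier H. hnorm K (B u) \<le> C * hnorm H u)"

definition hunitary :: "'h hspace \<Rightarrow> 'k hspace \<Rightarrow> ('h \<Rightarrow> 'k) \<Rightarrow> bool" where
  "hunitary H K B \<longleftrightarrow> hlinear H K B \<and> bij_betw B (hcarrier H) (hcarrier K) \<and>
     (\<forall>u\<in>hcarrier H. \<forall>v\<in>hcarrier H. hinner K (B u) (B v) = hinner H u v)"


section \<open>Quadratic forms and their semigroups\<close>

definition form_dom :: "'h hspace \<Rightarrow> ('h \<Rightarrow> ennreal) \<Rightarrow> 'h set" where
  "form_dom H Q = {u \<in> hcarrier H. Q u < \<infinity>}"

definition quadratic_form :: "'h hspace \<Rightarrow> ('h \<Rightarrow> ennreal) \<Rightarrow> bool" where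
  "quadratic_form H Q \<longleftrightarrow>
     (\<forall>u\<in>hcarrier H. \<forall>v\<in>hcarrier H. Q (hadd H u v) + Q (hdiff H u v) = 2 * Q u + 2 * Q v) \<and>
     hdense H (form_dom H Q)"

text \<open>The bilinear form on the domain is recovered from the quadratic form by polarization.\<close>

definition bilinear_of :: "'h hspace \<Rightarrow> ('h \<Rightarrow> ennreal) \<Rightarrow> 'h \<Rightarrow> 'h \<Rightarrow> real" where
  "bilinear_of H Q u v = (enn2real (Q (hadd H u v)) - enn2real (Q (hdiff H u v))) / 4"

text \<open>The domain of \<open>Q\<close> with the norm given by the square root of \<open>Q\<^sub>1(u) = Q(u) + \<parallel>u\<parallel>\<^sup>2\<close>.\<close>

definition form_space :: "'h hspace \<Rightarrow> ('h \<Rightarrow> ennreal) \<Rightarrow> 'h hspace" where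
  "form_space H Q =
     \<lparr>hcarrier = form_dom H Q, hzero = hzero H, hadd = hadd H, hscale = hscale H,
      hinner = (\<lambda>u v. bilinear_of H Q u v + hinner H u v)\<rparr>"

definition closed_form :: "'h hspace \<Rightarrow> ('h \<Rightarrow> ennreal) \<Rightarrow> bool" where
  "closed_form H Q \<longleftrightarrow> quadratic_form H Q \<and> real_hilbert (form_space H Q)"

text \<open>The operator \<open>L\<close>, as a relation \<open>w = L u\<close>: \<open>- L\<close> is the self-adjoint operator associated
  with \<open>Q\<close>.\<close>

definition form_operator :: "'h hspace \<Rightarrow> ('h \<Rightarrow> ennreal) \<Rightarrow> 'h \<Rightarrow> 'h \<Rightarrow> bool" where
  "form_operator H Q u w \<longleftrightarrow> u \<in> form_dom H Q \<and> w \<in> hcarrier H \<and>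
     (\<forall>v\<in>form_dom H Q. bilinear_of H Q u v = - hinner H w v)"

text \<open>\<open>T\<^sub>t = e\<^bsup>tL\<^esup>\<close>: the strongly continuous contraction semigroup whose infinitesimal generator,
  domain included, is \<open>L\<close>. For a closed form it exists and is unique by the Hille--Yosida
  theorem. The values \<open>T t\<close> with \<open>t < 0\<close> are irrelevant.\<close>

definition form_semigroup :: "'h hspace \<Rightarrow> ('h \<Rightarrow> ennreal) \<Rightarrow> (real \<Rightarrow> 'h \<Rightarrow> 'h) \<Rightarrow> bool" where
  "form_semigroup H Q T \<longleftrightarrow>
     (\<forall>t\<ge>0. hlinear H H (T t) \<and> (\<forall>u\<in>hcarrier H. hnorm H (T t u) \<le> hnorm H u)) \<and>
     (\<forall>u\<in>hcarrier H. T 0 u = u) \<and>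
     (\<forall>r\<ge>0. \<forall>t\<ge>0. \<forall>u\<in>hcarrier H. T (r + t) u = T r (T t u)) \<and>
     (\<forall>u\<in>hcarrier H. ((\<lambda>t. hdist H (T t u) u) \<longlongrightarrow> 0) (at_right 0)) \<and>
     (\<forall>u\<in>hcarrier H. \<forall>w\<in>hcarrier H. form_operator H Q u w \<longleftrightarrow>
        ((\<lambda>t. hdist H (hscale H (1 / t) (hdiff H (T t u) u)) w) \<longlongrightarrow> 0) (at_right 0))"


section \<open>Measurable fields and direct integrals\<close>

text \<open>Throughout, \<open>N\<close> is the base measure space, measurability is with respect to its completion,
  and only the values of a vector field on \<open>space N\<close> matter; fields are not required to be
  extensional.\<close>

definition total_sequence_in :: "'z measure \<Rightarrow> ('z \<Rightarrow> 'h hspace) \<Rightarrow> ('z \<Rightarrow> 'h) set \<Rightarrow> bool" where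
  "total_sequence_in N H S \<longleftrightarrow>
     (\<exists>w :: nat \<Rightarrow> 'z \<Rightarrow> 'h. (\<forall>n. w n \<in> S) \<and>
        (\<forall>z\<in>space N. htotal (H z) (range (\<lambda>n. w n z))))"

definition measurable_hilbert_field ::
    "'z measure \<Rightarrow> ('z \<Rightarrow> 'h hspace) \<Rightarrow> ('z \<Rightarrow> 'h) set \<Rightarrow> bool" where
  "measurable_hilbert_field N H S \<longleftrightarrow>
     (\<forall>z\<in>space N. real_hilbert (H z)) \<and>
     S \<subseteq> (\<Pi> z\<in>space N. hcarrier (H z)) \<and>
     (\<lambda>z. hzero (H z)) \<in> S \<and>
     (\<forall>u\<in>S. \<forall>v\<in>S. (\<lambda>z. hadd (H z) (u z) (v z)) \<in> S) \<and>
     (\<forall>c. \<forall>u\<in>S. (\<lambda>z. hscale (H z) c (u z)) \<in> S) \<and>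
     (\<forall>u\<in>S. (\<lambda>z. hnorm (H z) (u z)) \<in> borel_measurable (completion N)) \<and>
     (\<forall>v\<in>(\<Pi> z\<in>space N. hcarrier (H z)).
        (\<forall>u\<in>S. (\<lambda>z. hinner (H z) (u z) (v z)) \<in> borel_measurable (completion N)) \<longrightarrow> v \<in> S) \<and>
     total_sequence_in N H S"

definition field_generated_by ::
    "'z measure \<Rightarrow> ('z \<Rightarrow> 'h hspace) \<Rightarrow> ('z \<Rightarrow> 'h) set \<Rightarrow> ('z \<Rightarrow> 'h) set \<Rightarrow> bool" where
  "field_generated_by N H F S \<longleftrightarrow>
     (\<forall>u\<in>F. (\<lambda>z. hnorm (H z) (u z)) \<in> borel_measurable (completion N)) \<and>
     total_sequence_in N H F \<and>
     measurable_hilbert_field N H S \<and> F \<subseteq> S"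

definition square_integrable_field ::
    "'z measure \<Rightarrow> ('z \<Rightarrow> 'h hspace) \<Rightarrow> ('z \<Rightarrow> 'h) \<Rightarrow> bool" where
  "square_integrable_field N H u \<longleftrightarrow>
     (\<integral>\<^sup>+ z. ennreal ((hnorm (H z) (u z))\<^sup>2) \<partial>completion N) < \<infinity>"

definition field_class ::
    "'z measure \<Rightarrow> ('z \<Rightarrow> 'h hspace) \<Rightarrow> ('z \<Rightarrow> 'h) set \<Rightarrow> ('z \<Rightarrow> 'h) \<Rightarrow> ('z \<Rightarrow> 'h) set" where
  "field_class N H S u = {v \<in> S. square_integrable_field N H v \<and> (AE z in N. v z = u z)}"

definition field_rep :: "('z \<Rightarrow> 'h) set \<Rightarrow> 'z \<Rightarrow> 'h" where
  "field_rep P = (SOME u. u \<in> P)"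

definition direct_integral ::
    "'z measure \<Rightarrow> ('z \<Rightarrow> 'h hspace) \<Rightarrow> ('z \<Rightarrow> 'h) set \<Rightarrow> ('z \<Rightarrow> 'h) set hspace" where
  "direct_integral N H S =
     \<lparr>hcarrier = field_class N H S ` {u \<in> S. square_integrable_field N H u},
      hzero = field_class N H S (\<lambda>z. hzero (H z)),
      hadd = (\<lambda>P R. field_class N H S (\<lambda>z. hadd (H z) (field_rep P z) (field_rep R z))),
      hscale = (\<lambda>c P. field_class N H S (\<lambda>z. hscale (H z) c (field_rep P z))),
      hinner = (\<lambda>P R. LINT z|completion N. hinner (H z) (field_rep P z) (field_rep R z))\<rparr>"

definition measurable_operator_field ::
    "'z measure \<Rightarrow> ('z \<Rightarrow> 'h hspace) \<Rightarrow> ('z \<Rightarrow> 'h) set \<Rightarrow> ('z \<Rightarrow> 'k hspace) \<Rightarrow> ('z \<Rightarrow> 'k) set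
      \<Rightarrow> ('z \<Rightarrow> 'h \<Rightarrow> 'k) \<Rightarrow> bool" where
  "measurable_operator_field N H S K R B \<longleftrightarrow>
     (\<forall>z\<in>space N. hbounded (H z) (K z) (B z)) \<and> (\<forall>u\<in>S. (\<lambda>z. B z (u z)) \<in> R)"

definition direct_integral_operator ::
    "'z measure \<Rightarrow> ('z \<Rightarrow> 'k hspace) \<Rightarrow> ('z \<Rightarrow> 'k) set \<Rightarrow> ('z \<Rightarrow> 'h \<Rightarrow> 'k)
      \<Rightarrow> ('z \<Rightarrow> 'h) set \<Rightarrow> ('z \<Rightarrow> 'k) set" where
  "direct_integral_operator N K R B P = field_class N K R (\<lambda>z. B z (field_rep P z))"

definition measurable_form_field ::
    "'z measure \<Rightarrow> ('z \<Rightarrow> 'h hspace) \<Rightarrow> ('z \<Rightarrow> 'h) set \<Rightarrow> ('z \<Rightarrow> 'h \<Rightarrow> ennreal) \<Rightarrow> ('z \<Rightarrow> 'h) set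
      \<Rightarrow> bool" where
  "measurable_form_field N H SH Q SQ \<longleftrightarrow>
     (\<forall>z\<in>space N. closed_form (H z) (Q z)) \<and>
     measurable_hilbert_field N H SH \<and>
     measurable_hilbert_field N (\<lambda>z. form_space (H z) (Q z)) SQ \<and>
     SQ \<subseteq> SH"

text \<open>A class is in the domain iff it has a representative in \<open>SQ\<close> with finite \<open>Q\<^sub>1\<close>-integral. All
  such representatives are a.e. equal, so the infimum is over at most one value, and it is
  \<open>\<infinity>\<close> outside the domain.\<close>

definition direct_integral_form ::
    "'z measure \<Rightarrow> ('z \<Rightarrow> 'h hspace) \<Rightarrow> ('z \<Rightarrow> 'h \<Rightarrow> ennreal) \<Rightarrow> ('z \<Rightarrow> 'h) set
      \<Rightarrow> ('z \<Rightarrow> 'h) set \<Rightarrow> ennreal" where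
  "direct_integral_form N H Q SQ P =
     (INF u \<in> {u \<in> P \<inter> SQ.
          (\<integral>\<^sup>+ z. Q z (u z) + ennreal ((hnorm (H z) (u z))\<^sup>2) \<partial>completion N) < \<infinity>}.
        \<integral>\<^sup>+ z. Q z (u z) \<partial>completion N)"


section \<open>The space \<open>L\<^sup>2\<close> and Dirichlet forms\<close>

definition sq_integrable :: "'x measure \<Rightarrow> ('x \<Rightarrow> real) set" where
  "sq_integrable M = {f \<in> borel_measurable (completion M). integrable (completion M) (\<lambda>x. (f x)\<^sup>2)}"

definition L2_class :: "'x measure \<Rightarrow> ('x \<Rightarrow> real) \<Rightarrow> ('x \<Rightarrow> real) set" where
  "L2_class M f = {g \<in> sq_integrable M. AE x in M. g x = f x}"

definition L2_rep :: "('x \<Rightarrow> real) set \<Rightarrow> 'x \<Rightarrow> real" where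
  "L2_rep F = (SOME f. f \<in> F)"

definition L2 :: "'x measure \<Rightarrow> ('x \<Rightarrow> real) set hspace" where
  "L2 M =
     \<lparr>hcarrier = L2_class M ` sq_integrable M,
      hzero = L2_class M (\<lambda>x. 0),
      hadd = (\<lambda>F G. L2_class M (\<lambda>x. L2_rep F x + L2_rep G x)),
      hscale = (\<lambda>c F. L2_class M (\<lambda>x. c * L2_rep F x)),
      hinner = (\<lambda>F G. LINT x|completion M. L2_rep F x * L2_rep G x)\<rparr>"

definition L2_nonneg :: "'x measure \<Rightarrow> ('x \<Rightarrow> real) set \<Rightarrow> bool" where
  "L2_nonneg M F \<longleftrightarrow> (AE x in M. 0 \<le> L2_rep F x)"

definition order_preserving ::
    "'x measure \<Rightarrow> 'y measure \<Rightarrow> (('x \<Rightarrow> real) set \<Rightarrow> ('y \<Rightarrow> real) set) \<Rightarrow> bool" where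
  "order_preserving M M' U \<longleftrightarrow> (\<forall>F\<in>hcarrier (L2 M). L2_nonneg M F \<longrightarrow> L2_nonneg M' (U F))"

definition order_isomorphism ::
    "'x measure \<Rightarrow> 'y measure \<Rightarrow> (('x \<Rightarrow> real) set \<Rightarrow> ('y \<Rightarrow> real) set) \<Rightarrow> bool" where
  "order_isomorphism M M' U \<longleftrightarrow>
     hlinear (L2 M) (L2 M') U \<and> bij_betw U (hcarrier (L2 M)) (hcarrier (L2 M')) \<and>
     order_preserving M M' U \<and> order_preserving M' M (the_inv_into (hcarrier (L2 M)) U)"

definition dirichlet_form :: "'x measure \<Rightarrow> (('x \<Rightarrow> real) set \<Rightarrow> ennreal) \<Rightarrow> bool" where
  "dirichlet_form M E \<longleftrightarrow> closed_form (L2 M) E \<and>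
     (\<forall>f\<in>sq_integrable M. L2_class M f \<in> form_dom (L2 M) E \<longrightarrow>
        L2_class M (\<lambda>x. min (max (f x) 0) 1) \<in> form_dom (L2 M) E \<and>
        E (L2_class M (\<lambda>x. min (max (f x) 0) 1)) \<le> E (L2_class M f))"


section \<open>Measure spaces and disintegrations\<close>

text \<open>In a topological measure space all open sets belong to the given \<open>\<sigma>\<close>-algebra.\<close>

definition radon_measure_space :: "'x::t2_space measure \<Rightarrow> bool" where
  "radon_measure_space M \<longleftrightarrow>
     sets borel \<subseteq> sets M \<and>
     sets (completion M) = sets (completion (restr_to_subalg M borel)) \<and>
     (\<forall>x. \<exists>V. open V \<and> x \<in> V \<and> emeasure (completion M) V < \<infinity>) \<and>
     (\<forall>A\<in>sets (completion M).
        emeasure (completion M) A =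
          (SUP K \<in> {K. compact K \<and> K \<subseteq> A}. emeasure (completion M) K))"

definition separable_measurable_space :: "'z measure \<Rightarrow> bool" where
  "separable_measurable_space N \<longleftrightarrow> (\<forall>z\<in>space N. {z} \<in> sets N)"

definition countably_generated :: "'z measure \<Rightarrow> bool" where
  "countably_generated N \<longleftrightarrow>
     (\<exists>C. countable C \<and> C \<subseteq> Pow (space N) \<and> sets N = sigma_sets (space N) C)"

definition pseudo_disintegration :: "'x measure \<Rightarrow> 'z measure \<Rightarrow> ('z \<Rightarrow> 'x measure) \<Rightarrow> bool" where
  "pseudo_disintegration M N m \<longleftrightarrow>
     (\<forall>z\<in>space N. sets (m z) = sets M \<and> emeasure (m z) (space M) \<noteq> 0) \<and>
     (\<forall>A\<in>sets M. (\<lambda>z. emeasure (m z) A) \<in> borel_measurable (completion N) \<and>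
        emeasure M A = (\<integral>\<^sup>+ z. emeasure (m z) A \<partial>completion N))"

definition separated :: "('x \<Rightarrow> 'z) \<Rightarrow> 'z measure \<Rightarrow> ('z \<Rightarrow> 'x measure) \<Rightarrow> bool" where
  "separated s N m \<longleftrightarrow> (AE z in N. AE x in m z. s x = z)"

definition delta :: "('z \<Rightarrow> 'x measure) \<Rightarrow> ('x \<Rightarrow> real) \<Rightarrow> 'z \<Rightarrow> ('x \<Rightarrow> real) set" where
  "delta m f z = (if f \<in> sq_integrable (m z) then L2_class (m z) f else hzero (L2 (m z)))"

text \<open>The identification of \<open>L\<^sup>2(\<mu>)\<close> with the direct integral of the \<open>L\<^sup>2(\<mu>\<^sub>z)\<close>, and forms and
  operators transported along it; \<open>SH\<close> is the underlying space of the field of \<open>L\<^sup>2\<close> spaces.\<close>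

definition L2_to_direct_integral ::
    "'z measure \<Rightarrow> ('z \<Rightarrow> 'x measure) \<Rightarrow> ('z \<Rightarrow> ('x \<Rightarrow> real) set) set
      \<Rightarrow> ('x \<Rightarrow> real) set \<Rightarrow> ('z \<Rightarrow> ('x \<Rightarrow> real) set) set" where
  "L2_to_direct_integral N m SH F = field_class N (\<lambda>z. L2 (m z)) SH (delta m (L2_rep F))"

definition L2_direct_integral_form ::
    "'z measure \<Rightarrow> ('z \<Rightarrow> 'x measure) \<Rightarrow> ('z \<Rightarrow> ('x \<Rightarrow> real) set) set
      \<Rightarrow> ('z \<Rightarrow> ('x \<Rightarrow> real) set \<Rightarrow> ennreal) \<Rightarrow> ('z \<Rightarrow> ('x \<Rightarrow> real) set) set
      \<Rightarrow> ('x \<Rightarrow> real) set \<Rightarrow> ennreal" where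
  "L2_direct_integral_form N m SH E SQ F =
     direct_integral_form N (\<lambda>z. L2 (m z)) E SQ (L2_to_direct_integral N m SH F)"

definition L2_direct_integral_operator ::
    "'x measure \<Rightarrow> 'z measure \<Rightarrow> ('z \<Rightarrow> 'x measure) \<Rightarrow> ('z \<Rightarrow> ('x \<Rightarrow> real) set) set
      \<Rightarrow> ('z \<Rightarrow> 'x measure) \<Rightarrow> ('z \<Rightarrow> ('x \<Rightarrow> real) set) set
      \<Rightarrow> ('z \<Rightarrow> ('x \<Rightarrow> real) set \<Rightarrow> ('x \<Rightarrow> real) set)
      \<Rightarrow> ('x \<Rightarrow> real) set \<Rightarrow> ('x \<Rightarrow> real) set" where
  "L2_direct_integral_operator M N m SH m' SH' B F =
     the_inv_into (hcarrier (L2 M)) (L2_to_direct_integral N m' SH')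
       (direct_integral_operator N (\<lambda>z. L2 (m' z)) SH' B (L2_to_direct_integral N m SH F))"

definition compatible ::
    "'x measure \<Rightarrow> 'z measure \<Rightarrow> ('z \<Rightarrow> 'x measure) \<Rightarrow> ('z \<Rightarrow> ('x \<Rightarrow> real) set) set
      \<Rightarrow> ('z \<Rightarrow> ('x \<Rightarrow> real) set \<Rightarrow> ennreal) \<Rightarrow> ('z \<Rightarrow> ('x \<Rightarrow> real) set) set \<Rightarrow> bool" where
  "compatible M N m SH E SQ \<longleftrightarrow>
     (\<exists>A \<subseteq> sq_integrable M.
        (\<lambda>x. 0) \<in> A \<and> (\<forall>f\<in>A. \<forall>g\<in>A. (\<lambda>x. f x + g x) \<in> A) \<and> (\<forall>c. \<forall>f\<in>A. (\<lambda>x. c * f x) \<in> A) \<and>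
        hdense (L2 M) (L2_class M ` A) \<and>
        field_generated_by N (\<lambda>z. form_space (L2 (m z)) (E z)) (delta m ` A) SQ \<and>
        L2_class M ` A \<subseteq> form_dom (L2 M) (L2_direct_integral_form N m SH E SQ))"

end

theory Submission
  imports Defs
begin

text \<open>Forms are never compared directly. A pair \<open>(F, W)\<close> belongs to the generator of the direct
  integral form iff almost every pair of fibres \<open>(F\<^sub>z, W\<^sub>z)\<close> belongs to the generator of the form on
  the fibre, and the fibrewise generators are intertwined by \<open>U\<^sub>z\<close> since the semigroups are. Hence
  \<open>U\<close> intertwines the generators of the two direct integral forms. A contraction semigroup is
  determined by its generator as soon as the generator is densely defined. Density comes from the
  fibrewise resolvents \<open>G\<^sub>z = (1 - L\<^sub>z)\<^sup>-\<^sup>1\<close>, which preserve measurability: iterating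
  \<open>r \<mapsto> r - G r\<close> on a vector \<open>u\<close> of finite energy decreases the energy by at least twice the squared
  norm of the new residual, so the residuals come arbitrarily close to 0, while the accumulated
  differences \<open>u - r\<close> stay in the domain of the generator. That \<open>L\<^sup>2(\<mu>)\<close> is the full direct integral
  is proved by measurable selection, without projections.\<close>

section \<open>Hilbert spaces and closed forms with explicit carriers\<close>

text \<open>The semigroups on \<open>L2 M\<close> enter only as contraction semigroups with a
  prescribed generator; they are never decomposed into fibre semigroups. Neither completeness of
  \<open>L2 M\<close> nor closedness of the direct integral forms is established:
  \<open>L2 M\<close> is treated as a pre-Hilbert space, and whatever rests on closedness, such as
  the existence of resolvents, is obtained on the fibres and then glued. The obstacle is to pass
  from an identity integrated over the base to one on almost every fibre, with a single null set for
  all test vectors. Compatibility overcomes it: it provides countably many functions in the domain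
  of the direct integral form whose fibres are dense in the form norm, and cutting their fields off
  by indicators of sets of the base localises the identity. The map \<open>s\<close> leads back from
  fields to functions: it tells on which fibre a point lies, so that an index chosen measurably over
  the base becomes a measurable function on the total space.\<close>

locale pre_hilbert =
  fixes H :: "'h hspace"
  assumes zero_closed [simp]: "hzero H \<in> hcarrier H"
    and add_closed [simp]: "\<lbrakk>u \<in> hcarrier H; v \<in> hcarrier H\<rbrakk> \<Longrightarrow> hadd H u v \<in> hcarrier H"
    and scale_closed [simp]: "u \<in> hcarrier H \<Longrightarrow> hscale H c u \<in> hcarrier H"
    and add_zero: "u \<in> hcarrier H \<Longrightarrow> hadd H u (hzero H) = u"
    and inner_commute: "\<lbrakk>u \<in> hcarrier H; v \<in> hcarrier H\<rbrakk> \<Longrightarrow> hinner H u v = hinner H v u"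
    and inner_add_left [simp]: "\<lbrakk>u \<in> hcarrier H; v \<in> hcarrier H; w \<in> hcarrier H\<rbrakk>
      \<Longrightarrow> hinner H (hadd H u v) w = hinner H u w + hinner H v w"
    and inner_scale_left [simp]: "\<lbrakk>u \<in> hcarrier H; v \<in> hcarrier H\<rbrakk>
      \<Longrightarrow> hinner H (hscale H c u) v = c * hinner H u v"
    and inner_nonneg: "u \<in> hcarrier H \<Longrightarrow> 0 \<le> hinner H u u"
    and diff_null: "\<lbrakk>u \<in> hcarrier H; v \<in> hcarrier H; hinner H (hdiff H u v) (hdiff H u v) = 0\<rbrakk>
      \<Longrightarrow> u = v"
begin

lemma diff_closed [simp]: "u \<in> hcarrier H \<Longrightarrow> v \<in> hcarrier H \<Longrightarrow> hdiff H u v \<in> hcarrier H"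
  by (simp add: hdiff_def)

lemma inner_add_right [simp]:
  "\<lbrakk>u \<in> hcarrier H; v \<in> hcarrier H; w \<in> hcarrier H\<rbrakk> \<Longrightarrow> hinner H w (hadd H u v) = hinner H w u + hinner H w v"
  by (metis add_closed inner_add_left inner_commute)

lemma inner_scale_right [simp]:
  "\<lbrakk>u \<in> hcarrier H; v \<in> hcarrier H\<rbrakk> \<Longrightarrow> hinner H v (hscale H c u) = c * hinner H v u"
  by (metis scale_closed inner_scale_left inner_commute)

lemma inner_diff_left [simp]:
  "\<lbrakk>u \<in> hcarrier H; v \<in> hcarrier H; w \<in> hcarrier H\<rbrakk> \<Longrightarrow> hinner H (hdiff H u v) w = hinner H u w - hinner H v w"
  by (simp add: hdiff_def)

lemma inner_diff_right [simp]:
  "\<lbrakk>u \<in> hcarrier H; v \<in> hcarrier H; w \<in> hcarrier H\<rbrakk> \<Longrightarrow> hinner H w (hdiff H u v) = hinner H w u - hinner H w v"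
  by (simp add: hdiff_def)

lemma inner_zero_left [simp]: "u \<in> hcarrier H \<Longrightarrow> hinner H (hzero H) u = 0"
  using inner_add_left[of "hzero H" "hzero H" u] add_zero[of "hzero H"] by simp

lemma inner_zero_right [simp]: "u \<in> hcarrier H \<Longrightarrow> hinner H u (hzero H) = 0"
  by (metis inner_commute inner_zero_left zero_closed)

text \<open>Definiteness in the form \<open>diff_null\<close> replaces associativity and the other
  vector space laws: after pairing with an arbitrary \<open>w\<close>, an identity between linear
  combinations is an identity of real numbers.\<close>

lemma vec_eqI:
  assumes "x \<in> hcarrier H" "y \<in> hcarrier H" "\<And>w. w \<in> hcarrier H \<Longrightarrow> hinner H x w = hinner H y w"
  shows "x = y"
  by (rule diff_null) (use assms in auto)

lemma norm_nonneg [simp]: "u \<in> hcarrier H \<Longrightarrow> 0 \<le> hnorm H u"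
  by (simp add: hnorm_def inner_nonneg)

lemma norm_sq: "u \<in> hcarrier H \<Longrightarrow> (hnorm H u)\<^sup>2 = hinner H u u"
  by (simp add: hnorm_def inner_nonneg)

lemma norm_zero [simp]: "hnorm H (hzero H) = 0"
  by (simp add: hnorm_def)

lemma norm_scale: "u \<in> hcarrier H \<Longrightarrow> hnorm H (hscale H c u) = \<bar>c\<bar> * hnorm H u"
  by (simp add: hnorm_def real_sqrt_mult[symmetric] real_sqrt_abs2[symmetric] mult.assoc
      del: real_sqrt_abs2)

lemma polarization:
  assumes "u \<in> hcarrier H" "v \<in> hcarrier H"
  shows "hinner H u v = ((hnorm H (hadd H u v))\<^sup>2 - (hnorm H (hdiff H u v))\<^sup>2) / 4"
  using assms by (simp add: norm_sq algebra_simps inner_commute[of v u])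

lemma Cauchy_Schwarz:
  assumes u: "u \<in> hcarrier H" and v: "v \<in> hcarrier H"
  shows "\<bar>hinner H u v\<bar> \<le> hnorm H u * hnorm H v"
proof -
  define a b c where "a = hinner H u u" and "b = hinner H u v" and "c = hinner H v v"
  have a0: "0 \<le> a" and c0: "0 \<le> c" using u v by (auto simp: a_def c_def inner_nonneg)
  have quad: "0 \<le> a - 2 * t * b + t\<^sup>2 * c" for t
    using inner_nonneg[of "hdiff H u (hscale H t v)"] u v
    by (simp add: a_def b_def c_def inner_commute[of v u] algebra_simps power2_eq_square)
  have "b\<^sup>2 \<le> a * c"
  proof (cases "c = 0")
    case True
    have "b = 0"
    proof (rule ccontr)
      assume "b \<noteq> 0"
      \<comment> \<open>For \<open>c = 0\<close> the quadratic is affine in \<open>t\<close>, and at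
        this \<open>t\<close> its value is \<open>-1\<close>.\<close>
      then show False using quad[of "(a + 1) / (2 * b)"] True by (simp add: field_simps)
    qed
    then show ?thesis using True by simp
  next
    case False
    \<comment> \<open>The quadratic is smallest at \<open>b / c\<close>.\<close>
    then show ?thesis using quad[of "b / c"] c0
      by (simp add: field_simps power2_eq_square)
  qed
  then have "\<bar>b\<bar> \<le> sqrt (a * c)" by (metis real_sqrt_abs real_sqrt_le_iff)
  then show ?thesis by (simp add: hnorm_def a_def b_def c_def real_sqrt_mult)
qed

lemma norm_triangle:
  assumes u: "u \<in> hcarrier H" and v: "v \<in> hcarrier H"
  shows "hnorm H (hadd H u v) \<le> hnorm H u + hnorm H v"
proof (rule power2_le_imp_le)
  have "(hnorm H (hadd H u v))\<^sup>2 = (hnorm H u)\<^sup>2 + 2 * hinner H u v + (hnorm H v)\<^sup>2"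
    using u v by (simp add: norm_sq inner_commute[of v u])
  also have "\<dots> \<le> (hnorm H u + hnorm H v)\<^sup>2"
    using Cauchy_Schwarz[OF u v] by (simp add: power2_sum)
  finally show "(hnorm H (hadd H u v))\<^sup>2 \<le> (hnorm H u + hnorm H v)\<^sup>2" .
qed (use u v in simp)

lemma dist_triangle:
  assumes "u \<in> hcarrier H" "v \<in> hcarrier H" "w \<in> hcarrier H"
  shows "hdist H u w \<le> hdist H u v + hdist H v w"
proof -
  have "hdiff H u w = hadd H (hdiff H u v) (hdiff H v w)"
    by (rule vec_eqI) (use assms in auto)
  then show ?thesis using assms by (simp add: hdist_def norm_triangle)
qed

lemma dist_nonneg [simp]: "u \<in> hcarrier H \<Longrightarrow> v \<in> hcarrier H \<Longrightarrow> 0 \<le> hdist H u v"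
  by (simp add: hdist_def)

lemma dist_commute: 
  assumes "u \<in> hcarrier H" "v \<in> hcarrier H" shows "hdist H u v = hdist H v u"
  using assms by (simp add: hdist_def hnorm_def algebra_simps)

lemma dist_self [simp]: "u \<in> hcarrier H \<Longrightarrow> hdist H u u = 0"
  by (simp add: hdist_def hnorm_def)

lemma dist_zeroD: "u \<in> hcarrier H \<Longrightarrow> v \<in> hcarrier H \<Longrightarrow> hdist H u v = 0 \<Longrightarrow> u = v"
  by (rule diff_null) (auto simp: hdist_def hnorm_def)

lemma norm_diff_le_dist:
  assumes "u \<in> hcarrier H" "v \<in> hcarrier H"
  shows "\<bar>hnorm H u - hnorm H v\<bar> \<le> hdist H u v"
proof -
  have *: "hdist H w (hzero H) = hnorm H w" if "w \<in> hcarrier H" for w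
    using that by (simp add: hdist_def hnorm_def)
  show ?thesis
    using dist_triangle[of u v "hzero H"] dist_triangle[of v u "hzero H"] assms
    by (simp add: * dist_commute[of v u])
qed

lemma dist_add_add:
  assumes "u \<in> hcarrier H" "v \<in> hcarrier H" "u' \<in> hcarrier H" "v' \<in> hcarrier H"
  shows "hdist H (hadd H u v) (hadd H u' v') \<le> hdist H u u' + hdist H v v'"
proof -
  have "hdiff H (hadd H u v) (hadd H u' v') = hadd H (hdiff H u u') (hdiff H v v')"
    by (rule vec_eqI) (use assms in auto)
  then show ?thesis using assms by (simp add: hdist_def norm_triangle)
qed

lemma dist_scale_scale:
  assumes "u \<in> hcarrier H" "v \<in> hcarrier H"
  shows "hdist H (hscale H c u) (hscale H d v) \<le> \<bar>c - d\<bar> * hnorm H u + \<bar>d\<bar> * hdist H u v"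
proof -
  have "hdiff H (hscale H c u) (hscale H d v) =
      hadd H (hscale H (c - d) u) (hscale H d (hdiff H u v))"
    by (rule vec_eqI) (use assms in \<open>auto simp: algebra_simps\<close>)
  then show ?thesis
    using assms norm_triangle[of "hscale H (c - d) u" "hscale H d (hdiff H u v)"]
    by (simp add: hdist_def norm_scale)
qed

end

sublocale real_hilbert \<subseteq> pre_hilbert H
proof
  fix u v assume u: "u \<in> hcarrier H" and v: "v \<in> hcarrier H"
    and 0: "hinner H (hdiff H u v) (hdiff H u v) = 0"
  have nv: "hscale H (- 1) v \<in> hcarrier H" using v by (rule scale_closed)
  have "hadd H u (hscale H (- 1) v) = hzero H"
    using inner_eq_zero[of "hdiff H u v"] 0 u nv by (simp add: hdiff_def add_closed)
  then have "hadd H (hadd H u (hscale H (- 1) v)) v = hadd H (hzero H) v" by simp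
  moreover have "hadd H (hadd H u (hscale H (- 1) v)) v = u"
    using u v nv by (simp add: add_assoc add_commute[of "hscale H (- 1) v" v] add_inverse add_zero)
  moreover have "hadd H (hzero H) v = v"
    using v zero_closed by (simp add: add_commute[of "hzero H" v] add_zero)
  ultimately show "u = v" by simp
qed (auto intro: zero_closed add_closed scale_closed add_zero inner_commute inner_add_left
    inner_scale_left inner_nonneg)

text \<open>Polarization recovers the inner product from the norm. For the direct integral of the
  unitaries only norms then have to be compared, and these come from integrating over the
  fibres.\<close>

lemma unitary_imp_isometry:
  assumes "pre_hilbert H" "pre_hilbert K" and lin: "hlinear H K B"
    and norm: "\<And>u. u \<in> hcarrier H \<Longrightarrow> hnorm K (B u) = hnorm H u"
    and u: "u \<in> hcarrier H" and v: "v \<in> hcarrier H"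
  shows "hinner K (B u) (B v) = hinner H u v"
proof -
  interpret H: pre_hilbert H by fact
  interpret K: pre_hilbert K by fact
  have B: "B w \<in> hcarrier K" if "w \<in> hcarrier H" for w
    using lin that by (auto simp: hlinear_def)
  have "B (hadd H u v) = hadd K (B u) (B v)" "B (hdiff H u v) = hdiff K (B u) (B v)"
    using lin u v by (auto simp: hlinear_def hdiff_def)
  then show ?thesis
    using H.polarization[OF u v] K.polarization[OF B[OF u] B[OF v]] u v
    by (metis norm H.add_closed H.diff_closed)
qed

text \<open>The expression vanishes at \<open>t = 0\<close>, so it has its minimum there and its
  derivative \<open>2 * b\<close> is zero. This is the first-order condition at the minimiser in the
  Riesz representation.\<close>

lemma quadratic_nonneg_imp_linear_zero:
  fixes a b :: real
  assumes "\<And>t. 0 \<le> t\<^sup>2 * a + 2 * t * b"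
  shows "b = 0"
proof (rule ccontr)
  assume b: "b \<noteq> 0"
  have a0: "0 \<le> a" using assms[of 1] assms[of "-1"] by simp
  \<comment> \<open>The value at \<open>- c\<close> is \<open>- c^2 (a + 2)\<close>; dividing by
    \<open>a + 1\<close> rather than by \<open>a\<close> includes the case
    \<open>a = 0\<close>.\<close>
  define c where "c = b / (a + 1)"
  have b_eq: "b = c * (a + 1)" using a0 by (simp add: c_def)
  have "0 \<le> c\<^sup>2 * a - 2 * c * b" using assms[of "- c"] by simp
  also have "\<dots> = - (c\<^sup>2 * (a + 2))" by (simp add: b_eq power2_eq_square algebra_simps)
  also have "\<dots> < 0" using a0 b b_eq by auto
  finally show False by simp
qed

context real_hilbert
begin

text \<open>The representing vector minimises \<open>\<parallel>v\<parallel>\<^sup>2 - 2 \<phi>(v)\<close>.\<close>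

lemma Riesz_representation:
  assumes add: "\<And>u v. u \<in> hcarrier H \<Longrightarrow> v \<in> hcarrier H \<Longrightarrow> \<phi> (hadd H u v) = \<phi> u + \<phi> v"
    and scale: "\<And>c u. u \<in> hcarrier H \<Longrightarrow> \<phi> (hscale H c u) = c * \<phi> u"
    and bound: "\<And>u. u \<in> hcarrier H \<Longrightarrow> \<bar>\<phi> u\<bar> \<le> C * hnorm H u"
  shows "\<exists>g\<in>hcarrier H. \<forall>v\<in>hcarrier H. hinner H g v = \<phi> v"
proof -
  define J where "J v = hinner H v v - 2 * \<phi> v" for v
  have diff: "\<phi> (hdiff H u v) = \<phi> u - \<phi> v" if "u \<in> hcarrier H" "v \<in> hcarrier H" for u v
    using that by (simp add: hdiff_def add scale)
  have below: "- C\<^sup>2 \<le> J v" if "v \<in> hcarrier H" for v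
  proof -
    have "0 \<le> (hnorm H v - C)\<^sup>2" by simp
    then show ?thesis using bound[OF that] norm_sq[OF that]
      by (simp add: J_def power2_diff abs_le_iff algebra_simps)
  qed
  define I where "I = Inf (J ` hcarrier H)"
  have bdd: "bdd_below (J ` hcarrier H)" using below by (auto simp: bdd_below_def)
  have I_le: "I \<le> J v" if "v \<in> hcarrier H" for v
    unfolding I_def using that bdd by (auto intro: cInf_lower)
  have "\<exists>v\<in>hcarrier H. J v < I + 1 / real (Suc n)" for n
  proof -
    have "J ` hcarrier H \<noteq> {}" using zero_closed by blast
    then have "(\<exists>y\<in>J ` hcarrier H. y < I + 1 / real (Suc n))"
      using cInf_less_iff[of "J ` hcarrier H" "I + 1 / real (Suc n)"] bdd by (simp add: I_def)
    then show ?thesis by blast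
  qed
  then obtain x where x: "\<And>n. x n \<in> hcarrier H" "\<And>n. J (x n) < I + 1 / real (Suc n)"
    by metis
  \<comment> \<open>By the parallelogram law \<open>J\<close> is uniformly convex, and at the
    midpoint it cannot fall below \<open>I\<close>; near-minimisers are therefore close to one
    another.\<close>
  have near: "(hdist H (x m) (x n))\<^sup>2 \<le> 2 / real (Suc m) + 2 / real (Suc n)" for m n
  proof -
    have mid: "hscale H (1/2) (hadd H (x m) (x n)) \<in> hcarrier H" using x by simp
    have "(hdist H (x m) (x n))\<^sup>2 = 2 * J (x m) + 2 * J (x n)
        - 4 * J (hscale H (1/2) (hadd H (x m) (x n)))"
      using x by (simp add: J_def hdist_def norm_sq add scale inner_commute[of "x n" "x m"]
          algebra_simps)
    then show ?thesis using x(2)[of m] x(2)[of n] I_le[OF mid] by simp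
  qed
  have "\<forall>e>0. \<exists>k. \<forall>m\<ge>k. \<forall>n\<ge>k. hdist H (x m) (x n) < e"
  proof (intro allI impI)
    fix e :: real assume e: "e > 0"
    obtain k where k: "4 / e\<^sup>2 < real (Suc k)"
      by (meson reals_Archimedean2 less_le_trans of_nat_le_iff le_SucI order_refl)
    have small: "2 / real (Suc m) < e\<^sup>2 / 2" if "m \<ge> k" for m
    proof -
      have "4 / e\<^sup>2 < real (Suc m)" using k that by linarith
      then have "4 < real (Suc m) * e\<^sup>2" using e by (simp add: pos_divide_less_eq)
      then show ?thesis by (simp add: divide_less_eq mult.commute)
    qed
    show "\<exists>k. \<forall>m\<ge>k. \<forall>n\<ge>k. hdist H (x m) (x n) < e"
    proof (intro exI allI impI)
      fix m n assume "m \<ge> k" "n \<ge> k"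
      then have "(hdist H (x m) (x n))\<^sup>2 < e\<^sup>2"
        using near[of m n] small[of m] small[of n] by linarith
      then show "hdist H (x m) (x n) < e" using e by (simp add: power2_less_imp_less)
    qed
  qed
  then obtain g where g: "g \<in> hcarrier H" and lim: "(\<lambda>n. hdist H (x n) g) \<longlonglongrightarrow> 0"
    using complete[of x] x(1) by blast
  have lim_norm: "(\<lambda>n. hnorm H (x n)) \<longlonglongrightarrow> hnorm H g"
    by (rule Lim_transform_bound[where g = "\<lambda>n. hdist H (x n) g", THEN LIM_zero_cancel])
      (use norm_diff_le_dist[OF x(1) g] lim in \<open>auto simp: x(1) g\<close>)
  have lim_phi: "(\<lambda>n. \<phi> (x n)) \<longlonglongrightarrow> \<phi> g"
  proof (rule LIM_zero_cancel, rule Lim_transform_bound)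
    show "\<forall>\<^sub>F n in sequentially. norm (\<phi> (x n) - \<phi> g) \<le> norm (C * hdist H (x n) g)"
    proof (intro always_eventually allI)
      fix n
      show "norm (\<phi> (x n) - \<phi> g) \<le> norm (C * hdist H (x n) g)"
        using bound[of "hdiff H (x n) g"] x(1)[of n] g
        by (simp add: diff hdist_def)
    qed
    show "(\<lambda>n. C * hdist H (x n) g) \<longlonglongrightarrow> 0" using tendsto_mult_right_zero[OF lim] .
  qed
  have "(\<lambda>n. J (x n)) \<longlonglongrightarrow> J g"
  proof -
    have "(\<lambda>n. (hnorm H (x n))\<^sup>2 - 2 * \<phi> (x n)) \<longlonglongrightarrow> (hnorm H g)\<^sup>2 - 2 * \<phi> g"
      by (intro tendsto_intros lim_norm lim_phi)
    then show ?thesis using x(1) g by (simp add: J_def norm_sq)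
  qed
  moreover have "(\<lambda>n. I + 1 / real (Suc n)) \<longlonglongrightarrow> I"
    using tendsto_add[OF tendsto_const[of I] LIMSEQ_inverse_real_of_nat]
    by (simp add: inverse_eq_divide)
  ultimately have Jg: "J g \<le> I"
    by (rule LIMSEQ_le) (use x(2) in \<open>auto intro: less_imp_le\<close>)
  show ?thesis
  proof (intro bexI[OF _ g] ballI)
    fix v assume v: "v \<in> hcarrier H"
    have "hinner H g v - \<phi> v = 0"
    proof (rule quadratic_nonneg_imp_linear_zero)
      fix t
      have "J g \<le> J (hadd H g (hscale H t v))" using Jg I_le g v by (meson add_closed order_trans scale_closed)
      then show "0 \<le> t\<^sup>2 * hinner H v v + 2 * t * (hinner H g v - \<phi> v)"
        using g v by (simp add: J_def add scale inner_commute[of v g] algebra_simps power2_eq_square)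
    qed
    then show "hinner H g v = \<phi> v" by simp
  qed
qed

end

section \<open>Closed forms, polarization and resolvents\<close>

locale hilbert_form = real_hilbert H for H :: "'h hspace" +
  fixes Q :: "'h \<Rightarrow> ennreal"
  assumes closed: "closed_form H Q"
begin

abbreviation "fdom \<equiv> form_dom H Q"
abbreviation "bil \<equiv> bilinear_of H Q"

sublocale D: real_hilbert "form_space H Q"
  using closed by (simp add: closed_form_def)

lemma form_space_simps [simp]:
  "hcarrier (form_space H Q) = fdom" "hzero (form_space H Q) = hzero H"
  "hadd (form_space H Q) = hadd H" "hscale (form_space H Q) = hscale H"
  "hdiff (form_space H Q) = hdiff H"
  "hinner (form_space H Q) u v = bil u v + hinner H u v"
  by (auto simp: form_space_def hdiff_def fun_eq_iff)

lemma dom_carrier [simp]: "u \<in> fdom \<Longrightarrow> u \<in> hcarrier H"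
  by (simp add: form_dom_def)

lemma finite_on_dom: "u \<in> fdom \<Longrightarrow> Q u < \<infinity>"
  unfolding form_dom_def by blast

lemma dom_closed [simp]:
  "hzero H \<in> fdom" "u \<in> fdom \<Longrightarrow> v \<in> fdom \<Longrightarrow> hadd H u v \<in> fdom"
  "u \<in> fdom \<Longrightarrow> hscale H c u \<in> fdom" "u \<in> fdom \<Longrightarrow> v \<in> fdom \<Longrightarrow> hdiff H u v \<in> fdom"
  subgoal using D.zero_closed by (simp only: form_space_simps)
  subgoal using D.add_closed[of u v] by (simp only: form_space_simps)
  subgoal using D.scale_closed[of u c] by (simp only: form_space_simps)
  subgoal using D.diff_closed[of u v] by (simp only: form_space_simps)
  done

lemma parallelogram:
  "u \<in> hcarrier H \<Longrightarrow> v \<in> hcarrier H \<Longrightarrow> Q (hadd H u v) + Q (hdiff H u v) = 2 * Q u + 2 * Q v"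
  using closed by (simp add: closed_form_def quadratic_form_def)

lemma dom_dense: "hdense H fdom"
  using closed by (simp add: closed_form_def quadratic_form_def)

lemma bil_add_left: "\<lbrakk>u \<in> fdom; v \<in> fdom; w \<in> fdom\<rbrakk> \<Longrightarrow> bil (hadd H u v) w = bil u w + bil v w"
  using D.inner_add_left[of u v w] by simp

lemma bil_scale_left: "\<lbrakk>u \<in> fdom; v \<in> fdom\<rbrakk> \<Longrightarrow> bil (hscale H c u) v = c * bil u v"
  using D.inner_scale_left[of u v c] by (simp add: algebra_simps)

lemma bil_commute: "\<lbrakk>u \<in> fdom; v \<in> fdom\<rbrakk> \<Longrightarrow> bil u v = bil v u"
  using D.inner_commute[of u v] inner_commute[of u v] by simp

lemma bil_diff_left: "\<lbrakk>u \<in> fdom; v \<in> fdom; w \<in> fdom\<rbrakk> \<Longrightarrow> bil (hdiff H u v) w = bil u w - bil v w"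
  by (simp add: hdiff_def bil_add_left bil_scale_left)

lemma bil_diff_right: "\<lbrakk>u \<in> fdom; v \<in> fdom; w \<in> fdom\<rbrakk> \<Longrightarrow> bil w (hdiff H u v) = bil w u - bil w v"
  using bil_diff_left[of u v w] bil_commute[of w] by simp

text \<open>At the zero vector the parallelogram identity reads \<open>2 q = 4 q\<close>. Infinity
  solves this too; it is excluded because the zero vector belongs to the form domain.\<close>

lemma Q_zero: "Q (hzero H) = 0"
proof -
  have d: "hdiff H (hzero H) (hzero H) = hzero H" by (rule vec_eqI) auto
  obtain r where r: "0 \<le> r" "Q (hzero H) = ennreal r"
    using finite_on_dom[of "hzero H"] by (cases "Q (hzero H)") auto
  have "ennreal r + ennreal r = (ennreal r + ennreal r) + (ennreal r + ennreal r)"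
    using parallelogram[of "hzero H" "hzero H"] by (simp add: d add_zero r mult_2)
  then have "ennreal (r + r) = ennreal ((r + r) + (r + r))"
    by (metis r(1) ennreal_plus add_nonneg_nonneg)
  then have "r + r = (r + r) + (r + r)" using r(1) by (subst (asm) ennreal_inj) auto
  then show ?thesis by (simp add: r)
qed

lemma bil_self:
  assumes u: "u \<in> fdom" shows "bil u u = enn2real (Q u)"
proof -
  have d: "hdiff H u u = hzero H" by (rule vec_eqI) (use u in auto)
  have "Q (hadd H u u) = 4 * Q u"
    using parallelogram[of u u] u by (simp add: d Q_zero flip: distrib_right)
  then show ?thesis by (simp add: bilinear_of_def d Q_zero enn2real_mult)
qed

lemma bil_nonneg: "u \<in> fdom \<Longrightarrow> 0 \<le> bil u u"
  by (simp add: bil_self)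

lemma Q_eq: "u \<in> fdom \<Longrightarrow> Q u = ennreal (bil u u)"
  using finite_on_dom[of u] by (simp add: bil_self)

lemma dist_le_form_dist:
  assumes "u \<in> fdom" "v \<in> fdom" shows "hdist H u v \<le> hdist (form_space H Q) u v"
  using assms bil_nonneg[of "hdiff H u v"] by (simp add: hdist_def hnorm_def)

lemma norm_le_form_norm: "u \<in> fdom \<Longrightarrow> hnorm H u \<le> hnorm (form_space H Q) u"
  using bil_nonneg[of u] by (simp add: hnorm_def)

text \<open>The form norm dominates the norm of \<open>H\<close>, and the form domain is itself
  dense. One sequence that is dense in the form spaces thus serves both the field of form spaces and
  the field of \<open>L2\<close> spaces.\<close>

lemma dense_form_imp_dense:
  assumes "hdense (form_space H Q) D" shows "hdense H D"
  unfolding hdense_def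
proof (intro conjI ballI allI impI)
  have D: "D \<subseteq> fdom" using assms by (simp add: hdense_def)
  then show "D \<subseteq> hcarrier H" by auto
  fix u and e :: real assume u: "u \<in> hcarrier H" and e: "e > 0"
  obtain v where v: "v \<in> fdom" "hdist H u v < e / 2"
    using dom_dense u e unfolding hdense_def by (meson half_gt_zero)
  obtain w where w: "w \<in> D" "hdist (form_space H Q) v w < e / 2"
    using assms v(1) e unfolding hdense_def by (metis form_space_simps(1) half_gt_zero)
  have "w \<in> fdom" using w D by auto
  then have "hdist H u w < e"
    using dist_triangle[of u v w] dist_le_form_dist[of v w] u v w by auto
  then show "\<exists>v\<in>D. hdist H u v < e" using w by blast
qed

text \<open>Riesz representation in the form space, complete because \<open>Q\<close> is closed, of
  the functional \<open>v \<mapsto> hinner H h v\<close>. It is bounded there since the form norm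
  dominates the norm of \<open>H\<close>.\<close>

lemma resolvent_exists:
  assumes h: "h \<in> hcarrier H"
  shows "\<exists>g\<in>fdom. \<forall>v\<in>fdom. bil g v + hinner H g v = hinner H h v"
proof -
  have "\<exists>g\<in>hcarrier (form_space H Q). \<forall>v\<in>hcarrier (form_space H Q).
      hinner (form_space H Q) g v = hinner H h v"
  proof (rule D.Riesz_representation)
    fix u assume u: "u \<in> hcarrier (form_space H Q)"
    have "\<bar>hinner H h u\<bar> \<le> hnorm H h * hnorm H u" using u h Cauchy_Schwarz by simp
    also have "\<dots> \<le> hnorm H h * hnorm (form_space H Q) u"
      using u h norm_le_form_norm by (intro mult_left_mono) auto
    finally show "\<bar>hinner H h u\<bar> \<le> hnorm H h * hnorm (form_space H Q) u" .
  qed (use h in auto)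
  then show ?thesis by simp
qed

text \<open>Here \<open>g\<close> is the image of \<open>u\<close> under the resolvent \<open>(1 - L)\<^sup>-\<^sup>1\<close>.\<close>

lemma residual_energy:
  assumes u: "u \<in> fdom" and g: "g \<in> fdom"
    and res: "\<And>v. v \<in> fdom \<Longrightarrow> bil g v + hinner H g v = hinner H u v"
  defines "r \<equiv> hdiff H u g"
  shows "bil r r + 2 * hinner H r r \<le> bil u u"
proof -
  have r: "r \<in> fdom" using u g by (simp add: r_def)
  have "bil g r = hinner H r r"
    using res[OF r] u g r by (simp add: r_def)
  moreover have "bil g r = bil u r - bil r r"
    using u g r by (simp add: r_def bil_diff_left)
  \<comment> \<open>This is the nonnegativity of the form at \<open>u - r\<close>. Since
    \<open>bil u r = bil r r + hinner H r r\<close> by the two facts above, it gives the term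
    \<open>2 * hinner H r r\<close>.\<close>
  moreover have "0 \<le> bil u u - 2 * bil u r + bil r r"
    using bil_nonneg[of "hdiff H u r"] u r
    by (simp add: bil_diff_left bil_diff_right bil_commute[of r u])
  ultimately show ?thesis by simp
qed

end

section \<open>Measurable fields of Hilbert spaces\<close>

lemma measurable_completion_AE:
  assumes f: "f \<in> completion M \<rightarrow>\<^sub>M L" and eq: "AE x in M. f x = g x"
    and g: "g \<in> space M \<rightarrow> space L"
  shows "g \<in> completion M \<rightarrow>\<^sub>M L"
proof (rule measurableI)
  fix A assume A: "A \<in> sets L"
  show "g -` A \<inter> space (completion M) \<in> sets (completion M)"
  proof (rule completion.in_sets_AE)
    show "AE x in completion M. (x \<in> f -` A \<inter> space (completion M)) = (x \<in> g -` A \<inter> space (completion M))"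
      using AE_completion[OF eq] by eventually_elim auto
    show "f -` A \<inter> space (completion M) \<in> sets (completion M)"
      using measurable_sets[OF f A] .
  qed auto
qed (use g in auto)

lemma borel_measurable_completion_AE:
  "f \<in> borel_measurable (completion M) \<Longrightarrow> AE x in M. f x = g x \<Longrightarrow> g \<in> borel_measurable (completion M)"
  by (rule measurable_completion_AE) auto

text \<open>Rational combinations are coded by lists, which makes them enumerable and lets one code
  denote a vector in every fibre at once.\<close>

fun rat_comb :: "'h hspace \<Rightarrow> (nat \<Rightarrow> 'h) \<Rightarrow> (rat \<times> nat) list \<Rightarrow> 'h" where
  "rat_comb H w [] = hzero H"
| "rat_comb H w ((q, n) # xs) = hadd H (hscale H (of_rat q) (w n)) (rat_comb H w xs)"

context pre_hilbert
begin

lemma rat_comb_closed [simp]: "(\<And>n. w n \<in> hcarrier H) \<Longrightarrow> rat_comb H w xs \<in> hcarrier H"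
  by (induction xs) auto

lemma rat_comb_append:
  assumes "\<And>n. w n \<in> hcarrier H"
  shows "rat_comb H w (xs @ ys) = hadd H (rat_comb H w xs) (rat_comb H w ys)"
  by (induction xs) (use assms in \<open>auto intro!: vec_eqI\<close>)

lemma rat_comb_scale:
  assumes "\<And>n. w n \<in> hcarrier H"
  shows "rat_comb H w (map (\<lambda>(q, n). (c * q, n)) xs) = hscale H (of_rat c) (rat_comb H w xs)"
  by (induction xs) (use assms in \<open>auto intro!: vec_eqI simp: of_rat_mult algebra_simps\<close>)

text \<open>The closure \<open>C\<close> of the rational combinations is a real linear subspace
  containing \<open>w\<close>, so it contains the hull of \<open>w\<close>, which is dense by
  totality.\<close>

lemma rat_comb_dense:
  assumes w: "\<And>n. w n \<in> hcarrier H" and total: "htotal H (range w)"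
  shows "hdense H (range (rat_comb H w))"
proof -
  note cl = rat_comb_closed[of w, OF w]
  define C where "C = {v \<in> hcarrier H. \<forall>e>0. \<exists>xs. hdist H v (rat_comb H w xs) < e}"
  have C_dest: "\<exists>xs. hdist H v (rat_comb H w xs) < e" if "v \<in> C" "e > 0" for v e
    using that by (simp add: C_def)
  have C: "hsubspace H C"
    unfolding hsubspace_def
  proof (intro conjI ballI allI)
    show "C \<subseteq> hcarrier H" by (auto simp: C_def)
    show "hzero H \<in> C"
      unfolding C_def using zero_closed by (auto intro!: exI[of _ "[]"])
  next
    fix u v assume u: "u \<in> C" and v: "v \<in> C"
    show "hadd H u v \<in> C"
      unfolding C_def
    proof (intro CollectI conjI allI impI)
      show "hadd H u v \<in> hcarrier H" using u v by (auto simp: C_def)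
      fix e :: real assume e: "e > 0"
      then obtain xs ys where "hdist H u (rat_comb H w xs) < e / 2" "hdist H v (rat_comb H w ys) < e / 2"
        using C_dest[OF u] C_dest[OF v] by (meson half_gt_zero)
      then have "hdist H (hadd H u v) (rat_comb H w (xs @ ys)) < e"
        using dist_add_add[of u v "rat_comb H w xs" "rat_comb H w ys"] u v
        by (simp add: rat_comb_append w C_def)
      then show "\<exists>xs. hdist H (hadd H u v) (rat_comb H w xs) < e" by blast
    qed
  next
    fix c u assume u: "u \<in> C"
    then have uH: "u \<in> hcarrier H" by (auto simp: C_def)
    show "hscale H c u \<in> C"
      unfolding C_def
    proof (intro CollectI conjI allI impI)
      show "hscale H c u \<in> hcarrier H" using uH by simp
      fix e :: real assume e: "e > 0"
      have n0: "0 < hnorm H u + 1" using norm_nonneg[OF uH] by simp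
      \<comment> \<open>\<open>q\<close> is fixed before \<open>xs\<close>, because the precision
        demanded of \<open>xs\<close> depends on it. The added ones keep the denominators
        positive.\<close>
      obtain q where q: "\<bar>c - of_rat q\<bar> < e / (2 * (hnorm H u + 1))"
      proof -
        have "c < c + e / (2 * (hnorm H u + 1))" using e n0 by simp
        then obtain r where "r \<in> \<rat>" "c < r" "r < c + e / (2 * (hnorm H u + 1))"
          using Rats_dense_in_real by blast
        then show ?thesis using that by (elim Rats_cases) (metis abs_minus_commute abs_of_pos
              add_less_cancel_left diff_add_cancel diff_gt_0_iff_gt add.commute)
      qed
      have q0: "0 < \<bar>of_rat q\<bar> + (1::real)"
        using abs_ge_zero[of "of_rat q :: real"] by linarith
      then have "0 < e / (2 * (\<bar>of_rat q\<bar> + 1))" using e by simp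
      then obtain xs where xs: "hdist H u (rat_comb H w xs) < e / (2 * (\<bar>of_rat q\<bar> + 1))"
        using C_dest[OF u] by blast
      have "\<bar>c - of_rat q\<bar> * hnorm H u \<le> e / (2 * (hnorm H u + 1)) * hnorm H u"
        using q uH by (intro mult_right_mono) auto
      also have "\<dots> < e / 2" using e n0 by (simp add: field_simps)
      finally have 1: "\<bar>c - of_rat q\<bar> * hnorm H u < e / 2" .
      have "\<bar>of_rat q\<bar> * hdist H u (rat_comb H w xs) \<le> \<bar>of_rat q\<bar> * (e / (2 * (\<bar>of_rat q\<bar> + 1)))"
        using xs by (intro mult_left_mono) auto
      also have "\<dots> \<le> e / 2" using e q0 by (simp add: field_simps)
      finally have 2: "\<bar>of_rat q\<bar> * hdist H u (rat_comb H w xs) \<le> e / 2" .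
      have "hdist H (hscale H c u) (rat_comb H w (map (\<lambda>(r, n). (q * r, n)) xs)) < e"
        using dist_scale_scale[OF uH cl, of c "of_rat q" xs] 1 2 by (simp add: rat_comb_scale w)
      then show "\<exists>xs. hdist H (hscale H c u) (rat_comb H w xs) < e" by blast
    qed
  qed
  have "range w \<subseteq> C"
  proof safe
    fix n
    have "rat_comb H w [(1, n)] = w n" by (rule vec_eqI) (use w in auto)
    then have "hdist H (w n) (rat_comb H w [(1, n)]) = 0" using w by simp
    then show "w n \<in> C" unfolding C_def using w by (auto intro!: exI[of _ "[(1, n)]"])
  qed
  then have hull: "hsubspace H hull range w \<subseteq> C" using C by (rule hull_minimal)
  show ?thesis
    unfolding hdense_def
  proof (intro conjI ballI allI impI)
    show "range (rat_comb H w) \<subseteq> hcarrier H" using cl by auto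
    fix u and e :: real assume u: "u \<in> hcarrier H" and e: "e > 0"
    obtain v where v: "v \<in> C" "hdist H u v < e / 2"
      using total u e hull unfolding htotal_def hdense_def by (meson half_gt_zero subsetD)
    obtain xs where xs: "hdist H v (rat_comb H w xs) < e / 2"
      using C_dest[OF v(1)] e by (meson half_gt_zero)
    have "hdist H u (rat_comb H w xs) < e"
      using dist_triangle[of u v "rat_comb H w xs"] u v xs cl by (auto simp: C_def)
    then show "\<exists>v\<in>range (rat_comb H w). hdist H u v < e" by blast
  qed
qed

end

locale hilbert_field =
  fixes N :: "'z measure" and H :: "'z \<Rightarrow> 'h hspace" and S :: "('z \<Rightarrow> 'h) set"
  assumes field: "measurable_hilbert_field N H S"
begin

lemma hilbert: "z \<in> space N \<Longrightarrow> real_hilbert (H z)"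
  using field by (simp add: measurable_hilbert_field_def)

lemma pre: "z \<in> space N \<Longrightarrow> pre_hilbert (H z)"
proof -
  assume "z \<in> space N"
  then interpret real_hilbert "H z" by (rule hilbert)
  show ?thesis by (rule pre_hilbert_axioms)
qed

lemma carrier: "u \<in> S \<Longrightarrow> z \<in> space N \<Longrightarrow> u z \<in> hcarrier (H z)"
  using field by (auto simp: measurable_hilbert_field_def)

lemma zero_mem: "(\<lambda>z. hzero (H z)) \<in> S"
  using field by (simp add: measurable_hilbert_field_def)

lemma add_mem: "u \<in> S \<Longrightarrow> v \<in> S \<Longrightarrow> (\<lambda>z. hadd (H z) (u z) (v z)) \<in> S"
  using field by (simp add: measurable_hilbert_field_def)

lemma scale_mem: "u \<in> S \<Longrightarrow> (\<lambda>z. hscale (H z) c (u z)) \<in> S"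
  using field by (simp add: measurable_hilbert_field_def)

lemma diff_mem: "u \<in> S \<Longrightarrow> v \<in> S \<Longrightarrow> (\<lambda>z. hdiff (H z) (u z) (v z)) \<in> S"
  unfolding hdiff_def by (intro add_mem scale_mem)

lemma norm_meas [measurable (raw)]:
  "u \<in> S \<Longrightarrow> (\<lambda>z. hnorm (H z) (u z)) \<in> borel_measurable (completion N)"
  using field by (simp add: measurable_hilbert_field_def)

lemma memI:
  assumes "\<And>z. z \<in> space N \<Longrightarrow> v z \<in> hcarrier (H z)"
    and "\<And>u. u \<in> S \<Longrightarrow> (\<lambda>z. hinner (H z) (u z) (v z)) \<in> borel_measurable (completion N)"
  shows "v \<in> S"
  using field assms unfolding measurable_hilbert_field_def by (simp add: Pi_iff)

lemma dist_meas:
  "u \<in> S \<Longrightarrow> v \<in> S \<Longrightarrow> (\<lambda>z. hdist (H z) (u z) (v z)) \<in> borel_measurable (completion N)"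
  unfolding hdist_def by (intro norm_meas diff_mem)

lemma inner_meas:
  assumes u: "u \<in> S" and v: "v \<in> S"
  shows "(\<lambda>z. hinner (H z) (u z) (v z)) \<in> borel_measurable (completion N)"
proof -
  have "(\<lambda>z. ((hnorm (H z) (hadd (H z) (u z) (v z)))\<^sup>2 - (hnorm (H z) (hdiff (H z) (u z) (v z)))\<^sup>2) / 4)
      \<in> borel_measurable (completion N)"
    by (intro borel_measurable_divide borel_measurable_diff borel_measurable_power
        borel_measurable_const norm_meas add_mem diff_mem u v)
  then show ?thesis
    by (rule measurable_cong[THEN iffD1, rotated])
      (use carrier[OF u] carrier[OF v] in \<open>auto simp: pre_hilbert.polarization[OF pre]\<close>)
qed

text \<open>Maximality of \<open>S\<close> asks only for measurable inner products, and these are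
  cut off together with the field. Such cut-offs localise integrated identities to points of the
  base.\<close>

lemma restrict_mem:
  assumes u: "u \<in> S" and B: "B \<in> sets (completion N)"
  shows "(\<lambda>z. if z \<in> B then u z else hzero (H z)) \<in> S"
proof (rule memI)
  fix w assume w: "w \<in> S"
  have "(\<lambda>z. if z \<in> B then hinner (H z) (w z) (u z) else 0) \<in> borel_measurable (completion N)"
    by (rule measurable_If_set) (use inner_meas[OF w u] B in auto)
  then show "(\<lambda>z. hinner (H z) (w z) (if z \<in> B then u z else hzero (H z))) \<in> borel_measurable (completion N)"
    by (rule measurable_cong[THEN iffD1, rotated])
      (use carrier[OF w] in \<open>auto simp: pre_hilbert.inner_zero_right[OF pre]\<close>)
qed (use carrier[OF u] pre_hilbert.zero_closed[OF pre] in auto)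

text \<open>The least admissible index depends measurably on the base point because each of the
  countably many distances does.\<close>

lemma measurable_selection:
  assumes D: "\<And>k::nat. D k \<in> S" and dense: "\<And>z. z \<in> space N \<Longrightarrow> hdense (H z) (range (\<lambda>k. D k z))"
    and u: "u \<in> S" and e: "e > 0"
  shows "\<exists>k\<in>completion N \<rightarrow>\<^sub>M count_space UNIV. \<forall>z\<in>space N. hdist (H z) (u z) (D (k z) z) < e"
proof (intro bexI ballI)
  let ?k = "\<lambda>z. LEAST k. hdist (H z) (u z) (D k z) < e"
  have [measurable]: "(\<lambda>z. hdist (H z) (u z) (D k z)) \<in> borel_measurable (completion N)" for k
    using u D by (rule dist_meas)
  show "?k \<in> completion N \<rightarrow>\<^sub>M count_space UNIV" by measurable
  fix z assume z: "z \<in> space N"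
  then have "\<exists>k. hdist (H z) (u z) (D k z) < e"
    using dense[OF z] carrier[OF u z] e unfolding hdense_def by blast
  then show "hdist (H z) (u z) (D (?k z) z) < e" by (rule LeastI_ex)
qed

text \<open>The inner product with any \<open>u\<close> in \<open>S\<close> is a pointwise limit of
  inner products with the selected vectors \<open>D (k j z) z\<close>. On each of the countably many
  level sets of \<open>k j\<close> only one \<open>D i\<close> occurs, so these are measurable.
  Membership in \<open>S\<close> can therefore be tested on a countable family.\<close>

lemma mem_if_inner_dense:
  assumes D: "\<And>k::nat. D k \<in> S" and dense: "\<And>z. z \<in> space N \<Longrightarrow> hdense (H z) (range (\<lambda>k. D k z))"
    and v: "\<And>z. z \<in> space N \<Longrightarrow> v z \<in> hcarrier (H z)"
    and meas: "\<And>k. (\<lambda>z. hinner (H z) (D k z) (v z)) \<in> borel_measurable (completion N)"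
  shows "v \<in> S"
proof (rule memI[OF v])
  fix u assume u: "u \<in> S"
  have "\<exists>k\<in>completion N \<rightarrow>\<^sub>M count_space UNIV. \<forall>z\<in>space N. hdist (H z) (u z) (D (k z) z) < 1 / real (Suc j)"
    for j by (rule measurable_selection[OF D dense u]) auto
  then obtain k where k: "\<And>j. k j \<in> completion N \<rightarrow>\<^sub>M count_space UNIV"
    and close: "\<And>j z. z \<in> space N \<Longrightarrow> hdist (H z) (u z) (D (k j z) z) < 1 / real (Suc j)"
    by metis
  show "(\<lambda>z. hinner (H z) (u z) (v z)) \<in> borel_measurable (completion N)"
  proof (rule borel_measurable_LIMSEQ_real)
    show "(\<lambda>z. hinner (H z) (D (k j z) z) (v z)) \<in> borel_measurable (completion N)" for j
      by (rule measurable_compose_countable[OF meas k])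
    fix z assume "z \<in> space (completion N)"
    then have z: "z \<in> space N" by simp
    interpret pre_hilbert "H z" using z by (rule pre)
    have uz: "u z \<in> hcarrier (H z)" and Dz: "D i z \<in> hcarrier (H z)" for i
      using carrier u D z by auto
    show "(\<lambda>j. hinner (H z) (D (k j z) z) (v z)) \<longlonglongrightarrow> hinner (H z) (u z) (v z)"
    proof (rule LIM_zero_cancel, rule Lim_null_comparison)
      show "(\<lambda>j. 1 / real (Suc j) * hnorm (H z) (v z)) \<longlonglongrightarrow> 0"
        using tendsto_mult_left_zero[OF LIMSEQ_inverse_real_of_nat, of "hnorm (H z) (v z)"]
        by (simp add: inverse_eq_divide)
      show "\<forall>\<^sub>F j in sequentially. norm (hinner (H z) (D (k j z) z) (v z) - hinner (H z) (u z) (v z))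
          \<le> 1 / real (Suc j) * hnorm (H z) (v z)"
      proof (intro always_eventually allI)
        fix j
        have "\<bar>hinner (H z) (D (k j z) z) (v z) - hinner (H z) (u z) (v z)\<bar>
            = \<bar>hinner (H z) (hdiff (H z) (D (k j z) z) (u z)) (v z)\<bar>"
          using uz Dz v[OF z] by simp
        also have "\<dots> \<le> hdist (H z) (D (k j z) z) (u z) * hnorm (H z) (v z)"
          using Cauchy_Schwarz[of "hdiff (H z) (D (k j z) z) (u z)" "v z"] uz Dz v[OF z]
          by (simp add: hdist_def)
        also have "\<dots> \<le> 1 / real (Suc j) * hnorm (H z) (v z)"
          using close[OF z, of j] uz Dz v[OF z]
          by (intro mult_right_mono) (auto simp: dist_commute[of "D (k j z) z"] less_imp_le)
        finally show "norm (hinner (H z) (D (k j z) z) (v z) - hinner (H z) (u z) (v z))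
            \<le> 1 / real (Suc j) * hnorm (H z) (v z)" by simp
      qed
    qed
  qed
qed

lemma rat_comb_mem: "(\<And>n. w n \<in> S) \<Longrightarrow> (\<lambda>z. rat_comb (H z) (\<lambda>n. w n z) xs) \<in> S"
proof (induction xs)
  case Nil
  then show ?case by (simp add: zero_mem)
next
  case (Cons a xs)
  obtain q n where "a = (q, n)" by (cases a)
  moreover have "(\<lambda>z. hadd (H z) (hscale (H z) (of_rat q) (w n z)) (rat_comb (H z) (\<lambda>n. w n z) xs)) \<in> S"
    by (rule add_mem[OF scale_mem[OF Cons.prems] Cons.IH[OF Cons.prems]])
  ultimately show ?case by simp
qed

lemma sqint_AE:
  assumes "square_integrable_field N H u" "AE z in N. u z = v z"
  shows "square_integrable_field N H v"
proof -
  have "(\<integral>\<^sup>+ z. ennreal ((hnorm (H z) (u z))\<^sup>2) \<partial>completion N)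
      = (\<integral>\<^sup>+ z. ennreal ((hnorm (H z) (v z))\<^sup>2) \<partial>completion N)"
    by (rule nn_integral_cong_AE) (use AE_completion[OF assms(2)] in \<open>eventually_elim, simp\<close>)
  then show ?thesis using assms(1) by (simp add: square_integrable_field_def)
qed

lemma field_class_self: "u \<in> S \<Longrightarrow> square_integrable_field N H u \<Longrightarrow> u \<in> field_class N H S u"
  by (simp add: field_class_def)

lemma field_rep_class:
  assumes "u \<in> S" "square_integrable_field N H u"
  shows "AE z in N. field_rep (field_class N H S u) z = u z"
proof -
  have "field_rep (field_class N H S u) \<in> field_class N H S u"
    unfolding field_rep_def by (rule someI[of "\<lambda>v. v \<in> _"]) (rule field_class_self[OF assms])
  then show ?thesis by (simp add: field_class_def)
qed

lemma field_class_AE: 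
  assumes "AE z in N. u z = v z" shows "field_class N H S u = field_class N H S v"
proof -
  have "(AE z in N. w z = u z) \<longleftrightarrow> (AE z in N. w z = v z)" for w
  proof
    assume "AE z in N. w z = u z"
    with assms show "AE z in N. w z = v z" by eventually_elim simp
  next
    assume "AE z in N. w z = v z"
    with assms show "AE z in N. w z = u z" by eventually_elim simp
  qed
  then show ?thesis by (simp add: field_class_def)
qed

lemma field_class_eq_iff:
  assumes "u \<in> S" "square_integrable_field N H u"
  shows "field_class N H S u = field_class N H S v \<longleftrightarrow> (AE z in N. u z = v z)"
proof
  assume "field_class N H S u = field_class N H S v"
  then have "u \<in> field_class N H S v" using field_class_self[OF assms] by simp
  then show "AE z in N. u z = v z" by (simp add: field_class_def)
qed (rule field_class_AE)

end

section \<open>The space \<open>L\<^sup>2\<close>\<close>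

lemma sq_integrableI:
  "f \<in> borel_measurable (completion M) \<Longrightarrow> integrable (completion M) (\<lambda>x. (f x)\<^sup>2) \<Longrightarrow> f \<in> sq_integrable M"
  by (simp add: sq_integrable_def)

lemma sq_integrableD [measurable_dest]:
  "f \<in> sq_integrable M \<Longrightarrow> f \<in> borel_measurable (completion M)"
  by (simp add: sq_integrable_def)

lemma sq_integrable_square: "f \<in> sq_integrable M \<Longrightarrow> integrable (completion M) (\<lambda>x. (f x)\<^sup>2)"
  by (simp add: sq_integrable_def)

lemma sq_integrable_mult:
  assumes f: "f \<in> sq_integrable M" and g: "g \<in> sq_integrable M"
  shows "integrable (completion M) (\<lambda>x. f x * g x)"
proof (rule Bochner_Integration.integrable_bound)
  note [measurable] = sq_integrableD[OF f] sq_integrableD[OF g]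
  show "integrable (completion M) (\<lambda>x. (f x)\<^sup>2 + (g x)\<^sup>2)"
    using f g by (intro Bochner_Integration.integrable_add sq_integrable_square)
  show "(\<lambda>x. f x * g x) \<in> borel_measurable (completion M)" by measurable
  show "AE x in completion M. norm (f x * g x) \<le> norm ((f x)\<^sup>2 + (g x)\<^sup>2)"
  proof (rule AE_I2)
    fix x
    have "2 * \<bar>f x * g x\<bar> \<le> (f x)\<^sup>2 + (g x)\<^sup>2"
      using sum_squares_bound[of "\<bar>f x\<bar>" "\<bar>g x\<bar>"] by (simp add: abs_mult)
    moreover have "0 \<le> \<bar>f x * g x\<bar>" by simp
    ultimately have "\<bar>f x * g x\<bar> \<le> (f x)\<^sup>2 + (g x)\<^sup>2" by linarith
    then show "norm (f x * g x) \<le> norm ((f x)\<^sup>2 + (g x)\<^sup>2)" by simp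
  qed
qed

lemma sq_integrable_zero: "(\<lambda>x. 0) \<in> sq_integrable M"
  by (simp add: sq_integrable_def)

lemma sq_integrable_scale: "f \<in> sq_integrable M \<Longrightarrow> (\<lambda>x. c * f x) \<in> sq_integrable M"
  by (auto simp: sq_integrable_def power_mult_distrib)

lemma sq_integrable_add:
  assumes f: "f \<in> sq_integrable M" and g: "g \<in> sq_integrable M"
  shows "(\<lambda>x. f x + g x) \<in> sq_integrable M"
proof (rule sq_integrableI)
  note [measurable] = sq_integrableD[OF f] sq_integrableD[OF g]
  show "(\<lambda>x. f x + g x) \<in> borel_measurable (completion M)" by measurable
  have "integrable (completion M) (\<lambda>x. (f x)\<^sup>2 + (g x)\<^sup>2 + 2 * (f x * g x))"
    using f g by (intro Bochner_Integration.integrable_add sq_integrable_square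
        integrable_mult_right sq_integrable_mult) auto
  then show "integrable (completion M) (\<lambda>x. (f x + g x)\<^sup>2)"
    by (simp add: power2_sum mult.assoc)
qed

lemma sq_integrable_diff:
  "f \<in> sq_integrable M \<Longrightarrow> g \<in> sq_integrable M \<Longrightarrow> (\<lambda>x. f x - g x) \<in> sq_integrable M"
  using sq_integrable_add[of f M "\<lambda>x. - 1 * g x"] sq_integrable_scale[of g M "- 1"] by simp

lemma sq_integrable_AE:
  assumes f: "f \<in> sq_integrable M" and eq: "AE x in M. f x = g x"
  shows "g \<in> sq_integrable M"
proof (rule sq_integrableI)
  show g: "g \<in> borel_measurable (completion M)"
    by (rule borel_measurable_completion_AE[OF sq_integrableD[OF f] eq])
  note [measurable] = g sq_integrableD[OF f]
  have "AE x in completion M. (f x)\<^sup>2 = (g x)\<^sup>2"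
    using AE_completion[OF eq] by eventually_elim simp
  then have "integrable (completion M) (\<lambda>x. (f x)\<^sup>2) \<longleftrightarrow> integrable (completion M) (\<lambda>x. (g x)\<^sup>2)"
    by (intro integrable_cong_AE) measurable
  then show "integrable (completion M) (\<lambda>x. (g x)\<^sup>2)"
    using sq_integrable_square[OF f] by blast
qed

lemma sq_integrable_iff:
  "f \<in> sq_integrable M \<longleftrightarrow>
    f \<in> borel_measurable (completion M) \<and> (\<integral>\<^sup>+ x. ennreal ((f x)\<^sup>2) \<partial>completion M) < \<infinity>"
  unfolding sq_integrable_def by (auto simp: integrable_iff_bounded)

lemma L2_class_self: "f \<in> sq_integrable M \<Longrightarrow> f \<in> L2_class M f"
  by (simp add: L2_class_def)

lemma L2_rep_class:
  assumes "f \<in> sq_integrable M"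
  shows "L2_rep (L2_class M f) \<in> sq_integrable M" "AE x in M. L2_rep (L2_class M f) x = f x"
proof -
  have "L2_rep (L2_class M f) \<in> L2_class M f"
    unfolding L2_rep_def by (rule someI[of "\<lambda>v. v \<in> _"]) (rule L2_class_self[OF assms])
  then show "L2_rep (L2_class M f) \<in> sq_integrable M" "AE x in M. L2_rep (L2_class M f) x = f x"
    by (auto simp: L2_class_def)
qed

lemma L2_class_AE:
  assumes "AE x in M. f x = g x" shows "L2_class M f = L2_class M g"
proof -
  have "(AE x in M. h x = f x) \<longleftrightarrow> (AE x in M. h x = g x)" for h
  proof
    assume "AE x in M. h x = f x"
    with assms show "AE x in M. h x = g x" by eventually_elim simp
  next
    assume "AE x in M. h x = g x"
    with assms show "AE x in M. h x = f x" by eventually_elim simp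
  qed
  then show ?thesis by (simp add: L2_class_def)
qed

lemma L2_carrier: "hcarrier (L2 M) = L2_class M ` sq_integrable M"
  by (simp add: L2_def)

lemma L2_class_carrier [simp]: "f \<in> sq_integrable M \<Longrightarrow> L2_class M f \<in> hcarrier (L2 M)"
  by (simp add: L2_carrier)

lemma L2_carrier_rep:
  assumes "F \<in> hcarrier (L2 M)"
  shows "L2_rep F \<in> sq_integrable M" "L2_class M (L2_rep F) = F"
  using assms L2_rep_class by (auto simp: L2_carrier intro!: L2_class_AE)

lemma L2_zero: "hzero (L2 M) = L2_class M (\<lambda>x. 0)"
  by (simp add: L2_def)

lemma L2_add:
  assumes "f \<in> sq_integrable M" "g \<in> sq_integrable M"
  shows "hadd (L2 M) (L2_class M f) (L2_class M g) = L2_class M (\<lambda>x. f x + g x)"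
proof -
  have "AE x in M. L2_rep (L2_class M f) x + L2_rep (L2_class M g) x = f x + g x"
    using L2_rep_class(2)[OF assms(1)] L2_rep_class(2)[OF assms(2)] by eventually_elim simp
  then show ?thesis by (simp add: L2_def L2_class_AE)
qed

lemma L2_scale:
  assumes "f \<in> sq_integrable M"
  shows "hscale (L2 M) c (L2_class M f) = L2_class M (\<lambda>x. c * f x)"
proof -
  have "AE x in M. c * L2_rep (L2_class M f) x = c * f x"
    using L2_rep_class(2)[OF assms(1)] by eventually_elim simp
  then show ?thesis by (simp add: L2_def L2_class_AE)
qed

lemma L2_diff:
  assumes "f \<in> sq_integrable M" "g \<in> sq_integrable M"
  shows "hdiff (L2 M) (L2_class M f) (L2_class M g) = L2_class M (\<lambda>x. f x - g x)"
  using L2_add[OF assms(1) sq_integrable_scale[OF assms(2), of "- 1"]]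
  by (simp add: hdiff_def L2_scale assms)

lemma L2_inner:
  assumes f: "f \<in> sq_integrable M" and g: "g \<in> sq_integrable M"
  shows "hinner (L2 M) (L2_class M f) (L2_class M g) = (LINT x|completion M. f x * g x)"
proof -
  have "AE x in M. L2_rep (L2_class M f) x * L2_rep (L2_class M g) x = f x * g x"
    using L2_rep_class(2)[OF f] L2_rep_class(2)[OF g] by eventually_elim simp
  then show ?thesis unfolding L2_def
    using sq_integrableD[OF L2_rep_class(1)[OF f]] sq_integrableD[OF L2_rep_class(1)[OF g]]
      sq_integrableD[OF f] sq_integrableD[OF g]
    by (auto intro!: integral_cong_AE AE_completion)
qed

lemma L2_cases [consumes 1]:
  assumes "F \<in> hcarrier (L2 M)" obtains f where "f \<in> sq_integrable M" "F = L2_class M f"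
  using assms by (auto simp: L2_carrier)

lemma pre_hilbert_L2: "pre_hilbert (L2 M)"
proof
  show "hzero (L2 M) \<in> hcarrier (L2 M)" by (simp add: L2_zero sq_integrable_zero)
  fix F G assume F: "F \<in> hcarrier (L2 M)" and G: "G \<in> hcarrier (L2 M)"
  from F obtain f where f: "f \<in> sq_integrable M" "F = L2_class M f" by (rule L2_cases)
  from G obtain g where g: "g \<in> sq_integrable M" "G = L2_class M g" by (rule L2_cases)
  note fg = f g
  show "hadd (L2 M) F G \<in> hcarrier (L2 M)" "hscale (L2 M) c F \<in> hcarrier (L2 M)"
    "hadd (L2 M) F (hzero (L2 M)) = F"
    "hinner (L2 M) F G = hinner (L2 M) G F"
    "hinner (L2 M) (hscale (L2 M) c F) G = c * hinner (L2 M) F G" for c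
    using fg sq_integrable_mult[OF f(1) g(1)]
    by (auto simp: L2_add L2_scale L2_zero L2_inner sq_integrable_add sq_integrable_scale
        sq_integrable_zero mult.commute mult.left_commute)
  show "0 \<le> hinner (L2 M) F F" using fg by (simp add: L2_inner)
  show "F = G" if 0: "hinner (L2 M) (hdiff (L2 M) F G) (hdiff (L2 M) F G) = 0"
  proof -
    have d: "(\<lambda>x. f x - g x) \<in> sq_integrable M" using f g by (simp add: sq_integrable_diff)
    have "(LINT x|completion M. (f x - g x)\<^sup>2) = 0"
      using 0 fg d by (simp add: L2_diff L2_inner power2_eq_square)
    then have "AE x in completion M. (f x - g x)\<^sup>2 = 0"
      by (subst (asm) integral_nonneg_eq_0_iff_AE) (auto intro: sq_integrable_square[OF d])
    then have "AE x in M. f x = g x" by (simp add: AE_completion_iff)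
    then show ?thesis using fg by (simp add: L2_class_AE)
  qed
  fix K assume "K \<in> hcarrier (L2 M)"
  then obtain k where k: "k \<in> sq_integrable M" "K = L2_class M k" by (rule L2_cases)
  show "hinner (L2 M) (hadd (L2 M) F G) K = hinner (L2 M) F K + hinner (L2 M) G K"
    using fg k by (simp add: L2_add L2_inner sq_integrable_add distrib_right sq_integrable_mult)
qed

lemma L2_norm:
  assumes f: "f \<in> sq_integrable M"
  shows "ennreal ((hnorm (L2 M) (L2_class M f))\<^sup>2) = (\<integral>\<^sup>+ x. ennreal ((f x)\<^sup>2) \<partial>completion M)"
proof -
  interpret pre_hilbert "L2 M" by (rule pre_hilbert_L2)
  show ?thesis
    using f by (simp add: norm_sq L2_inner nn_integral_eq_integral[OF sq_integrable_square]
        flip: power2_eq_square)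
qed

lemma L2_nonneg_class:
  assumes "f \<in> sq_integrable K" shows "L2_nonneg K (L2_class K f) \<longleftrightarrow> (AE x in K. 0 \<le> f x)"
proof -
  note eq = L2_rep_class(2)[OF assms]
  show ?thesis unfolding L2_nonneg_def
  proof
    assume "AE x in K. 0 \<le> L2_rep (L2_class K f) x"
    with eq show "AE x in K. 0 \<le> f x" by eventually_elim simp
  next
    assume "AE x in K. 0 \<le> f x"
    with eq show "AE x in K. 0 \<le> L2_rep (L2_class K f) x" by eventually_elim simp
  qed
qed

section \<open>Disintegrations and the fibres of \<open>L\<^sup>2\<close> functions\<close>

locale disintegration =
  fixes M :: "'x measure" and N :: "'z measure" and s :: "'x \<Rightarrow> 'z" and m :: "'z \<Rightarrow> 'x measure"
  assumes pseudo: "pseudo_disintegration M N m"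
    and separated: "separated s N m"
    and s_meas: "s \<in> completion M \<rightarrow>\<^sub>M N"
begin

lemma sets_m: "z \<in> space N \<Longrightarrow> sets (m z) = sets M"
  using pseudo by (simp add: pseudo_disintegration_def)

lemma space_m: "z \<in> space N \<Longrightarrow> space (m z) = space M"
  using sets_m by (rule sets_eq_imp_space_eq)

lemma measurable_m: "z \<in> space N \<Longrightarrow> f \<in> M \<rightarrow>\<^sub>M L \<Longrightarrow> f \<in> m z \<rightarrow>\<^sub>M L"
  using sets_m by (subst measurable_cong_sets) auto

lemma emeasure_m:
  assumes "A \<in> sets M"
  shows "(\<lambda>z. emeasure (m z) A) \<in> borel_measurable (completion N)"
    "emeasure M A = (\<integral>\<^sup>+ z. emeasure (m z) A \<partial>completion N)"
  using pseudo assms by (auto simp: pseudo_disintegration_def)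

lemma AE_fibres:
  assumes "AE x in M. P x"
  shows "AE z in N. AE x in m z. P x"
proof -
  obtain A where A: "A \<in> sets M" "emeasure M A = 0" "{x \<in> space M. \<not> P x} \<subseteq> A"
    using assms by (auto elim: AE_E)
  have "(\<integral>\<^sup>+ z. emeasure (m z) A \<partial>completion N) = 0" using emeasure_m[OF A(1)] A by simp
  then have "AE z in completion N. emeasure (m z) A = 0"
    using emeasure_m[OF A(1)] by (subst (asm) nn_integral_0_iff_AE) auto
  then have "AE z in N. emeasure (m z) A = 0" by (simp add: AE_completion_iff)
  moreover have "AE z in N. z \<in> space N" by (rule AE_space)
  ultimately show ?thesis
  proof eventually_elim
    case (elim z)
    show "AE x in m z. P x"
      by (rule AE_I[of _ _ A]) (use elim A in \<open>auto simp: space_m sets_m\<close>)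
  qed
qed

text \<open>The disintegration formula is available on \<open>sets M\<close> only. It is applied to
  the main part of the exceptional set, which carries its whole completed measure; this is why that
  set is required to be measurable for the completion.\<close>

lemma AE_if_fibres:
  assumes fibre: "AE z in N. AE x in m z. P x" and P: "{x \<in> space M. \<not> P x} \<in> sets (completion M)"
  shows "AE x in M. P x"
proof -
  define B where "B = {x \<in> space M. \<not> P x}"
  define A where "A = main_part M B"
  have A: "A \<in> sets M" and AB: "A \<subseteq> B"
    using P main_part_null_part_Un[of B M] main_part_sets[of B M] unfolding A_def B_def by blast+
  have "AE z in N. emeasure (m z) A = 0"
    using fibre AE_space
  proof eventually_elim
    case (elim z)
    have "AE x in m z. x \<notin> A" using elim(1) by eventually_elim (use AB in \<open>auto simp: B_def\<close>)
    then show ?case using A elim(2) by (subst (asm) AE_iff_measurable[of A])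
        (auto simp: sets_m space_m dest: sets.sets_into_space)
  qed
  then have "emeasure M A = 0"
    using emeasure_m[OF A] by (subst emeasure_m(2)[OF A])
      (auto simp: nn_integral_0_iff_AE AE_completion_iff)
  then have "B \<in> null_sets (completion M)"
    using P by (simp add: null_sets_def A_def B_def)
  then have "AE x in completion M. x \<notin> B" by (rule AE_not_in)
  then have "AE x in M. x \<notin> B" by (simp add: AE_completion_iff)
  then show ?thesis using AE_space by eventually_elim (simp add: B_def)
qed

text \<open>The fibre measures are controlled only for \<open>z\<close> in \<open>space N\<close>.
  This rule exchanges an integrand that agrees there, for the measurability claim and for the
  integral formula at the same time.\<close>

lemma fibre_integral_cong:
  assumes "\<And>z. z \<in> space N \<Longrightarrow> F z = G z"
    and "G \<in> borel_measurable (completion N) \<and> c = (\<integral>\<^sup>+ z. G z \<partial>completion N)"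
  shows "F \<in> borel_measurable (completion N) \<and> c = (\<integral>\<^sup>+ z. F z \<partial>completion N)"
  using assms nn_integral_cong[of "completion N" F G] measurable_cong[of "completion N" F G] by simp

text \<open>Measurability of the inner integral and the formula are proved in one induction, because
  additivity and monotone convergence of the outer integral need the former.\<close>

lemma nn_integral_fibres_borel:
  assumes "f \<in> borel_measurable M"
  shows "(\<lambda>z. \<integral>\<^sup>+ x. f x \<partial>m z) \<in> borel_measurable (completion N) \<and>
    (\<integral>\<^sup>+ x. f x \<partial>M) = (\<integral>\<^sup>+ z. \<integral>\<^sup>+ x. f x \<partial>m z \<partial>completion N)"
  using assms
proof (induct rule: borel_measurable_induct)
  case (cong f g)
  have "(\<integral>\<^sup>+ x. f x \<partial>M) = (\<integral>\<^sup>+ x. g x \<partial>M)"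
    using cong by (intro nn_integral_cong) simp
  then have c: "(\<lambda>z. \<integral>\<^sup>+ x. g x \<partial>m z) \<in> borel_measurable (completion N) \<and>
      (\<integral>\<^sup>+ x. f x \<partial>M) = (\<integral>\<^sup>+ z. \<integral>\<^sup>+ x. g x \<partial>m z \<partial>completion N)"
    using cong(4) by simp
  show ?case
  proof (rule fibre_integral_cong[OF _ c])
    fix z assume "z \<in> space N"
    then show "(\<integral>\<^sup>+ x. f x \<partial>m z) = (\<integral>\<^sup>+ x. g x \<partial>m z)"
      using cong(3) by (intro nn_integral_cong) (simp add: space_m)
  qed
next
  case (set A)
  show ?case
  proof (rule fibre_integral_cong)
    show "(\<integral>\<^sup>+ x. indicator A x \<partial>m z) = emeasure (m z) A" if "z \<in> space N" for z
      using set that by (intro nn_integral_indicator) (simp add: sets_m)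
    show "(\<lambda>z. emeasure (m z) A) \<in> borel_measurable (completion N) \<and>
        (\<integral>\<^sup>+ x. indicator A x \<partial>M) = (\<integral>\<^sup>+ z. emeasure (m z) A \<partial>completion N)"
      using emeasure_m[OF set] nn_integral_indicator[OF set] by simp
  qed
next
  case (mult f c)
  show ?case
  proof (rule fibre_integral_cong)
    show "(\<integral>\<^sup>+ x. c * f x \<partial>m z) = c * (\<integral>\<^sup>+ x. f x \<partial>m z)" if "z \<in> space N" for z
      using mult that by (intro nn_integral_cmult measurable_m)
    show "(\<lambda>z. c * (\<integral>\<^sup>+ x. f x \<partial>m z)) \<in> borel_measurable (completion N) \<and>
        (\<integral>\<^sup>+ x. c * f x \<partial>M) = (\<integral>\<^sup>+ z. c * (\<integral>\<^sup>+ x. f x \<partial>m z) \<partial>completion N)"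
      using mult by (auto simp: nn_integral_cmult intro!: borel_measurable_times_ennreal)
  qed
next
  case (add f g)
  show ?case
  proof (rule fibre_integral_cong)
    show "(\<integral>\<^sup>+ x. g x + f x \<partial>m z) = (\<integral>\<^sup>+ x. g x \<partial>m z) + (\<integral>\<^sup>+ x. f x \<partial>m z)" if "z \<in> space N" for z
      using add that by (intro nn_integral_add measurable_m)
    show "(\<lambda>z. (\<integral>\<^sup>+ x. g x \<partial>m z) + (\<integral>\<^sup>+ x. f x \<partial>m z)) \<in> borel_measurable (completion N) \<and>
        (\<integral>\<^sup>+ x. g x + f x \<partial>M) =
        (\<integral>\<^sup>+ z. (\<integral>\<^sup>+ x. g x \<partial>m z) + (\<integral>\<^sup>+ x. f x \<partial>m z) \<partial>completion N)"
      using add by (auto simp: nn_integral_add)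
  qed
next
  case (seq U)
  show ?case
  proof (rule fibre_integral_cong)
    show "(\<integral>\<^sup>+ x. (SUP i. U i) x \<partial>m z) = (SUP i. \<integral>\<^sup>+ x. U i x \<partial>m z)" if "z \<in> space N" for z
      unfolding SUP_apply using seq that by (intro nn_integral_monotone_convergence_SUP measurable_m)
    have "incseq (\<lambda>i z. \<integral>\<^sup>+ x. U i x \<partial>m z)"
      using seq by (auto simp: incseq_def le_fun_def intro!: nn_integral_mono)
    moreover have "(\<integral>\<^sup>+ x. (SUP i. U i) x \<partial>M) = (SUP i. \<integral>\<^sup>+ x. U i x \<partial>M)"
      unfolding SUP_apply using seq by (intro nn_integral_monotone_convergence_SUP)
    moreover have "(\<lambda>z. SUP i. \<integral>\<^sup>+ x. U i x \<partial>m z) \<in> borel_measurable (completion N)"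
      using seq by (intro borel_measurable_SUP) auto
    ultimately show "(\<lambda>z. SUP i. \<integral>\<^sup>+ x. U i x \<partial>m z) \<in> borel_measurable (completion N) \<and>
        (\<integral>\<^sup>+ x. (SUP i. U i) x \<partial>M) = (\<integral>\<^sup>+ z. (SUP i. \<integral>\<^sup>+ x. U i x \<partial>m z) \<partial>completion N)"
      using seq by (simp add: nn_integral_monotone_convergence_SUP)
  qed
qed

text \<open>Passing to a Borel version of \<open>f\<close> alters the inner integrals over a null
  set of the base only, which the completion of \<open>N\<close> absorbs.\<close>

lemma nn_integral_fibres:
  fixes f :: "'x \<Rightarrow> ennreal"
  assumes "f \<in> borel_measurable (completion M)"
  shows "(\<lambda>z. \<integral>\<^sup>+ x. f x \<partial>m z) \<in> borel_measurable (completion N)"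
    and "(\<integral>\<^sup>+ x. f x \<partial>M) = (\<integral>\<^sup>+ z. \<integral>\<^sup>+ x. f x \<partial>m z \<partial>completion N)"
proof -
  obtain g where g: "g \<in> borel_measurable M" "AE x in M. f x = g x"
    using completion_ex_borel_measurable[OF assms] by blast
  have eq: "AE z in N. (\<integral>\<^sup>+ x. g x \<partial>m z) = (\<integral>\<^sup>+ x. f x \<partial>m z)"
    using AE_fibres[OF g(2)] by eventually_elim (auto intro!: nn_integral_cong_AE elim: AE_mp)
  show "(\<lambda>z. \<integral>\<^sup>+ x. f x \<partial>m z) \<in> borel_measurable (completion N)"
    using nn_integral_fibres_borel[OF g(1)] eq by (blast intro: borel_measurable_completion_AE)
  show "(\<integral>\<^sup>+ x. f x \<partial>M) = (\<integral>\<^sup>+ z. \<integral>\<^sup>+ x. f x \<partial>m z \<partial>completion N)"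
    using nn_integral_fibres_borel[OF g(1)] nn_integral_cong_AE[OF g(2)]
      nn_integral_cong_AE[OF AE_completion[OF eq]] by simp
qed

lemma measurable_fibres:
  fixes f :: "'x \<Rightarrow> real"
  assumes "f \<in> borel_measurable (completion M)"
  shows "AE z in N. f \<in> borel_measurable (completion (m z))"
proof -
  obtain g where g: "g \<in> borel_measurable M" "AE x in M. f x = g x"
    using completion_ex_borel_measurable_real[OF assms] by blast
  show ?thesis using AE_fibres[OF g(2)] AE_space
  proof eventually_elim
    case (elim z)
    have "g \<in> borel_measurable (completion (m z))"
      using elim g by (intro measurable_completion measurable_m)
    then show ?case
      by (rule borel_measurable_completion_AE) (use elim(1) in \<open>eventually_elim, simp\<close>)
  qed
qed

lemma AE_fibre_over: "AE z in N. AE x in m z. s x = z"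
  using separated by (simp add: separated_def)

text \<open>A null set of the base pulls back to a null set: almost every \<open>m z\<close> is
  concentrated over the point \<open>z\<close>, and almost every \<open>z\<close> avoids the given
  null set. Selections that are measurable only for the completion of \<open>N\<close> can hence be
  composed with \<open>s\<close>.\<close>

lemma s_meas_completion: "s \<in> completion M \<rightarrow>\<^sub>M completion N"
proof (rule completion.measurable_completion2[OF s_meas], rule subsetI)
  fix B assume B: "B \<in> null_sets N"
  have "AE x in M. s x \<notin> B"
  proof (rule AE_if_fibres)
    show "AE z in N. AE x in m z. s x \<notin> B"
      using AE_fibre_over AE_not_in[OF B]
    proof eventually_elim
      case (elim z)
      show ?case using elim(1) by eventually_elim (use elim(2) in simp)
    qed
    have "{x \<in> space M. \<not> s x \<notin> B} = s -` B \<inter> space (completion M)" by auto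
    then show "{x \<in> space M. \<not> s x \<notin> B} \<in> sets (completion M)"
      using measurable_sets[OF s_meas] B by auto
  qed
  then have "AE x in completion M. s x \<notin> B" by (rule AE_completion)
  then have "{x \<in> space (completion M). \<not> s x \<notin> B} \<in> null_sets (completion M)"
    by (simp only: completion.AE_iff_null_sets)
  moreover have "{x \<in> space (completion M). \<not> s x \<notin> B} = s -` B \<inter> space (completion M)" by auto
  ultimately show "B \<in> null_sets (distr (completion M) N s)"
    using B by (auto simp: null_sets_distr_iff[OF s_meas])
qed

lemma delta_eq: "f \<in> sq_integrable (m z) \<Longrightarrow> delta m f z = L2_class (m z) f"
  by (simp add: delta_def)

lemma delta_carrier [simp]: "delta m f z \<in> hcarrier (L2 (m z))"
  by (simp add: delta_def L2_zero sq_integrable_zero)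

lemma delta_norm:
  "f \<in> sq_integrable (m z) \<Longrightarrow> ennreal ((hnorm (L2 (m z)) (delta m f z))\<^sup>2) = (\<integral>\<^sup>+ x. ennreal ((f x)\<^sup>2) \<partial>m z)"
  by (simp add: delta_eq L2_norm nn_integral_completion)

lemma sq_integrable_fibres:
  assumes f: "f \<in> sq_integrable M"
  shows "AE z in N. f \<in> sq_integrable (m z)"
proof -
  have [measurable]: "f \<in> borel_measurable (completion M)" using f by (rule sq_integrableD)
  have meas: "(\<lambda>x. ennreal ((f x)\<^sup>2)) \<in> borel_measurable (completion M)" by measurable
  have "(\<integral>\<^sup>+ z. \<integral>\<^sup>+ x. ennreal ((f x)\<^sup>2) \<partial>m z \<partial>completion N) \<noteq> \<infinity>"
    using f nn_integral_fibres(2)[OF meas]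
    by (simp add: sq_integrable_iff nn_integral_completion less_top)
  then have "AE z in completion N. (\<integral>\<^sup>+ x. ennreal ((f x)\<^sup>2) \<partial>m z) \<noteq> \<infinity>"
    by (rule nn_integral_PInf_AE[OF nn_integral_fibres(1)[OF meas]])
  then have "AE z in N. (\<integral>\<^sup>+ x. ennreal ((f x)\<^sup>2) \<partial>m z) \<noteq> \<infinity>" by (simp add: AE_completion_iff)
  then show ?thesis using measurable_fibres[OF sq_integrableD[OF f]]
    by eventually_elim (simp add: sq_integrable_iff nn_integral_completion less_top)
qed

text \<open>Where \<open>f\<close> is not square integrable on the fibre, \<open>delta m f z\<close>
  is 0 by convention and contributes nothing to the integral; the hypothesis \<open>fibre\<close>
  rules this out almost everywhere.\<close>

lemma sq_integrable_if_fibres: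
  assumes f: "f \<in> borel_measurable (completion M)" and fibre: "AE z in N. f \<in> sq_integrable (m z)"
    and fin: "(\<integral>\<^sup>+ z. ennreal ((hnorm (L2 (m z)) (delta m f z))\<^sup>2) \<partial>completion N) < \<infinity>"
  shows "f \<in> sq_integrable M"
proof -
  have meas: "(\<lambda>x. ennreal ((f x)\<^sup>2)) \<in> borel_measurable (completion M)" using f by measurable
  have "AE z in completion N. ennreal ((hnorm (L2 (m z)) (delta m f z))\<^sup>2) = (\<integral>\<^sup>+ x. ennreal ((f x)\<^sup>2) \<partial>m z)"
    using AE_completion[OF fibre] by eventually_elim (rule delta_norm)
  then have "(\<integral>\<^sup>+ x. ennreal ((f x)\<^sup>2) \<partial>M) < \<infinity>"
    using fin nn_integral_fibres(2)[OF meas] by (simp cong: nn_integral_cong_AE)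
  then show ?thesis using f by (simp add: sq_integrable_iff nn_integral_completion)
qed

lemma delta_norm_meas:
  assumes f: "f \<in> sq_integrable M"
  shows "(\<lambda>z. hnorm (L2 (m z)) (delta m f z)) \<in> borel_measurable (completion N)"
proof -
  have "(\<lambda>x. ennreal ((f x)\<^sup>2)) \<in> borel_measurable (completion M)"
    using sq_integrableD[OF f] by measurable
  then have [measurable]: "(\<lambda>z. \<integral>\<^sup>+ x. ennreal ((f x)\<^sup>2) \<partial>m z) \<in> borel_measurable (completion N)"
    by (rule nn_integral_fibres)
  have "(\<lambda>z. sqrt (enn2real (\<integral>\<^sup>+ x. ennreal ((f x)\<^sup>2) \<partial>m z))) \<in> borel_measurable (completion N)"
    by measurable
  then show ?thesis
  proof (rule borel_measurable_completion_AE)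
    show "AE z in N. sqrt (enn2real (\<integral>\<^sup>+ x. ennreal ((f x)\<^sup>2) \<partial>m z)) = hnorm (L2 (m z)) (delta m f z)"
      using sq_integrable_fibres[OF f]
    proof eventually_elim
      case (elim z)
      interpret pre_hilbert "L2 (m z)" by (rule pre_hilbert_L2)
      show ?case by (simp flip: delta_norm[OF elim])
    qed
  qed
qed

lemma delta_norm_integral:
  assumes f: "f \<in> sq_integrable M"
  shows "(\<integral>\<^sup>+ z. ennreal ((hnorm (L2 (m z)) (delta m f z))\<^sup>2) \<partial>completion N)
    = ennreal ((hnorm (L2 M) (L2_class M f))\<^sup>2)"
proof -
  have "(\<lambda>x. ennreal ((f x)\<^sup>2)) \<in> borel_measurable (completion M)"
    using sq_integrableD[OF f] by measurable
  note fibre = nn_integral_fibres(2)[OF this]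
  have "AE z in completion N. ennreal ((hnorm (L2 (m z)) (delta m f z))\<^sup>2) = (\<integral>\<^sup>+ x. ennreal ((f x)\<^sup>2) \<partial>m z)"
    using AE_completion[OF sq_integrable_fibres[OF f]] by eventually_elim (rule delta_norm)
  then show ?thesis
    using f fibre by (simp add: L2_norm nn_integral_completion cong: nn_integral_cong_AE)
qed

lemma delta_AE:
  assumes f: "f \<in> sq_integrable M" and eq: "AE x in M. f x = g x"
  shows "AE z in N. delta m f z = delta m g z"
  using sq_integrable_fibres[OF f] AE_fibres[OF eq]
proof eventually_elim
  case (elim z)
  then show ?case using sq_integrable_AE[OF elim] by (simp add: delta_eq L2_class_AE)
qed

lemma delta_add:
  assumes f: "f \<in> sq_integrable M" and g: "g \<in> sq_integrable M"
  shows "AE z in N. delta m (\<lambda>x. f x + g x) z = hadd (L2 (m z)) (delta m f z) (delta m g z)"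
  using sq_integrable_fibres[OF f] sq_integrable_fibres[OF g]
  by eventually_elim (simp add: delta_eq sq_integrable_add L2_add)

lemma delta_diff:
  assumes f: "f \<in> sq_integrable M" and g: "g \<in> sq_integrable M"
  shows "AE z in N. delta m (\<lambda>x. f x - g x) z = hdiff (L2 (m z)) (delta m f z) (delta m g z)"
  using sq_integrable_fibres[OF f] sq_integrable_fibres[OF g]
  by eventually_elim (simp add: delta_eq sq_integrable_diff L2_diff)

lemma delta_scale:
  assumes f: "f \<in> sq_integrable M"
  shows "AE z in N. delta m (\<lambda>x. c * f x) z = hscale (L2 (m z)) c (delta m f z)"
  using sq_integrable_fibres[OF f]
  by eventually_elim (simp add: delta_eq sq_integrable_scale L2_scale)

lemma delta_inner_meas:
  assumes f: "f \<in> sq_integrable M" and g: "g \<in> sq_integrable M"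
  shows "(\<lambda>z. hinner (L2 (m z)) (delta m f z) (delta m g z)) \<in> borel_measurable (completion N)"
proof -
  have [measurable]:
    "(\<lambda>z. hnorm (L2 (m z)) (delta m (\<lambda>x. f x + g x) z)) \<in> borel_measurable (completion N)"
    "(\<lambda>z. hnorm (L2 (m z)) (delta m (\<lambda>x. f x - g x) z)) \<in> borel_measurable (completion N)"
    using f g by (auto intro!: delta_norm_meas sq_integrable_add sq_integrable_diff)
  have "(\<lambda>z. ((hnorm (L2 (m z)) (delta m (\<lambda>x. f x + g x) z))\<^sup>2
      - (hnorm (L2 (m z)) (delta m (\<lambda>x. f x - g x) z))\<^sup>2) / 4) \<in> borel_measurable (completion N)"
    by measurable
  then show ?thesis
  proof (rule borel_measurable_completion_AE)
    show "AE z in N. ((hnorm (L2 (m z)) (delta m (\<lambda>x. f x + g x) z))\<^sup>2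
      - (hnorm (L2 (m z)) (delta m (\<lambda>x. f x - g x) z))\<^sup>2) / 4
      = hinner (L2 (m z)) (delta m f z) (delta m g z)"
      using delta_add[OF f g] delta_diff[OF f g]
      by eventually_elim (simp add: pre_hilbert.polarization[OF pre_hilbert_L2])
  qed
qed

end

text \<open>A concrete field representing the image of the class \<open>F\<close> under the
  identification. Another representative of \<open>F\<close> changes it over a null set only, so the
  arguments can be carried out almost everywhere on vectors, without classes of fields.\<close>

definition fibre :: "('z \<Rightarrow> 'x measure) \<Rightarrow> ('x \<Rightarrow> real) set \<Rightarrow> 'z \<Rightarrow> ('x \<Rightarrow> real) set" where
  "fibre m F = delta m (L2_rep F)"

text \<open>The density of \<open>D\<close> has to hold in every fibre, whereas
  \<open>delta m\<close> of a linear combination is the combination of the \<open>delta m\<close>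
  only where the functions are square integrable on the fibre, that is, almost everywhere. Hence two
  sequences, one of functions and one of fields, agreeing almost everywhere.\<close>

locale L2_field = disintegration M N s m + hilbert_field N "\<lambda>z. L2 (m z)" S
  for M :: "'x measure" and N :: "'z measure" and s m and S :: "('z \<Rightarrow> ('x \<Rightarrow> real) set) set" +
  fixes b :: "nat \<Rightarrow> 'x \<Rightarrow> real" and D :: "nat \<Rightarrow> 'z \<Rightarrow> ('x \<Rightarrow> real) set"
  assumes b: "b k \<in> sq_integrable M" and D: "D k \<in> S"
    and D_delta: "AE z in N. D k z = delta m (b k) z"
    and D_dense: "z \<in> space N \<Longrightarrow> hdense (L2 (m z)) (range (\<lambda>k. D k z))"
begin

text \<open>Its inner products with the dense sequence are almost everywhere inner products of two
  fields \<open>delta m\<close>, which are measurable by polarization. So every square integrable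
  function gives a measurable field, not only those that generate \<open>S\<close>.\<close>

lemma delta_mem:
  assumes f: "f \<in> sq_integrable M" shows "delta m f \<in> S"
proof (rule mem_if_inner_dense[OF D D_dense])
  fix k
  show "(\<lambda>z. hinner (L2 (m z)) (D k z) (delta m f z)) \<in> borel_measurable (completion N)"
    by (rule borel_measurable_completion_AE[OF delta_inner_meas[OF b f]])
      (use D_delta[of k] in eventually_elim, simp)
qed auto

lemma delta_sqint:
  assumes f: "f \<in> sq_integrable M" shows "square_integrable_field N (\<lambda>z. L2 (m z)) (delta m f)"
  by (simp add: square_integrable_field_def delta_norm_integral[OF f])

text \<open>A field is approximated within \<open>2\<^sup>-\<^sup>n\<close>, uniformly over the base, by fields \<open>\<delta>(f\<^sub>n)\<close>
  assembled from the countable dense family along the fibres of \<open>s\<close>; on almost every fibre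
  \<open>f\<^sub>n\<close> then converges almost everywhere.\<close>

lemma delta_surj:
  assumes u: "u \<in> S" and fin: "square_integrable_field N (\<lambda>z. L2 (m z)) u"
  shows "\<exists>f\<in>sq_integrable M. AE z in N. delta m f z = u z"
proof -
  have "\<exists>k\<in>completion N \<rightarrow>\<^sub>M count_space UNIV. \<forall>z\<in>space N. hdist (L2 (m z)) (u z) (D (k z) z) < (1/2) ^ n"
    for n :: nat by (rule measurable_selection[OF D D_dense u]) auto
  then obtain k where k: "\<And>n. k n \<in> completion N \<rightarrow>\<^sub>M count_space UNIV"
    and close: "\<And>n z. z \<in> space N \<Longrightarrow> hdist (L2 (m z)) (u z) (D (k n z) z) < (1/2) ^ n"
    by metis
  \<comment> \<open>On the fibre over \<open>z\<close> one has \<open>s x = z\<close>, so the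
    selected index is constant there and the sequence is \<open>b (k n z)\<close>. Where it
    diverges, \<open>lim\<close> takes an unspecified value, which does not affect
    measurability.\<close>
  define f where "f x = lim (\<lambda>n. b (k n (s x)) x)" for x
  have "(\<lambda>x. b (k n (s x)) x) \<in> borel_measurable (completion M)" for n
  proof (rule measurable_compose_countable)
    show "(\<lambda>x. k n (s x)) \<in> completion M \<rightarrow>\<^sub>M count_space UNIV"
      by (rule measurable_compose[OF s_meas_completion k])
    show "(\<lambda>x. b i x) \<in> borel_measurable (completion M)" for i using sq_integrableD[OF b] .
  qed
  then have f: "f \<in> borel_measurable (completion M)"
    unfolding f_def by (rule borel_measurable_lim_metric)
  \<comment> \<open>One null set for all \<open>k\<close>, so that whichever index is selected at
    \<open>z\<close> is covered.\<close>
  have all: "AE z in N. \<forall>k. D k z = delta m (b k) z \<and> b k \<in> sq_integrable (m z)"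
    unfolding AE_all_countable
    using D_delta sq_integrable_fibres[OF b] by (auto intro: AE_conjI)
  have "AE z in N. f \<in> sq_integrable (m z) \<and> delta m f z = u z"
    using all AE_fibre_over AE_space
  proof eventually_elim
    case (elim z)
    define g where "g = L2_rep (u z)"
    have uz: "u z \<in> hcarrier (L2 (m z))" using carrier[OF u] elim by blast
    have g: "g \<in> sq_integrable (m z)" "u z = L2_class (m z) g"
      using L2_carrier_rep[OF uz] by (auto simp: g_def)
    define c where "c n = b (k n z)" for n
    have c: "c n \<in> sq_integrable (m z)" for n using elim by (simp add: c_def)
    have d: "(\<lambda>x. g x - c n x) \<in> sq_integrable (m z)" for n using g c by (simp add: sq_integrable_diff)
    \<comment> \<open>The geometric rate makes the squared deviations summable in the mean, hence
      almost everywhere. The sequence itself then converges almost everywhere; a subsequence chosen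
      separately for each \<open>z\<close> would not give one function \<open>f\<close>.\<close>
    have small: "(\<integral>\<^sup>+ x. ennreal ((g x - c n x)\<^sup>2) \<partial>m z) \<le> ennreal ((1/4) ^ n)" for n
    proof -
      have "D (k n z) z = L2_class (m z) (c n)" using elim c by (simp add: c_def delta_eq)
      then have "hnorm (L2 (m z)) (L2_class (m z) (\<lambda>x. g x - c n x)) < (1/2) ^ n"
        using close[OF elim(3), of n] g c by (simp add: hdist_def L2_diff)
      moreover have "0 \<le> hnorm (L2 (m z)) (L2_class (m z) (\<lambda>x. g x - c n x))"
        using d by (simp add: pre_hilbert.norm_nonneg[OF pre_hilbert_L2])
      ultimately have "(hnorm (L2 (m z)) (L2_class (m z) (\<lambda>x. g x - c n x)))\<^sup>2 \<le> ((1/2) ^ n)\<^sup>2"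
        by (intro power_mono) auto
      also have "\<dots> = (1/4) ^ n"
        by (simp add: power2_eq_square flip: power_mult_distrib)
      finally have "ennreal ((hnorm (L2 (m z)) (L2_class (m z) (\<lambda>x. g x - c n x)))\<^sup>2) \<le> ennreal ((1/4) ^ n)"
        by (rule ennreal_leI)
      then show ?thesis by (simp only: L2_norm[OF d] nn_integral_completion)
    qed
    have meas [measurable]: "(\<lambda>x. ennreal ((g x - c n x)\<^sup>2)) \<in> borel_measurable (completion (m z))" for n
      using sq_integrableD[OF d, of n] by measurable
    have "(\<integral>\<^sup>+ x. (\<Sum>n. ennreal ((g x - c n x)\<^sup>2)) \<partial>completion (m z))
        = (\<Sum>n. \<integral>\<^sup>+ x. ennreal ((g x - c n x)\<^sup>2) \<partial>completion (m z))"
      by (rule nn_integral_suminf[OF meas])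
    also have "\<dots> \<le> (\<Sum>n. ennreal ((1/4) ^ n))"
      by (rule suminf_le) (auto simp: nn_integral_completion small)
    also have "\<dots> < \<infinity>"
      by (subst suminf_ennreal2) (auto simp: summable_geometric)
    finally have "(\<integral>\<^sup>+ x. (\<Sum>n. ennreal ((g x - c n x)\<^sup>2)) \<partial>completion (m z)) \<noteq> \<infinity>" by simp
    then have "AE x in completion (m z). (\<Sum>n. ennreal ((g x - c n x)\<^sup>2)) \<noteq> \<infinity>"
      by (rule nn_integral_PInf_AE[rotated]) measurable
    then have "AE x in m z. (\<Sum>n. ennreal ((g x - c n x)\<^sup>2)) \<noteq> \<infinity>" by (simp add: AE_completion_iff)
    then have "AE x in m z. g x = f x"
      using elim(2)
    proof eventually_elim
      case (elim x)
      have "summable (\<lambda>n. (g x - c n x)\<^sup>2)"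
        by (rule summable_suminf_not_top) (use elim in auto)
      then have "(\<lambda>n. (g x - c n x)\<^sup>2) \<longlonglongrightarrow> 0" by (rule summable_LIMSEQ_zero)
      then have "(\<lambda>n. \<bar>g x - c n x\<bar>) \<longlonglongrightarrow> 0"
        using tendsto_real_sqrt[of "\<lambda>n. (g x - c n x)\<^sup>2" 0] by simp
      then have "(\<lambda>n. g x - c n x) \<longlonglongrightarrow> 0" by (simp add: tendsto_rabs_zero_iff)
      then have "(\<lambda>n. g x - (g x - c n x)) \<longlonglongrightarrow> g x - 0" by (intro tendsto_intros)
      then have "(\<lambda>n. c n x) \<longlonglongrightarrow> g x" by simp
      then have "lim (\<lambda>n. c n x) = g x" by (rule limI)
      then show ?case using elim by (simp add: f_def c_def)
    qed
    then show ?case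
      using sq_integrable_AE[OF g(1)] g(2) by (auto simp: delta_eq intro!: L2_class_AE elim: AE_mp)
  qed
  then have fibre: "AE z in N. f \<in> sq_integrable (m z)" and eq: "AE z in N. delta m f z = u z"
    by (auto elim: AE_mp)
  have "AE z in N. u z = delta m f z" using eq by eventually_elim simp
  then have "square_integrable_field N (\<lambda>z. L2 (m z)) (delta m f)" by (rule sqint_AE[OF fin])
  then have "f \<in> sq_integrable M"
    using sq_integrable_if_fibres[OF f fibre] by (simp add: square_integrable_field_def)
  then show ?thesis using eq by blast
qed

section \<open>The identification of \<open>L2 M\<close> with the direct integral of the
  fibres\<close>

lemma fibre_class:
  assumes "f \<in> sq_integrable M"
  shows "AE z in N. fibre m (L2_class M f) z = delta m f z"
  unfolding fibre_def by (rule delta_AE) (use L2_rep_class[OF assms] in auto)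

lemma fibre_mem: "F \<in> hcarrier (L2 M) \<Longrightarrow> fibre m F \<in> S"
  unfolding fibre_def by (intro delta_mem L2_carrier_rep)

lemma fibre_sqint: "F \<in> hcarrier (L2 M) \<Longrightarrow> square_integrable_field N (\<lambda>z. L2 (m z)) (fibre m F)"
  unfolding fibre_def by (intro delta_sqint L2_carrier_rep)

lemma fibre_carrier [simp]: "fibre m F z \<in> hcarrier (L2 (m z))"
  by (simp add: fibre_def)

lemma fibre_surj:
  assumes "u \<in> S" "square_integrable_field N (\<lambda>z. L2 (m z)) u"
  shows "\<exists>F\<in>hcarrier (L2 M). AE z in N. fibre m F z = u z"
proof -
  obtain f where f: "f \<in> sq_integrable M" "AE z in N. delta m f z = u z"
    using delta_surj[OF assms] by blast
  have "AE z in N. fibre m (L2_class M f) z = u z"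
    using fibre_class[OF f(1)] f(2) by eventually_elim simp
  then show ?thesis using f by (intro bexI[of _ "L2_class M f"]) auto
qed

lemma fibre_add:
  assumes "F \<in> hcarrier (L2 M)" "G \<in> hcarrier (L2 M)"
  shows "AE z in N. fibre m (hadd (L2 M) F G) z = hadd (L2 (m z)) (fibre m F z) (fibre m G z)"
proof -
  obtain f where f: "f \<in> sq_integrable M" "F = L2_class M f" using assms(1) by (rule L2_cases)
  obtain g where g: "g \<in> sq_integrable M" "G = L2_class M g" using assms(2) by (rule L2_cases)
  show ?thesis
    using fibre_class[OF f(1)] fibre_class[OF g(1)] delta_add[OF f(1) g(1)]
      fibre_class[OF sq_integrable_add[OF f(1) g(1)]]
    by eventually_elim (simp add: f g L2_add)
qed

lemma fibre_scale:
  assumes "F \<in> hcarrier (L2 M)"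
  shows "AE z in N. fibre m (hscale (L2 M) c F) z = hscale (L2 (m z)) c (fibre m F z)"
proof -
  obtain f where f: "f \<in> sq_integrable M" "F = L2_class M f" using assms by (rule L2_cases)
  show ?thesis
    using fibre_class[OF f(1)] delta_scale[OF f(1), of c] fibre_class[OF sq_integrable_scale[OF f(1), of c]]
    by eventually_elim (simp add: f L2_scale)
qed

lemma fibre_diff:
  assumes "F \<in> hcarrier (L2 M)" "G \<in> hcarrier (L2 M)"
  shows "AE z in N. fibre m (hdiff (L2 M) F G) z = hdiff (L2 (m z)) (fibre m F z) (fibre m G z)"
  using fibre_add[OF assms(1) pre_hilbert.scale_closed[OF pre_hilbert_L2 assms(2)], of "- 1"]
    fibre_scale[OF assms(2), of "- 1"]
  by eventually_elim (simp add: hdiff_def)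

lemma fibre_norm_integral:
  assumes F: "F \<in> hcarrier (L2 M)"
  shows "(\<integral>\<^sup>+ z. ennreal ((hnorm (L2 (m z)) (fibre m F z))\<^sup>2) \<partial>completion N) = ennreal ((hnorm (L2 M) F)\<^sup>2)"
  unfolding fibre_def using delta_norm_integral[OF L2_carrier_rep(1)[OF F]] L2_carrier_rep(2)[OF F]
  by simp

lemma sqint_inner_integrable:
  assumes u: "u \<in> S" "square_integrable_field N (\<lambda>z. L2 (m z)) u"
    and v: "v \<in> S" "square_integrable_field N (\<lambda>z. L2 (m z)) v"
  shows "integrable (completion N) (\<lambda>z. hinner (L2 (m z)) (u z) (v z))"
proof (rule Bochner_Integration.integrable_bound)
  have *: "integrable (completion N) (\<lambda>z. (hnorm (L2 (m z)) (w z))\<^sup>2)"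
    if "w \<in> S" "square_integrable_field N (\<lambda>z. L2 (m z)) w" for w
    using that norm_meas[OF that(1)]
    by (auto simp: integrable_iff_bounded square_integrable_field_def)
  show "integrable (completion N) (\<lambda>z. (hnorm (L2 (m z)) (u z))\<^sup>2 + (hnorm (L2 (m z)) (v z))\<^sup>2)"
    using u v * by simp
  show "(\<lambda>z. hinner (L2 (m z)) (u z) (v z)) \<in> borel_measurable (completion N)"
    using u v by (intro inner_meas)
  show "AE z in completion N. norm (hinner (L2 (m z)) (u z) (v z))
      \<le> norm ((hnorm (L2 (m z)) (u z))\<^sup>2 + (hnorm (L2 (m z)) (v z))\<^sup>2)"
  proof (rule AE_I2)
    fix z assume "z \<in> space (completion N)"
    then have uz: "u z \<in> hcarrier (L2 (m z))" and vz: "v z \<in> hcarrier (L2 (m z))"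
      using carrier[OF u(1)] carrier[OF v(1)] by auto
    interpret pre_hilbert "L2 (m z)" by (rule pre_hilbert_L2)
    have "2 * (hnorm (L2 (m z)) (u z) * hnorm (L2 (m z)) (v z))
        \<le> (hnorm (L2 (m z)) (u z))\<^sup>2 + (hnorm (L2 (m z)) (v z))\<^sup>2"
      using sum_squares_bound[of "hnorm (L2 (m z)) (u z)" "hnorm (L2 (m z)) (v z)"] by simp
    moreover have "0 \<le> hnorm (L2 (m z)) (u z) * hnorm (L2 (m z)) (v z)"
      using uz vz by simp
    ultimately show "norm (hinner (L2 (m z)) (u z) (v z))
        \<le> norm ((hnorm (L2 (m z)) (u z))\<^sup>2 + (hnorm (L2 (m z)) (v z))\<^sup>2)"
      using Cauchy_Schwarz[OF uz vz] by simp
  qed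
qed

text \<open>Polarization on both sides reduces this to the norm formula, since sums and differences
  are taken fibrewise almost everywhere.\<close>

lemma fibre_inner:
  assumes F: "F \<in> hcarrier (L2 M)" and G: "G \<in> hcarrier (L2 M)"
  shows "hinner (L2 M) F G = (LINT z|completion N. hinner (L2 (m z)) (fibre m F z) (fibre m G z))"
proof -
  interpret L2: pre_hilbert "L2 M" by (rule pre_hilbert_L2)
  have int: "integrable (completion N) (\<lambda>z. (hnorm (L2 (m z)) (fibre m F z))\<^sup>2)"
    if "F \<in> hcarrier (L2 M)" for F
    using fibre_norm_integral[OF that] norm_meas[OF fibre_mem[OF that]]
    by (auto simp: integrable_iff_bounded)
  have norm: "(hnorm (L2 M) F)\<^sup>2 = (LINT z|completion N. (hnorm (L2 (m z)) (fibre m F z))\<^sup>2)"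
    if "F \<in> hcarrier (L2 M)" for F
    using fibre_norm_integral[OF that] int[OF that] by (simp add: nn_integral_eq_integral)
  have "hinner (L2 M) F G = ((hnorm (L2 M) (hadd (L2 M) F G))\<^sup>2 - (hnorm (L2 M) (hdiff (L2 M) F G))\<^sup>2) / 4"
    using F G by (rule L2.polarization)
  also have "\<dots> = (LINT z|completion N. ((hnorm (L2 (m z)) (fibre m (hadd (L2 M) F G) z))\<^sup>2
      - (hnorm (L2 (m z)) (fibre m (hdiff (L2 M) F G) z))\<^sup>2) / 4)"
    using F G int by (simp add: norm)
  also have "\<dots> = (LINT z|completion N. hinner (L2 (m z)) (fibre m F z) (fibre m G z))"
  proof (rule integral_cong_AE)
    show "(\<lambda>z. ((hnorm (L2 (m z)) (fibre m (hadd (L2 M) F G) z))\<^sup>2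
      - (hnorm (L2 (m z)) (fibre m (hdiff (L2 M) F G) z))\<^sup>2) / 4) \<in> borel_measurable (completion N)"
      using F G by (intro borel_measurable_divide borel_measurable_diff borel_measurable_power
        borel_measurable_const norm_meas fibre_mem) auto
    show "(\<lambda>z. hinner (L2 (m z)) (fibre m F z) (fibre m G z)) \<in> borel_measurable (completion N)"
      using F G by (intro inner_meas fibre_mem)
    show "AE z in completion N. ((hnorm (L2 (m z)) (fibre m (hadd (L2 M) F G) z))\<^sup>2
      - (hnorm (L2 (m z)) (fibre m (hdiff (L2 M) F G) z))\<^sup>2) / 4 = hinner (L2 (m z)) (fibre m F z) (fibre m G z)"
      using AE_completion[OF fibre_add[OF F G]] AE_completion[OF fibre_diff[OF F G]]
      by eventually_elim (simp add: pre_hilbert.polarization[OF pre_hilbert_L2])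
  qed
  finally show ?thesis .
qed

lemma fibre_inj:
  assumes F: "F \<in> hcarrier (L2 M)" and G: "G \<in> hcarrier (L2 M)" and eq: "AE z in N. fibre m F z = fibre m G z"
  shows "F = G"
proof -
  interpret L2: pre_hilbert "L2 M" by (rule pre_hilbert_L2)
  have "AE z in completion N. ennreal ((hnorm (L2 (m z)) (fibre m (hdiff (L2 M) F G) z))\<^sup>2) = 0"
    using AE_completion[OF eq] AE_completion[OF fibre_diff[OF F G]]
  proof eventually_elim
    case (elim z)
    then show ?case
      using pre_hilbert.dist_self[OF pre_hilbert_L2, of "fibre m G z" "m z"] by (simp add: hdist_def)
  qed
  then have "(\<integral>\<^sup>+ z. ennreal ((hnorm (L2 (m z)) (fibre m (hdiff (L2 M) F G) z))\<^sup>2) \<partial>completion N)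
      = (\<integral>\<^sup>+ z. 0 \<partial>completion N)" by (rule nn_integral_cong_AE)
  then have "(hnorm (L2 M) (hdiff (L2 M) F G))\<^sup>2 = 0"
    using fibre_norm_integral[of "hdiff (L2 M) F G"] F G by simp
  then show ?thesis using F G by (intro L2.dist_zeroD) (auto simp: hdist_def)
qed

text \<open>Almost everywhere on the total space means almost everywhere on almost every fibre; for
  the direction back, the set where \<open>f\<close> is negative is measurable. The order is thus
  decided on the fibres.\<close>

lemma fibre_nonneg:
  assumes F: "F \<in> hcarrier (L2 M)"
  shows "L2_nonneg M F \<longleftrightarrow> (AE z in N. L2_nonneg (m z) (fibre m F z))"
proof -
  define f where "f = L2_rep F"
  have f: "f \<in> sq_integrable M" using L2_carrier_rep[OF F] by (simp add: f_def)
  have fibre: "AE z in N. L2_nonneg (m z) (fibre m F z) = (AE x in m z. 0 \<le> f x)"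
    using sq_integrable_fibres[OF f]
    by eventually_elim (simp add: fibre_def delta_eq L2_nonneg_class flip: f_def)
  have "(AE x in M. 0 \<le> f x) \<longleftrightarrow> (AE z in N. AE x in m z. 0 \<le> f x)"
  proof
    assume *: "AE z in N. AE x in m z. 0 \<le> f x"
    have "{x \<in> space (completion M). \<not> 0 \<le> f x} \<in> sets (completion M)"
      using sq_integrableD[OF f] by measurable
    then show "AE x in M. 0 \<le> f x" using * by (intro AE_if_fibres) auto
  qed (rule AE_fibres)
  also have "\<dots> \<longleftrightarrow> (AE z in N. L2_nonneg (m z) (fibre m F z))"
  proof
    assume "AE z in N. AE x in m z. 0 \<le> f x"
    with fibre show "AE z in N. L2_nonneg (m z) (fibre m F z)" by eventually_elim simp
  next
    assume "AE z in N. L2_nonneg (m z) (fibre m F z)"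
    with fibre show "AE z in N. AE x in m z. 0 \<le> f x" by eventually_elim simp
  qed
  finally show ?thesis by (simp add: L2_nonneg_def f_def)
qed

lemma identification_class:
  assumes "F \<in> hcarrier (L2 M)"
  shows "L2_to_direct_integral N m S F = field_class N (\<lambda>z. L2 (m z)) S (fibre m F)"
  by (simp add: L2_to_direct_integral_def fibre_def)

text \<open>The transported operator is defined through \<open>the_inv_into\<close>, which inverts
  the identification only where it is injective.\<close>

lemma identification_inj: "inj_on (L2_to_direct_integral N m S) (hcarrier (L2 M))"
proof (rule inj_onI)
  fix F G assume F: "F \<in> hcarrier (L2 M)" and G: "G \<in> hcarrier (L2 M)"
    and "L2_to_direct_integral N m S F = L2_to_direct_integral N m S G"
  then have "AE z in N. fibre m F z = fibre m G z"
    by (simp add: identification_class field_class_eq_iff fibre_mem fibre_sqint)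
  then show "F = G" by (rule fibre_inj[OF F G])
qed

end

section \<open>Direct integrals of forms\<close>

context hilbert_form
begin

text \<open>Both sides are continuous in the test vector for the form norm, with the constant
  \<open>C\<close>, because \<open>bil u\<close> is the inner product of the form space minus that
  of \<open>H\<close>. Countably many test vectors thus decide the generator relation, and countably
  many null sets can be united.\<close>

lemma form_operator_if_dense:
  assumes u: "u \<in> fdom" and w: "w \<in> hcarrier H" and dense: "hdense (form_space H Q) D0"
    and eq: "\<And>d. d \<in> D0 \<Longrightarrow> bil u d = - hinner H w d"
  shows "form_operator H Q u w"
  unfolding form_operator_def
proof (intro conjI ballI u w)
  fix v assume v: "v \<in> fdom"
  define C where "C = hnorm (form_space H Q) u + hnorm H u + hnorm H w"
  have C0: "0 \<le> C"
    using u w D.norm_nonneg[of u] by (simp add: C_def)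
  have "\<bar>bil u v + hinner H w v\<bar> \<le> 0 + e" if e: "e > 0" for e
  proof -
    have "0 < e / (C + 1)" using e C0 by simp
    then obtain d where d: "d \<in> D0" "hdist (form_space H Q) v d < e / (C + 1)"
      using dense v unfolding hdense_def form_space_simps by blast
    have d_dom: "d \<in> fdom" using d dense by (auto simp: hdense_def)
    define x where "x = hdiff H v d"
    have x: "x \<in> fdom" and nx: "hnorm (form_space H Q) x < e / (C + 1)"
      using v d d_dom by (auto simp: x_def hdist_def)
    have "bil u v + hinner H w v = bil u x + hinner H w x"
      using eq[OF d(1)] u v w d_dom by (simp add: x_def bil_diff_right)
    also have "\<dots> = hinner (form_space H Q) u x - hinner H u x + hinner H w x" by simp
    finally have "\<bar>bil u v + hinner H w v\<bar>
        \<le> \<bar>hinner (form_space H Q) u x\<bar> + \<bar>hinner H u x\<bar> + \<bar>hinner H w x\<bar>" by linarith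
    also have "\<dots> \<le> hnorm (form_space H Q) u * hnorm (form_space H Q) x
        + hnorm H u * hnorm H x + hnorm H w * hnorm H x"
      using D.Cauchy_Schwarz[of u x] Cauchy_Schwarz[of u x] Cauchy_Schwarz[of w x] u w x by simp
    also have "\<dots> \<le> C * hnorm (form_space H Q) x"
      using norm_le_form_norm[OF x] u w x
      by (auto simp: C_def distrib_right intro!: add_mono mult_left_mono)
    also have "\<dots> \<le> C * (e / (C + 1))"
      using nx C0 by (intro mult_left_mono) auto
    also have "\<dots> \<le> e" using e C0 by (simp add: field_simps)
    finally show ?thesis by simp
  qed
  then have "\<bar>bil u v + hinner H w v\<bar> \<le> 0" by (rule field_le_epsilon)
  then show "bil u v = - hinner H w v" by simp
qed

lemma form_operator_add:
  assumes "form_operator H Q u w" "form_operator H Q u' w'"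
  shows "form_operator H Q (hadd H u u') (hadd H w w')"
  using assms unfolding form_operator_def by (simp add: bil_add_left)

lemma form_operator_zero: "form_operator H Q (hzero H) (hzero H)"
proof -
  have "hscale H 0 (hzero H) = hzero H" by (rule vec_eqI) auto
  then show ?thesis
    using bil_scale_left[of "hzero H" _ 0] by (simp add: form_operator_def)
qed

lemma Q_parallelogram_le:
  assumes "u \<in> hcarrier H" "v \<in> hcarrier H"
  shows "Q (hadd H u v) \<le> 2 * Q u + 2 * Q v" "Q (hdiff H u v) \<le> 2 * Q u + 2 * Q v"
  using parallelogram[OF assms] by (metis le_iff_add, metis add.commute le_iff_add)

end

lemma (in pre_hilbert) norm_sq_parallelogram_le:
  assumes "u \<in> hcarrier H" "v \<in> hcarrier H"
  shows "(hnorm H (hadd H u v))\<^sup>2 \<le> 2 * (hnorm H u)\<^sup>2 + 2 * (hnorm H v)\<^sup>2"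
    "(hnorm H (hdiff H u v))\<^sup>2 \<le> 2 * (hnorm H u)\<^sup>2 + 2 * (hnorm H v)\<^sup>2"
  using inner_nonneg[of "hdiff H u v"] inner_nonneg[of "hadd H u v"] assms
  by (auto simp: norm_sq inner_commute[of v u])

lemma AE_eq_0_if_integrals:
  fixes g :: "'a \<Rightarrow> real"
  assumes g: "integrable K g" and 0: "\<And>B. B \<in> sets K \<Longrightarrow> (LINT x|K. indicator B x * g x) = 0"
  shows "AE x in K. g x = 0"
proof -
  have [measurable]: "g \<in> borel_measurable K" using g by simp
  have *: "AE x in K. h x \<le> 0"
    if h: "integrable K h" and 0: "\<And>B. B \<in> sets K \<Longrightarrow> (LINT x|K. indicator B x * h x) = 0" for h :: "'a \<Rightarrow> real"
  proof -
    have [measurable]: "h \<in> borel_measurable K" using h by simp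
    define B where "B = {x \<in> space K. 0 < h x}"
    have B: "B \<in> sets K" by (simp add: B_def)
    have "integrable K (\<lambda>x. indicator B x * h x)"
      using integrable_real_mult_indicator[OF B h] by (simp add: mult.commute)
    moreover have "AE x in K. 0 \<le> indicator B x * h x"
      by (rule AE_I2) (simp add: B_def indicator_def)
    ultimately have "AE x in K. indicator B x * h x = 0"
      using 0[OF B] integral_nonneg_eq_0_iff_AE by blast
    then show ?thesis using AE_space by eventually_elim (auto simp: B_def indicator_def split: if_splits)
  qed
  have "AE x in K. g x \<le> 0" using g 0 by (rule *)
  moreover have "AE x in K. - g x \<le> 0" by (rule *) (use g 0 in auto)
  ultimately show ?thesis by eventually_elim simp
qed

text \<open>What the arguments use of compatibility: the fields \<open>D k\<close> are dense in
  every form space, while the functions \<open>b k\<close> lie in the domain of the direct integral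
  form. The same vectors can then test the generator relation on the total space and on the
  fibres.\<close>

locale form_field = disintegration M N s m
  for M :: "'x measure" and N :: "'z measure" and s m +
  fixes SH :: "('z \<Rightarrow> ('x \<Rightarrow> real) set) set" and E :: "'z \<Rightarrow> ('x \<Rightarrow> real) set \<Rightarrow> ennreal"
    and SQ :: "('z \<Rightarrow> ('x \<Rightarrow> real) set) set"
    and b :: "nat \<Rightarrow> 'x \<Rightarrow> real" and D :: "nat \<Rightarrow> 'z \<Rightarrow> ('x \<Rightarrow> real) set"
  assumes forms: "measurable_form_field N (\<lambda>z. L2 (m z)) SH E SQ"
    and b_sq: "b k \<in> sq_integrable M"
    and b_dom: "L2_class M (b k) \<in> form_dom (L2 M) (L2_direct_integral_form N m SH E SQ)"
    and D_SQ: "D k \<in> SQ"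
    and D_b: "AE z in N. D k z = delta m (b k) z"
    and D_form_dense: "z \<in> space N \<Longrightarrow> hdense (form_space (L2 (m z)) (E z)) (range (\<lambda>k. D k z))"
    and form_dom_dense: "hdense (L2 M) (form_dom (L2 M) (L2_direct_integral_form N m SH E SQ))"
begin

abbreviation "Et \<equiv> L2_direct_integral_form N m SH E SQ"
abbreviation "bilf z \<equiv> bilinear_of (L2 (m z)) (E z)"

lemma SQ_SH: "u \<in> SQ \<Longrightarrow> u \<in> SH"
  using forms by (auto simp: measurable_form_field_def)

lemma hilbert_form:
  assumes "z \<in> space N" shows "hilbert_form (L2 (m z)) (E z)"
proof -
  have "real_hilbert (L2 (m z))" "closed_form (L2 (m z)) (E z)"
    using forms assms by (auto simp: measurable_form_field_def measurable_hilbert_field_def)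
  then show ?thesis by (simp add: hilbert_form_def hilbert_form_axioms_def)
qed

sublocale L2_field M N s m SH b D
proof
  show "measurable_hilbert_field N (\<lambda>z. L2 (m z)) SH"
    using forms by (simp add: measurable_form_field_def)
  show "hdense (L2 (m z)) (range (\<lambda>k. D k z))" if "z \<in> space N" for z
    using hilbert_form.dense_form_imp_dense[OF hilbert_form[OF that] D_form_dense[OF that]] .
qed (use b_sq D_SQ SQ_SH D_b in auto)

sublocale Q: hilbert_field N "\<lambda>z. form_space (L2 (m z)) (E z)" SQ
  by standard (use forms in \<open>simp add: measurable_form_field_def\<close>)

lemma SQ_dom: "u \<in> SQ \<Longrightarrow> z \<in> space N \<Longrightarrow> u z \<in> form_dom (L2 (m z)) (E z)"
  using Q.carrier[of u z] hilbert_form.form_space_simps(1)[OF hilbert_form] by blast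

lemma SQ_add: "u \<in> SQ \<Longrightarrow> v \<in> SQ \<Longrightarrow> (\<lambda>z. hadd (L2 (m z)) (u z) (v z)) \<in> SQ"
  using Q.add_mem[of u v] by (simp add: form_space_def)

lemma SQ_diff: "u \<in> SQ \<Longrightarrow> v \<in> SQ \<Longrightarrow> (\<lambda>z. hdiff (L2 (m z)) (u z) (v z)) \<in> SQ"
  using Q.diff_mem[of u v] by (simp add: form_space_def hdiff_def)

lemma SQ_I:
  assumes dom: "\<And>z. z \<in> space N \<Longrightarrow> u z \<in> form_dom (L2 (m z)) (E z)"
    and meas: "\<And>w. w \<in> SQ \<Longrightarrow>
      (\<lambda>z. bilf z (w z) (u z) + hinner (L2 (m z)) (w z) (u z)) \<in> borel_measurable (completion N)"
  shows "u \<in> SQ"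
  by (rule Q.memI) (use assms in \<open>auto simp: form_space_def\<close>)

lemma bilf_meas:
  assumes "u \<in> SQ" "v \<in> SQ"
  shows "(\<lambda>z. bilf z (u z) (v z)) \<in> borel_measurable (completion N)"
proof -
  have "(\<lambda>z. hinner (form_space (L2 (m z)) (E z)) (u z) (v z) - hinner (L2 (m z)) (u z) (v z))
      \<in> borel_measurable (completion N)"
    using assms by (intro borel_measurable_diff Q.inner_meas inner_meas SQ_SH)
  then show ?thesis by (simp add: form_space_def)
qed

lemma E_eq: "u \<in> SQ \<Longrightarrow> z \<in> space N \<Longrightarrow> E z (u z) = ennreal (bilf z (u z) (u z))"
  using hilbert_form.Q_eq[OF hilbert_form SQ_dom] .

lemma E_meas: "u \<in> SQ \<Longrightarrow> (\<lambda>z. E z (u z)) \<in> borel_measurable (completion N)"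
  using bilf_meas[of u u]
  by (subst measurable_cong[of _ _ "\<lambda>z. ennreal (bilf z (u z) (u z))"]) (auto simp: E_eq)

section \<open>Fields of finite energy and the domain of the direct integral form\<close>

definition finite_energy :: "('z \<Rightarrow> ('x \<Rightarrow> real) set) \<Rightarrow> bool" where
  "finite_energy u \<longleftrightarrow> u \<in> SQ \<and>
    (\<integral>\<^sup>+ z. E z (u z) + ennreal ((hnorm (L2 (m z)) (u z))\<^sup>2) \<partial>completion N) < \<infinity>"

lemma finite_energy_SQ: "finite_energy u \<Longrightarrow> u \<in> SQ"
  by (simp add: finite_energy_def)

lemma finite_energy_iff:
  assumes u: "u \<in> SQ"
  shows "finite_energy u \<longleftrightarrow> (\<integral>\<^sup>+ z. E z (u z) \<partial>completion N) < \<infinity> \<and>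
    square_integrable_field N (\<lambda>z. L2 (m z)) u"
proof -
  have "(\<integral>\<^sup>+ z. E z (u z) + ennreal ((hnorm (L2 (m z)) (u z))\<^sup>2) \<partial>completion N)
      = (\<integral>\<^sup>+ z. E z (u z) \<partial>completion N) + (\<integral>\<^sup>+ z. ennreal ((hnorm (L2 (m z)) (u z))\<^sup>2) \<partial>completion N)"
    using E_meas[OF u] norm_meas[OF SQ_SH[OF u]] by (intro nn_integral_add) auto
  then show ?thesis using u by (simp add: finite_energy_def square_integrable_field_def)
qed

text \<open>The two factors 2 are those of the parallelogram identity, so that sums and differences
  are covered by one estimate.\<close>

lemma finite_energyI_bound:
  assumes u: "u \<in> SQ" and v: "finite_energy v" and w: "finite_energy w"
    and E: "\<And>z. z \<in> space N \<Longrightarrow> E z (u z) \<le> 2 * E z (v z) + 2 * E z (w z)"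
    and n: "\<And>z. z \<in> space N \<Longrightarrow> (hnorm (L2 (m z)) (u z))\<^sup>2
      \<le> 2 * (hnorm (L2 (m z)) (v z))\<^sup>2 + 2 * (hnorm (L2 (m z)) (w z))\<^sup>2"
  shows "finite_energy u"
proof -
  note vw = finite_energy_SQ[OF v] finite_energy_SQ[OF w]
  have meas: "(\<lambda>z. E z (x z) + ennreal ((hnorm (L2 (m z)) (x z))\<^sup>2)) \<in> borel_measurable (completion N)"
    if "x \<in> SQ" for x
    using E_meas[OF that] norm_meas[OF SQ_SH[OF that]] by simp
  have lin: "(\<integral>\<^sup>+ z. 2 * f z + 2 * g z \<partial>completion N) = 2 * (\<integral>\<^sup>+ z. f z \<partial>completion N) + 2 * (\<integral>\<^sup>+ z. g z \<partial>completion N)"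
    if "f \<in> borel_measurable (completion N)" "g \<in> borel_measurable (completion N)" for f g :: "'z \<Rightarrow> ennreal"
    using that by (simp add: nn_integral_add nn_integral_cmult)
  have "(\<integral>\<^sup>+ z. E z (u z) + ennreal ((hnorm (L2 (m z)) (u z))\<^sup>2) \<partial>completion N)
    \<le> (\<integral>\<^sup>+ z. 2 * (E z (v z) + ennreal ((hnorm (L2 (m z)) (v z))\<^sup>2))
        + 2 * (E z (w z) + ennreal ((hnorm (L2 (m z)) (w z))\<^sup>2)) \<partial>completion N)"
  proof (rule nn_integral_mono)
    fix z assume "z \<in> space (completion N)"
    then have z: "z \<in> space N" by simp
    have "ennreal ((hnorm (L2 (m z)) (u z))\<^sup>2)
        \<le> ennreal (2 * (hnorm (L2 (m z)) (v z))\<^sup>2 + 2 * (hnorm (L2 (m z)) (w z))\<^sup>2)"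
      using n[OF z] by (rule ennreal_leI)
    also have "\<dots> = 2 * ennreal ((hnorm (L2 (m z)) (v z))\<^sup>2) + 2 * ennreal ((hnorm (L2 (m z)) (w z))\<^sup>2)"
      by (simp add: ennreal_plus ennreal_mult')
    finally have "E z (u z) + ennreal ((hnorm (L2 (m z)) (u z))\<^sup>2) \<le> (2 * E z (v z) + 2 * E z (w z)) +
        (2 * ennreal ((hnorm (L2 (m z)) (v z))\<^sup>2) + 2 * ennreal ((hnorm (L2 (m z)) (w z))\<^sup>2))"
      using E[OF z] by (rule add_mono[rotated])
    then show "E z (u z) + ennreal ((hnorm (L2 (m z)) (u z))\<^sup>2)
      \<le> 2 * (E z (v z) + ennreal ((hnorm (L2 (m z)) (v z))\<^sup>2))
        + 2 * (E z (w z) + ennreal ((hnorm (L2 (m z)) (w z))\<^sup>2))"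
      by (simp add: distrib_left ac_simps)
  qed
  also have "\<dots> = 2 * (\<integral>\<^sup>+ z. E z (v z) + ennreal ((hnorm (L2 (m z)) (v z))\<^sup>2) \<partial>completion N)
      + 2 * (\<integral>\<^sup>+ z. E z (w z) + ennreal ((hnorm (L2 (m z)) (w z))\<^sup>2) \<partial>completion N)"
    by (rule lin[OF meas[OF vw(1)] meas[OF vw(2)]])
  also have "\<dots> < \<infinity>"
    using v w by (simp add: finite_energy_def ennreal_mult_less_top)
  finally show ?thesis using u by (simp add: finite_energy_def)
qed

lemma finite_energy_add_diff:
  assumes v: "finite_energy v" and w: "finite_energy w"
  shows "finite_energy (\<lambda>z. hadd (L2 (m z)) (v z) (w z))" "finite_energy (\<lambda>z. hdiff (L2 (m z)) (v z) (w z))"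
proof -
  note vw = finite_energy_SQ[OF v] finite_energy_SQ[OF w]
  note c = carrier[OF SQ_SH[OF vw(1)]] carrier[OF SQ_SH[OF vw(2)]]
  show "finite_energy (\<lambda>z. hadd (L2 (m z)) (v z) (w z))"
    using hilbert_form.Q_parallelogram_le[OF hilbert_form c]
      pre_hilbert.norm_sq_parallelogram_le[OF pre_hilbert_L2 c]
    by (intro finite_energyI_bound[OF SQ_add[OF vw] v w]) auto
  show "finite_energy (\<lambda>z. hdiff (L2 (m z)) (v z) (w z))"
    using hilbert_form.Q_parallelogram_le[OF hilbert_form c]
      pre_hilbert.norm_sq_parallelogram_le[OF pre_hilbert_L2 c]
    by (intro finite_energyI_bound[OF SQ_diff[OF vw] v w]) auto
qed

lemma Et_eq:
  assumes F: "F \<in> hcarrier (L2 M)" and v: "finite_energy v" and eq: "AE z in N. fibre m F z = v z"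
  shows "Et F = (\<integral>\<^sup>+ z. E z (v z) \<partial>completion N)" and "F \<in> form_dom (L2 M) Et"
proof -
  let ?A = "{u \<in> L2_to_direct_integral N m SH F \<inter> SQ.
    (\<integral>\<^sup>+ z. E z (u z) + ennreal ((hnorm (L2 (m z)) (u z))\<^sup>2) \<partial>completion N) < \<infinity>}"
  have vSQ: "v \<in> SQ" using v by (rule finite_energy_SQ)
  have "AE z in N. v z = fibre m F z" using eq by eventually_elim simp
  then have vA: "v \<in> ?A"
    using v vSQ SQ_SH[OF vSQ] finite_energy_iff[OF vSQ] F
    by (simp add: identification_class field_class_def finite_energy_def)
  have const: "(\<integral>\<^sup>+ z. E z (u z) \<partial>completion N) = (\<integral>\<^sup>+ z. E z (v z) \<partial>completion N)" if "u \<in> ?A" for u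
  proof (rule nn_integral_cong_AE)
    have "AE z in completion N. u z = fibre m F z"
      using that F by (auto simp: identification_class field_class_def intro: AE_completion)
    then show "AE z in completion N. E z (u z) = E z (v z)"
      using AE_completion[OF eq] by eventually_elim simp
  qed
  have "(INF u \<in> ?A. \<integral>\<^sup>+ z. E z (u z) \<partial>completion N) = (\<integral>\<^sup>+ z. E z (v z) \<partial>completion N)"
    by (rule INF_eq_const[OF _ const]) (use vA in blast)
  then show eq: "Et F = (\<integral>\<^sup>+ z. E z (v z) \<partial>completion N)"
    by (simp add: L2_direct_integral_form_def direct_integral_form_def)
  show "F \<in> form_dom (L2 M) Et"
    using F v vSQ eq by (simp add: form_dom_def finite_energy_iff)
qed

text \<open>An infimum over the empty set is infinite, so finiteness of \<open>Et F\<close> by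
  itself yields a representative of finite energy.\<close>

lemma form_dom_rep:
  assumes "F \<in> form_dom (L2 M) Et"
  obtains v where "finite_energy v" "AE z in N. fibre m F z = v z"
proof -
  let ?A = "{u \<in> L2_to_direct_integral N m SH F \<inter> SQ.
    (\<integral>\<^sup>+ z. E z (u z) + ennreal ((hnorm (L2 (m z)) (u z))\<^sup>2) \<partial>completion N) < \<infinity>}"
  have F: "F \<in> hcarrier (L2 M)" using assms unfolding form_dom_def by blast
  have "Et F \<noteq> \<infinity>" using assms unfolding form_dom_def by auto
  then have "?A \<noteq> {}"
    unfolding L2_direct_integral_form_def direct_integral_form_def by (metis image_empty Inf_empty infinity_ennreal_def)
  then obtain v where v: "v \<in> ?A" by blast
  then have "AE z in N. v z = fibre m F z"
    using F by (simp add: identification_class field_class_def)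
  then have "AE z in N. fibre m F z = v z" by eventually_elim simp
  then show ?thesis using v that[of v] by (simp add: finite_energy_def)
qed

lemma energy_integrable:
  assumes v: "finite_energy v"
  shows "integrable (completion N) (\<lambda>z. enn2real (E z (v z)))"
    and "(LINT z|completion N. enn2real (E z (v z))) = enn2real (\<integral>\<^sup>+ z. E z (v z) \<partial>completion N)"
proof -
  note vSQ = finite_energy_SQ[OF v]
  have eq: "(\<integral>\<^sup>+ z. ennreal (enn2real (E z (v z))) \<partial>completion N) = (\<integral>\<^sup>+ z. E z (v z) \<partial>completion N)"
    by (rule nn_integral_cong) (simp add: E_eq[OF vSQ] hilbert_form.bil_nonneg[OF hilbert_form SQ_dom[OF vSQ]])
  have [measurable]: "(\<lambda>z. E z (v z)) \<in> borel_measurable (completion N)" by (rule E_meas[OF vSQ])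
  show "integrable (completion N) (\<lambda>z. enn2real (E z (v z)))"
    using v vSQ by (auto simp: integrable_iff_bounded eq finite_energy_iff)
  show "(LINT z|completion N. enn2real (E z (v z))) = enn2real (\<integral>\<^sup>+ z. E z (v z) \<partial>completion N)"
    by (subst integral_eq_nn_integral) (auto simp: eq)
qed

lemma bilf_integrable:
  assumes "finite_energy v" "finite_energy w"
  shows "integrable (completion N) (\<lambda>z. bilf z (v z) (w z))"
  unfolding bilinear_of_def using finite_energy_add_diff[OF assms, THEN energy_integrable(1)] by simp

text \<open>Both sides are polarizations; since sum and difference of \<open>v\<close> and
  \<open>w\<close> have integrable energy, the difference of the two integrals is the integral of
  the difference.\<close>

lemma bilinear_Et:
  assumes F: "F \<in> hcarrier (L2 M)" "finite_energy v" "AE z in N. fibre m F z = v z"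
    and G: "G \<in> hcarrier (L2 M)" "finite_energy w" "AE z in N. fibre m G z = w z"
  shows "bilinear_of (L2 M) Et F G = (LINT z|completion N. bilf z (v z) (w z))"
proof -
  interpret L2: pre_hilbert "L2 M" by (rule pre_hilbert_L2)
  note vw = finite_energy_add_diff[OF F(2) G(2)]
  have "AE z in N. fibre m (hadd (L2 M) F G) z = hadd (L2 (m z)) (v z) (w z)"
    using F(3) G(3) fibre_add[OF F(1) G(1)] by eventually_elim simp
  moreover have "AE z in N. fibre m (hdiff (L2 M) F G) z = hdiff (L2 (m z)) (v z) (w z)"
    using F(3) G(3) fibre_diff[OF F(1) G(1)] by eventually_elim simp
  ultimately show ?thesis
    unfolding bilinear_of_def[of _ Et]
    using F(1) G(1) vw
    by (simp add: Et_eq(1)[of _ "\<lambda>z. hadd (L2 (m z)) (v z) (w z)"]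
        Et_eq(1)[of _ "\<lambda>z. hdiff (L2 (m z)) (v z) (w z)"]
        flip: energy_integrable(2)) (simp add: bilinear_of_def energy_integrable(1))
qed

section \<open>The generator of the direct integral form and those of the fibres\<close>

lemma fibre_inner_AE:
  assumes F: "F \<in> hcarrier (L2 M)" and G: "G \<in> hcarrier (L2 M)" and w: "w \<in> SH" "AE z in N. fibre m G z = w z"
  shows "hinner (L2 M) F G = (LINT z|completion N. hinner (L2 (m z)) (fibre m F z) (w z))"
  unfolding fibre_inner[OF F G]
proof (rule integral_cong_AE)
  show "AE z in completion N. hinner (L2 (m z)) (fibre m F z) (fibre m G z) = hinner (L2 (m z)) (fibre m F z) (w z)"
    using AE_completion[OF w(2)] by eventually_elim simp
qed (use F G w in \<open>auto intro!: inner_meas fibre_mem\<close>)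

text \<open>The generator relation itself supplies what membership in the domain asks for: against
  any field in \<open>SQ\<close> the form is minus an inner product with \<open>fibre m W\<close>,
  hence measurable, and the energy is minus the inner product of the fibres of \<open>W\<close> and
  \<open>F\<close>, hence integrable.\<close>

lemma form_operator_if_fibres:
  assumes F: "F \<in> hcarrier (L2 M)" and W: "W \<in> hcarrier (L2 M)"
    and fibres: "AE z in N. form_operator (L2 (m z)) (E z) (fibre m F z) (fibre m W z)"
  shows "form_operator (L2 M) Et F W"
proof -
  \<comment> \<open>Members of \<open>SQ\<close> must lie in the form domain at every point of the
    base, so the field is set to zero on the exceptional set.\<close>
  define u where "u z = (if form_operator (L2 (m z)) (E z) (fibre m F z) (fibre m W z)
    then fibre m F z else hzero (L2 (m z)))" for z
  have eq: "AE z in N. fibre m F z = u z" using fibres by eventually_elim (simp add: u_def)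
  have dom: "u z \<in> form_dom (L2 (m z)) (E z)" if "z \<in> space N" for z
    using hilbert_form.dom_closed(1)[OF hilbert_form[OF that]]
    by (simp add: u_def) (simp add: form_operator_def)
  have op: "AE z in N. \<forall>v\<in>form_dom (L2 (m z)) (E z). bilf z (u z) v = - hinner (L2 (m z)) (fibre m W z) v"
    using fibres by eventually_elim (auto simp: u_def form_operator_def)
  have uSQ: "u \<in> SQ"
  proof (rule SQ_I[OF dom])
    fix w assume w: "w \<in> SQ"
    have "(\<lambda>z. - hinner (L2 (m z)) (fibre m W z) (w z) + hinner (L2 (m z)) (w z) (fibre m F z))
        \<in> borel_measurable (completion N)"
      using w F W by (intro borel_measurable_add borel_measurable_uminus inner_meas fibre_mem SQ_SH)
    then show "(\<lambda>z. bilf z (w z) (u z) + hinner (L2 (m z)) (w z) (u z)) \<in> borel_measurable (completion N)"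
    proof (rule borel_measurable_completion_AE)
      show "AE z in N. - hinner (L2 (m z)) (fibre m W z) (w z) + hinner (L2 (m z)) (w z) (fibre m F z)
        = bilf z (w z) (u z) + hinner (L2 (m z)) (w z) (u z)"
        using op eq AE_space
      proof eventually_elim
        case (elim z)
        interpret hilbert_form "L2 (m z)" "E z" by (rule hilbert_form[OF elim(3)])
        show ?case using elim SQ_dom[OF w elim(3)] dom[OF elim(3)] by (simp add: bil_commute[of "w z"])
      qed
    qed
  qed
  have "AE z in completion N. E z (u z) = ennreal (- hinner (L2 (m z)) (fibre m W z) (fibre m F z))"
    using AE_completion[OF op] AE_completion[OF eq] AE_space
    by eventually_elim (use dom in \<open>simp add: E_eq[OF uSQ]\<close>)
  then have "(\<integral>\<^sup>+ z. E z (u z) \<partial>completion N)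
      = (\<integral>\<^sup>+ z. ennreal (- hinner (L2 (m z)) (fibre m W z) (fibre m F z)) \<partial>completion N)"
    by (rule nn_integral_cong_AE)
  also have "\<dots> \<le> (\<integral>\<^sup>+ z. ennreal (norm (hinner (L2 (m z)) (fibre m W z) (fibre m F z))) \<partial>completion N)"
    by (intro nn_integral_mono ennreal_leI) simp
  also have "\<dots> < \<infinity>"
    using sqint_inner_integrable[OF fibre_mem[OF W] fibre_sqint[OF W] fibre_mem[OF F] fibre_sqint[OF F]]
    by (simp add: integrable_iff_bounded)
  finally have u: "finite_energy u"
    using sqint_AE[OF fibre_sqint[OF F] eq] by (simp add: finite_energy_iff[OF uSQ])
  show ?thesis
    unfolding form_operator_def
  proof (intro conjI ballI W)
    show "F \<in> form_dom (L2 M) Et" using F u eq by (rule Et_eq(2))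
    fix V assume V: "V \<in> form_dom (L2 M) Et"
    then have VM: "V \<in> hcarrier (L2 M)" unfolding form_dom_def by blast
    obtain v where v: "finite_energy v" "AE z in N. fibre m V z = v z" using V by (rule form_dom_rep)
    note vSQ = finite_energy_SQ[OF v(1)]
    have "bilinear_of (L2 M) Et F V = (LINT z|completion N. bilf z (u z) (v z))"
      by (rule bilinear_Et[OF F u eq VM v])
    also have "\<dots> = (LINT z|completion N. - hinner (L2 (m z)) (fibre m W z) (v z))"
    proof (rule integral_cong_AE)
      show "AE z in completion N. bilf z (u z) (v z) = - hinner (L2 (m z)) (fibre m W z) (v z)"
        using AE_completion[OF op] AE_space by eventually_elim (use SQ_dom[OF vSQ] in auto)
    qed (use bilf_meas[OF uSQ vSQ] inner_meas[OF fibre_mem[OF W] SQ_SH[OF vSQ]] in auto)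
    also have "\<dots> = - hinner (L2 M) W V"
      using fibre_inner_AE[OF W VM SQ_SH[OF vSQ] v(2)] by simp
    finally show "bilinear_of (L2 M) Et F V = - hinner (L2 M) W V" .
  qed
qed

text \<open>Testing with \<open>D k\<close> cut off by an arbitrary measurable set of the base shows
  that the fibrewise defect has integral 0 over each such set, so it vanishes almost everywhere. The
  null sets of all \<open>k\<close> are united, and density in the form norm passes from
  \<open>D k\<close> to every test vector of the fibre.\<close>

lemma fibres_form_operator:
  assumes op: "form_operator (L2 M) Et F W"
  shows "AE z in N. form_operator (L2 (m z)) (E z) (fibre m F z) (fibre m W z)"
proof -
  have F: "F \<in> hcarrier (L2 M)" and Fdom: "F \<in> form_dom (L2 M) Et" and W: "W \<in> hcarrier (L2 M)"
    using op unfolding form_operator_def form_dom_def by auto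
  obtain u where u: "finite_energy u" and eq: "AE z in N. fibre m F z = u z"
    using Fdom by (rule form_dom_rep)
  note uSQ = finite_energy_SQ[OF u]
  \<comment> \<open>Here the inclusion of the generating functions in the domain of the direct
    integral form enters: it gives a representative of finite energy, equal to \<open>D k\<close>
    almost everywhere.\<close>
  have D_fin: "finite_energy (D k)" for k
  proof -
    obtain v where v: "finite_energy v" "AE z in N. fibre m (L2_class M (b k)) z = v z"
      using b_dom by (rule form_dom_rep)
    have "AE z in completion N. E z (D k z) + ennreal ((hnorm (L2 (m z)) (D k z))\<^sup>2)
        = E z (v z) + ennreal ((hnorm (L2 (m z)) (v z))\<^sup>2)"
      using AE_completion[OF v(2)] AE_completion[OF D_b[of k]] AE_completion[OF fibre_class[OF b_sq[of k]]]
      by eventually_elim simp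
    then show ?thesis using v(1) D_SQ[of k] by (simp add: finite_energy_def cong: nn_integral_cong_AE)
  qed
  have "AE z in N. bilf z (u z) (D k z) + hinner (L2 (m z)) (fibre m W z) (D k z) = 0" for k
  proof -
    define g where "g z = bilf z (u z) (D k z) + hinner (L2 (m z)) (fibre m W z) (D k z)" for z
    have int1: "integrable (completion N) (\<lambda>z. bilf z (u z) (D k z))"
      by (rule bilf_integrable[OF u D_fin])
    have int2: "integrable (completion N) (\<lambda>z. hinner (L2 (m z)) (fibre m W z) (D k z))"
      using W D_fin[of k] D_SQ[of k]
      by (intro sqint_inner_integrable fibre_mem fibre_sqint SQ_SH) (auto simp: finite_energy_iff)
    have "AE z in completion N. g z = 0"
    proof (rule AE_eq_0_if_integrals)
      show "integrable (completion N) g" unfolding g_def using int1 int2 by simp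
      fix B assume B: "B \<in> sets (completion N)"
      define v where "v z = (if z \<in> B then D k z else hzero (L2 (m z)))" for z
      have vSQ: "v \<in> SQ" using Q.restrict_mem[OF D_SQ[of k] B] by (simp add: v_def[abs_def] form_space_def cong: if_cong)
      have "(\<integral>\<^sup>+ z. E z (v z) + ennreal ((hnorm (L2 (m z)) (v z))\<^sup>2) \<partial>completion N)
          \<le> (\<integral>\<^sup>+ z. E z (D k z) + ennreal ((hnorm (L2 (m z)) (D k z))\<^sup>2) \<partial>completion N)"
        by (rule nn_integral_mono)
          (simp add: v_def hilbert_form.Q_zero[OF hilbert_form] pre_hilbert.norm_zero[OF pre_hilbert_L2])
      also have "\<dots> < \<infinity>" using D_fin[of k] by (simp add: finite_energy_def)
      finally have v: "finite_energy v" using vSQ by (simp add: finite_energy_def)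
      \<comment> \<open>The hypothesis can only be tested with classes in \<open>L2 M\<close>, so
        the cut-off field has to be realised by a function on the total space.\<close>
      obtain V where V: "V \<in> hcarrier (L2 M)" "AE z in N. fibre m V z = v z"
        using fibre_surj[OF SQ_SH[OF vSQ]] v by (auto simp: finite_energy_iff[OF vSQ])
      have "V \<in> form_dom (L2 M) Et" using V(1) v V(2) by (rule Et_eq(2))
      then have "bilinear_of (L2 M) Et F V = - hinner (L2 M) W V"
        using op by (simp add: form_operator_def)
      then have 0: "(LINT z|completion N. bilf z (u z) (v z))
          + (LINT z|completion N. hinner (L2 (m z)) (fibre m W z) (v z)) = 0"
        using bilinear_Et[OF F u eq V(1) v V(2)] fibre_inner_AE[OF W V(1) SQ_SH[OF vSQ] V(2)] by simp
      have "(LINT z|completion N. indicator B z * g z)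
          = (LINT z|completion N. bilf z (u z) (v z) + hinner (L2 (m z)) (fibre m W z) (v z))"
      proof (rule Bochner_Integration.integral_cong[OF refl])
        fix z assume "z \<in> space (completion N)"
        then have z: "z \<in> space N" by simp
        interpret hilbert_form "L2 (m z)" "E z" by (rule hilbert_form[OF z])
        have "bilf z (u z) (hzero (L2 (m z))) = 0"
          using SQ_dom[OF uSQ z] bil_diff_right[of "u z" "u z" "u z"] dist_self
          by (metis bil_diff_right cancel_comm_monoid_add_class.diff_cancel diff_closed diff_null
              dom_carrier inner_diff_left inner_zero_left vec_eqI zero_closed)
        then show "indicator B z * g z = bilf z (u z) (v z) + hinner (L2 (m z)) (fibre m W z) (v z)"
          by (simp add: v_def g_def indicator_def)
      qed
      also have "\<dots> = 0"
        using 0 bilf_integrable[OF u v] sqint_inner_integrable[OF fibre_mem[OF W] fibre_sqint[OF W] SQ_SH[OF vSQ]] v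
        by (simp add: finite_energy_iff[OF vSQ])
      finally show "(LINT z|completion N. indicator B z * g z) = 0" .
    qed
    then show ?thesis by (simp add: AE_completion_iff g_def)
  qed
  then have "AE z in N. \<forall>k. bilf z (u z) (D k z) + hinner (L2 (m z)) (fibre m W z) (D k z) = 0"
    by (simp add: AE_all_countable)
  then show ?thesis using eq AE_space
  proof eventually_elim
    case (elim z)
    interpret hilbert_form "L2 (m z)" "E z" by (rule hilbert_form[OF elim(3)])
    have "form_operator (L2 (m z)) (E z) (u z) (fibre m W z)"
    proof (rule form_operator_if_dense)
      show "u z \<in> form_dom (L2 (m z)) (E z)" by (rule SQ_dom[OF uSQ elim(3)])
      show "hdense (form_space (L2 (m z)) (E z)) (range (\<lambda>k. D k z))" by (rule D_form_dense[OF elim(3)])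
      show "bilf z (u z) d = - hinner (L2 (m z)) (fibre m W z) d" if "d \<in> range (\<lambda>k. D k z)" for d
        using elim(1) that by (auto simp: add_eq_0_iff2)
    qed simp
    then show ?case using elim(2) by simp
  qed
qed

section \<open>Density of the domain of the generator\<close>

lemma form_operator_add_Et:
  assumes "form_operator (L2 M) Et F W" "form_operator (L2 M) Et F' W'"
  shows "form_operator (L2 M) Et (hadd (L2 M) F F') (hadd (L2 M) W W')"
proof -
  interpret L2: pre_hilbert "L2 M" by (rule pre_hilbert_L2)
  have c: "F \<in> hcarrier (L2 M)" "W \<in> hcarrier (L2 M)" "F' \<in> hcarrier (L2 M)" "W' \<in> hcarrier (L2 M)"
    using assms unfolding form_operator_def form_dom_def by auto
  show ?thesis
  proof (rule form_operator_if_fibres)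
    show "AE z in N. form_operator (L2 (m z)) (E z) (fibre m (hadd (L2 M) F F') z) (fibre m (hadd (L2 M) W W') z)"
      using fibres_form_operator[OF assms(1)] fibres_form_operator[OF assms(2)] AE_space
        fibre_add[OF c(1,3)] fibre_add[OF c(2,4)]
    proof eventually_elim
      case (elim z)
      interpret hilbert_form "L2 (m z)" "E z" by (rule hilbert_form[OF elim(3)])
      show ?case using elim form_operator_add by simp
    qed
  qed (use c in auto)
qed

text \<open>For zero, as for sums, the relation is taken from the fibres: \<open>Et\<close> has not
  been shown to be a closed form, so the general rules do not apply to it directly.\<close>

lemma form_operator_zero_Et: "form_operator (L2 M) Et (hzero (L2 M)) (hzero (L2 M))"
proof (rule form_operator_if_fibres)
  interpret L2: pre_hilbert "L2 M" by (rule pre_hilbert_L2)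
  show "hzero (L2 M) \<in> hcarrier (L2 M)" "hzero (L2 M) \<in> hcarrier (L2 M)" by auto
  show "AE z in N. form_operator (L2 (m z)) (E z) (fibre m (hzero (L2 M)) z) (fibre m (hzero (L2 M)) z)"
    using fibre_class[OF sq_integrable_zero] AE_space
  proof eventually_elim
    case (elim z)
    interpret hilbert_form "L2 (m z)" "E z" by (rule hilbert_form[OF elim(2)])
    have "fibre m (hzero (L2 M)) z = hzero (L2 (m z))"
      using elim(1) by (simp add: L2_zero delta_eq sq_integrable_zero)
    then show ?case using form_operator_zero by simp
  qed
qed

text \<open>\<open>R\<close> is \<open>F\<close> minus its fibrewise resolvent, and the energy
  estimate is \<open>residual_energy\<close> integrated over the base.\<close>

lemma residual_step:
  assumes "F \<in> form_dom (L2 M) Et"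
  shows "\<exists>R W. R \<in> form_dom (L2 M) Et \<and> form_operator (L2 M) Et (hdiff (L2 M) F R) W \<and>
    enn2real (Et R) + 2 * (hnorm (L2 M) R)\<^sup>2 \<le> enn2real (Et F)"
proof -
  interpret L2: pre_hilbert "L2 M" by (rule pre_hilbert_L2)
  have F: "F \<in> hcarrier (L2 M)" using assms unfolding form_dom_def by blast
  obtain v where v: "finite_energy v" and eq: "AE z in N. fibre m F z = v z"
    using assms by (rule form_dom_rep)
  note vSQ = finite_energy_SQ[OF v]
  have "\<exists>g. z \<in> space N \<longrightarrow> g \<in> form_dom (L2 (m z)) (E z) \<and>
      (\<forall>w\<in>form_dom (L2 (m z)) (E z). bilf z g w + hinner (L2 (m z)) g w = hinner (L2 (m z)) (v z) w)" for z
    using hilbert_form.resolvent_exists[OF hilbert_form, of z "v z"] carrier[OF SQ_SH[OF vSQ]] by blast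
  then obtain g where g: "\<And>z. z \<in> space N \<Longrightarrow> g z \<in> form_dom (L2 (m z)) (E z)"
    and res: "\<And>z w. z \<in> space N \<Longrightarrow> w \<in> form_dom (L2 (m z)) (E z) \<Longrightarrow>
      bilf z (g z) w + hinner (L2 (m z)) (g z) w = hinner (L2 (m z)) (v z) w"
    by metis
  \<comment> \<open>The vectors \<open>g z\<close> were chosen point by point; measurability comes
    from the resolvent equation, by which the inner product of \<open>g\<close> with
    \<open>w\<close> in the form space equals that of \<open>v\<close> with \<open>w\<close> in
    \<open>L2 (m z)\<close>.\<close>
  have gSQ: "g \<in> SQ"
  proof (rule SQ_I[OF g])
    fix w assume w: "w \<in> SQ"
    have "(\<lambda>z. hinner (L2 (m z)) (v z) (w z)) \<in> borel_measurable (completion N)"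
      using w vSQ by (intro inner_meas SQ_SH)
    then show "(\<lambda>z. bilf z (w z) (g z) + hinner (L2 (m z)) (w z) (g z)) \<in> borel_measurable (completion N)"
    proof (rule measurable_cong[THEN iffD1, rotated])
      fix z assume "z \<in> space (completion N)"
      then have z: "z \<in> space N" by simp
      interpret hilbert_form "L2 (m z)" "E z" by (rule hilbert_form[OF z])
      show "hinner (L2 (m z)) (v z) (w z) = bilf z (w z) (g z) + hinner (L2 (m z)) (w z) (g z)"
        using res[OF z SQ_dom[OF w z]] g[OF z] SQ_dom[OF w z]
        by (simp add: bil_commute[of "w z"] inner_commute[of "w z"])
    qed
  qed
  define r where "r z = hdiff (L2 (m z)) (v z) (g z)" for z
  have rSQ: "r \<in> SQ" using SQ_diff[OF vSQ gSQ] by (simp add: r_def[abs_def])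
  have energy: "bilf z (r z) (r z) + 2 * (hnorm (L2 (m z)) (r z))\<^sup>2 \<le> bilf z (v z) (v z)" if z: "z \<in> space N" for z
  proof -
    interpret hilbert_form "L2 (m z)" "E z" by (rule hilbert_form[OF z])
    show ?thesis
      using residual_energy[OF SQ_dom[OF vSQ z] g[OF z] res[OF z]] SQ_dom[OF rSQ z]
      by (simp add: norm_sq flip: r_def)
  qed
  have energy': "E z (r z) + 2 * ennreal ((hnorm (L2 (m z)) (r z))\<^sup>2) \<le> E z (v z)" if z: "z \<in> space N" for z
  proof -
    interpret hilbert_form "L2 (m z)" "E z" by (rule hilbert_form[OF z])
    have "E z (r z) + 2 * ennreal ((hnorm (L2 (m z)) (r z))\<^sup>2)
        = ennreal (bilf z (r z) (r z) + 2 * (hnorm (L2 (m z)) (r z))\<^sup>2)"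
      using bil_nonneg[OF SQ_dom[OF rSQ z]] by (simp add: E_eq[OF rSQ z] ennreal_mult')
    also have "\<dots> \<le> ennreal (bilf z (v z) (v z))" using energy[OF z] by (rule ennreal_leI)
    finally show ?thesis by (simp add: E_eq[OF vSQ z])
  qed
  have [measurable]: "(\<lambda>z. E z (r z)) \<in> borel_measurable (completion N)"
    "(\<lambda>z. hnorm (L2 (m z)) (r z)) \<in> borel_measurable (completion N)"
    using rSQ by (auto intro: E_meas norm_meas SQ_SH)
  have total: "(\<integral>\<^sup>+ z. E z (r z) \<partial>completion N) + 2 * (\<integral>\<^sup>+ z. ennreal ((hnorm (L2 (m z)) (r z))\<^sup>2) \<partial>completion N)
      \<le> (\<integral>\<^sup>+ z. E z (v z) \<partial>completion N)"
  proof -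
    have "(\<integral>\<^sup>+ z. E z (r z) \<partial>completion N) + 2 * (\<integral>\<^sup>+ z. ennreal ((hnorm (L2 (m z)) (r z))\<^sup>2) \<partial>completion N)
      = (\<integral>\<^sup>+ z. E z (r z) + 2 * ennreal ((hnorm (L2 (m z)) (r z))\<^sup>2) \<partial>completion N)"
      by (simp add: nn_integral_add nn_integral_cmult)
    also have "\<dots> \<le> (\<integral>\<^sup>+ z. E z (v z) \<partial>completion N)"
      using energy' by (intro nn_integral_mono) simp
    finally show ?thesis .
  qed
  have vfin: "(\<integral>\<^sup>+ z. E z (v z) \<partial>completion N) < \<infinity>" using v by (simp add: finite_energy_iff[OF vSQ])
  have fin: "(\<integral>\<^sup>+ z. E z (r z) \<partial>completion N) < \<infinity>"
    "2 * (\<integral>\<^sup>+ z. ennreal ((hnorm (L2 (m z)) (r z))\<^sup>2) \<partial>completion N) < \<infinity>"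
    using le_less_trans[OF total vfin] by simp_all
  have "(\<integral>\<^sup>+ z. ennreal ((hnorm (L2 (m z)) (r z))\<^sup>2) \<partial>completion N) < \<infinity>"
    using fin(2) by (auto simp: ennreal_mult_less_top)
  then have r: "finite_energy r" using fin(1)
    by (simp add: finite_energy_iff[OF rSQ] square_integrable_field_def)
  obtain R where R: "R \<in> hcarrier (L2 M)" "AE z in N. fibre m R z = r z"
    using fibre_surj[OF SQ_SH[OF rSQ]] r by (auto simp: finite_energy_iff[OF rSQ])
  \<comment> \<open>On the fibre, \<open>F - R\<close> is \<open>g\<close>, and the resolvent
    equation says that the generator sends \<open>g\<close> to \<open>g - v = - r\<close>.\<close>
  have "form_operator (L2 M) Et (hdiff (L2 M) F R) (hscale (L2 M) (- 1) R)"
  proof (rule form_operator_if_fibres)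
    show "AE z in N. form_operator (L2 (m z)) (E z) (fibre m (hdiff (L2 M) F R) z) (fibre m (hscale (L2 M) (- 1) R) z)"
      using R(2) eq fibre_diff[OF F R(1)] fibre_scale[OF R(1), of "- 1"] AE_space
    proof eventually_elim
      case (elim z)
      interpret hilbert_form "L2 (m z)" "E z" by (rule hilbert_form[OF elim(5)])
      have c: "v z \<in> form_dom (L2 (m z)) (E z)" "g z \<in> form_dom (L2 (m z)) (E z)" "r z \<in> form_dom (L2 (m z)) (E z)"
        using SQ_dom[OF vSQ] SQ_dom[OF rSQ] g elim(5) by auto
      have "hdiff (L2 (m z)) (v z) (r z) = g z"
        by (rule vec_eqI) (use c in \<open>auto simp: r_def\<close>)
      moreover have "bilf z (g z) w = hinner (L2 (m z)) (r z) w" if "w \<in> form_dom (L2 (m z)) (E z)" for w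
        using res[OF elim(5) that] c that by (simp add: r_def)
      ultimately show ?case
        using elim c by (simp add: form_operator_def)
    qed
  qed (use F R in auto)
  moreover have "R \<in> form_dom (L2 M) Et" using R(1) r R(2) by (rule Et_eq(2))
  moreover have "enn2real (Et R) + 2 * (hnorm (L2 M) R)\<^sup>2 \<le> enn2real (Et F)"
  proof -
    have "(\<integral>\<^sup>+ z. ennreal ((hnorm (L2 (m z)) (r z))\<^sup>2) \<partial>completion N)
        = (\<integral>\<^sup>+ z. ennreal ((hnorm (L2 (m z)) (fibre m R z))\<^sup>2) \<partial>completion N)"
      by (rule nn_integral_cong_AE) (use AE_completion[OF R(2)] in \<open>eventually_elim, simp\<close>)
    then have nR: "(\<integral>\<^sup>+ z. ennreal ((hnorm (L2 (m z)) (r z))\<^sup>2) \<partial>completion N) = ennreal ((hnorm (L2 M) R)\<^sup>2)"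
      using fibre_norm_integral[OF R(1)] by simp
    have "enn2real (Et R + 2 * ennreal ((hnorm (L2 M) R)\<^sup>2)) \<le> enn2real (Et F)"
      using total vfin
      by (intro enn2real_mono) (simp_all add: Et_eq(1)[OF R(1) r R(2)] Et_eq(1)[OF F v eq] nR)
    moreover have "enn2real (Et R + 2 * ennreal ((hnorm (L2 M) R)\<^sup>2)) = enn2real (Et R) + 2 * (hnorm (L2 M) R)\<^sup>2"
      using fin(1) by (subst enn2real_plus)
        (auto simp: Et_eq(1)[OF R(1) r R(2)] enn2real_mult ennreal_mult_less_top)
    ultimately show ?thesis by simp
  qed
  ultimately show ?thesis by blast
qed

lemma generator_dense_form_dom:
  assumes F: "F \<in> form_dom (L2 M) Et" and e: "e > 0"
  shows "\<exists>U W. form_operator (L2 M) Et U W \<and> hdist (L2 M) F U < e"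
proof (rule ccontr)
  assume "\<not> ?thesis"
  then have far: "e \<le> hdist (L2 M) F U" if "form_operator (L2 M) Et U W" for U W
    using that by force
  interpret L2: pre_hilbert "L2 M" by (rule pre_hilbert_L2)
  have domM: "G \<in> hcarrier (L2 M)" if "G \<in> form_dom (L2 M) Et" for G
    using that unfolding form_dom_def by blast
  have opM: "U \<in> hcarrier (L2 M)" if "form_operator (L2 M) Et U W" for U W
    using that domM by (auto simp: form_operator_def)
  \<comment> \<open>The residual stays in the form domain, so that the step can be repeated, and is
    kept in the form \<open>F - U\<close> with \<open>U\<close> in the domain of the generator. By
    \<open>far\<close> each new residual has norm at least \<open>e\<close>, so every step uses up
    at least \<open>2 * e\<^sup>2\<close> of the energy of \<open>F\<close>.\<close>
  have "\<exists>R U W. R \<in> form_dom (L2 M) Et \<and> form_operator (L2 M) Et U W \<and> hdiff (L2 M) F U = R \<and>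
      enn2real (Et R) + real k * (2 * e\<^sup>2) \<le> enn2real (Et F)" for k
  proof (induction k)
    case 0
    have "hdiff (L2 M) F (hzero (L2 M)) = F"
      by (rule L2.vec_eqI) (use domM[OF F] in auto)
    then show ?case using F form_operator_zero_Et by auto
  next
    case (Suc k)
    then obtain R U W where R: "R \<in> form_dom (L2 M) Et" "form_operator (L2 M) Et U W" "hdiff (L2 M) F U = R"
      "enn2real (Et R) + real k * (2 * e\<^sup>2) \<le> enn2real (Et F)" by blast
    obtain R' W' where R': "R' \<in> form_dom (L2 M) Et" "form_operator (L2 M) Et (hdiff (L2 M) R R') W'"
      "enn2real (Et R') + 2 * (hnorm (L2 M) R')\<^sup>2 \<le> enn2real (Et R)"
      using residual_step[OF R(1)] by blast
    define U' where "U' = hadd (L2 M) U (hdiff (L2 M) R R')"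
    have op: "form_operator (L2 M) Et U' (hadd (L2 M) W W')"
      unfolding U'_def by (rule form_operator_add_Et[OF R(2) R'(2)])
    have eq: "hdiff (L2 M) F U' = R'"
      unfolding U'_def R(3)[symmetric]
      by (rule L2.vec_eqI) (use domM[OF F] opM[OF R(2)] domM[OF R'(1)] in auto)
    have "e \<le> hnorm (L2 M) R'" using far[OF op] eq by (simp add: hdist_def)
    then have "e\<^sup>2 \<le> (hnorm (L2 M) R')\<^sup>2" using e by (intro power_mono) auto
    then have "enn2real (Et R') + real (Suc k) * (2 * e\<^sup>2) \<le> enn2real (Et F)"
      using R(4) R'(3) by (simp add: algebra_simps)
    then show ?case using R'(1) op eq by blast
  qed
  then have "real k * (2 * e\<^sup>2) \<le> enn2real (Et F)" for k
    using enn2real_nonneg by (smt (verit))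
  moreover obtain k where "enn2real (Et F) / (2 * e\<^sup>2) < real k" using reals_Archimedean2 by blast
  ultimately show False using e by (smt (verit) pos_divide_less_eq zero_less_power)
qed

lemma generator_dense:
  assumes F: "F \<in> hcarrier (L2 M)" and e: "e > 0"
  shows "\<exists>U W. form_operator (L2 M) Et U W \<and> hdist (L2 M) F U < e"
proof -
  interpret L2: pre_hilbert "L2 M" by (rule pre_hilbert_L2)
  obtain G where G: "G \<in> form_dom (L2 M) Et" "hdist (L2 M) F G < e / 2"
    using form_dom_dense F e unfolding hdense_def by (meson half_gt_zero)
  obtain U W where U: "form_operator (L2 M) Et U W" "hdist (L2 M) G U < e / 2"
    using generator_dense_form_dom[OF G(1), of "e / 2"] e by auto
  have "G \<in> hcarrier (L2 M)" "U \<in> hcarrier (L2 M)"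
    using G(1) U(1) unfolding form_operator_def form_dom_def by auto
  then have "hdist (L2 M) F U < e" using L2.dist_triangle[of F G U] F G(2) U(2) by simp
  then show ?thesis using U(1) by blast
qed

end

section \<open>Semigroups and intertwining\<close>

text \<open>The distance of two orbits need not be differentiable, so only a bound on the upper
  right growth is assumed. For a slope \<open>e > 0\<close>, the set \<open>A\<close> of times at
  which \<open>\<psi>\<close> is at most \<open>\<psi> 0 + e * r\<close> is closed by continuity,
  and the bound moves its supremum to the right until it reaches \<open>t\<close>.\<close>

lemma Dini_nonincreasing:
  fixes \<psi> :: "real \<Rightarrow> real"
  assumes cont: "continuous_on {0..} \<psi>"
    and Dini: "\<And>r e. 0 \<le> r \<Longrightarrow> 0 < e \<Longrightarrow> \<forall>\<^sub>F h in at_right 0. \<psi> (r + h) \<le> \<psi> r + e * h"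
    and t: "0 \<le> t"
  shows "\<psi> t \<le> \<psi> 0"
proof (rule field_le_epsilon)
  fix d :: real assume d: "0 < d"
  \<comment> \<open>Chosen so that the slack \<open>e * t\<close> is at most \<open>d\<close>; the
    added 1 covers \<open>t = 0\<close>.\<close>
  define e where "e = d / (t + 1)"
  have e: "0 < e" and et: "e * t \<le> d" using d t by (auto simp: e_def field_simps)
  define A where "A = {r \<in> {0..t}. \<psi> r - e * r \<le> \<psi> 0}"
  have "continuous_on {0..t} (\<lambda>r. \<psi> r - e * r)"
    by (intro continuous_intros continuous_on_subset[OF cont]) auto
  then have "closed ({0..t} \<inter> (\<lambda>r. \<psi> r - e * r) -` {..\<psi> 0})"
    by (rule continuous_closed_preimage) auto
  moreover have "A = {0..t} \<inter> (\<lambda>r. \<psi> r - e * r) -` {..\<psi> 0}" by (auto simp: A_def)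
  ultimately have closed: "closed A" by simp
  have A0: "0 \<in> A" using t by (simp add: A_def)
  have bdd: "bdd_above A" by (auto simp: A_def bdd_above_def)
  define c where "c = Sup A"
  have cA: "c \<in> A" unfolding c_def using closed_contains_Sup[OF _ bdd closed] A0 by blast
  have "c = t"
  proof (rule ccontr)
    assume "c \<noteq> t"
    then have c: "0 \<le> c" "c < t" "\<psi> c - e * c \<le> \<psi> 0" using cA by (auto simp: A_def)
    have "\<forall>\<^sub>F h in at_right 0. \<psi> (c + h) \<le> \<psi> c + e * h \<and> 0 < h \<and> h < t - c"
      using c by (intro eventually_conj Dini e eventually_at_right_less eventually_at_right_field[THEN iffD2])
        (auto intro!: exI[of _ "t - c"])
    then obtain h where h: "\<psi> (c + h) \<le> \<psi> c + e * h" "0 < h" "h < t - c"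
      by (metis (mono_tags, lifting) eventually_happens' trivial_limit_at_right_real)
    then have "c + h \<in> A" using c by (simp add: A_def algebra_simps)
    then have "c + h \<le> c" unfolding c_def[symmetric] using bdd cSup_upper c_def by blast
    then show False using h by simp
  qed
  then show "\<psi> t \<le> \<psi> 0 + d" using cA et by (simp add: A_def)
qed

text \<open>The bound depends on \<open>h\<close> but not on \<open>r\<close>. Taking the earlier of
  two times as base point gives continuity from the left as well, although \<open>h\<close> is
  positive.\<close>

lemma continuous_on_if_modulus:
  fixes \<psi> :: "real \<Rightarrow> real"
  assumes mod: "\<And>r h. 0 \<le> r \<Longrightarrow> 0 < h \<Longrightarrow> \<bar>\<psi> (r + h) - \<psi> r\<bar> \<le> \<omega> h"
    and lim: "(\<omega> \<longlongrightarrow> 0) (at_right 0)"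
  shows "continuous_on {0..} \<psi>"
  unfolding continuous_on_iff
proof (intro ballI allI impI)
  fix r e :: real assume r: "r \<in> {0..}" and e: "0 < e"
  have "\<forall>\<^sub>F h in at_right 0. \<omega> h < e" using order_tendstoD(2)[OF lim] e by simp
  then obtain d where d: "d > 0" "\<And>h. 0 < h \<Longrightarrow> h < d \<Longrightarrow> \<omega> h < e"
    by (auto simp: eventually_at_right_field)
  show "\<exists>d>0. \<forall>x'\<in>{0..}. dist x' r < d \<longrightarrow> dist (\<psi> x') (\<psi> r) < e"
  proof (intro exI[of _ d] conjI ballI impI d(1))
    fix x assume x: "x \<in> {0..}" "dist x r < d"
    consider "x = r" | "r < x" | "x < r" by linarith
    then show "dist (\<psi> x) (\<psi> r) < e"
    proof cases
      case 1 then show ?thesis using e by simp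
    next
      case 2 then show ?thesis using mod[of r "x - r"] d(2)[of "x - r"] r x by (simp add: dist_real_def)
    next
      case 3 then show ?thesis using mod[of x "r - x"] d(2)[of "r - x"] r x by (simp add: dist_real_def)
    qed
  qed
qed

section \<open>Contraction semigroups, their generators and their orbits\<close>

locale semigroup_form = pre_hilbert H for H :: "'h hspace" +
  fixes Q :: "'h \<Rightarrow> ennreal" and T :: "real \<Rightarrow> 'h \<Rightarrow> 'h"
  assumes semigroup: "form_semigroup H Q T"
begin

lemma lin: "0 \<le> t \<Longrightarrow> hlinear H H (T t)"
  using semigroup by (simp add: form_semigroup_def)

lemma T_closed [simp]: "0 \<le> t \<Longrightarrow> u \<in> hcarrier H \<Longrightarrow> T t u \<in> hcarrier H"
  using lin[of t] by (auto simp: hlinear_def)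

lemma T_add: "0 \<le> t \<Longrightarrow> u \<in> hcarrier H \<Longrightarrow> v \<in> hcarrier H \<Longrightarrow> T t (hadd H u v) = hadd H (T t u) (T t v)"
  and T_scale: "0 \<le> t \<Longrightarrow> u \<in> hcarrier H \<Longrightarrow> T t (hscale H c u) = hscale H c (T t u)"
  using lin[of t] by (auto simp: hlinear_def)

lemma T_diff: "0 \<le> t \<Longrightarrow> u \<in> hcarrier H \<Longrightarrow> v \<in> hcarrier H \<Longrightarrow> T t (hdiff H u v) = hdiff H (T t u) (T t v)"
  by (simp add: hdiff_def T_add T_scale)

lemma contraction: "0 \<le> t \<Longrightarrow> u \<in> hcarrier H \<Longrightarrow> v \<in> hcarrier H \<Longrightarrow> hdist H (T t u) (T t v) \<le> hdist H u v"
  using semigroup by (simp add: hdist_def form_semigroup_def flip: T_diff)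

lemma T_0: "u \<in> hcarrier H \<Longrightarrow> T 0 u = u"
  and T_plus: "0 \<le> r \<Longrightarrow> 0 \<le> t \<Longrightarrow> u \<in> hcarrier H \<Longrightarrow> T (r + t) u = T r (T t u)"
  and strong_continuity: "u \<in> hcarrier H \<Longrightarrow> ((\<lambda>t. hdist H (T t u) u) \<longlongrightarrow> 0) (at_right 0)"
  using semigroup by (simp_all add: form_semigroup_def)

abbreviation "dquot u h \<equiv> hscale H (1 / h) (hdiff H (T h u) u)"

lemma generator: "u \<in> hcarrier H \<Longrightarrow> w \<in> hcarrier H \<Longrightarrow>
    form_operator H Q u w \<longleftrightarrow> ((\<lambda>h. hdist H (dquot u h) w) \<longlongrightarrow> 0) (at_right 0)"
  using semigroup by (simp add: form_semigroup_def)

lemma generator_carrier: "form_operator H Q u w \<Longrightarrow> u \<in> hcarrier H \<and> w \<in> hcarrier H"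
  by (simp add: form_operator_def form_dom_def)

text \<open>Difference quotients of \<open>T t u\<close> are images under \<open>T t\<close> of
  those of \<open>u\<close>, since the semigroup commutes with itself, and \<open>T t\<close> is a
  contraction.\<close>

lemma generator_invariant:
  assumes op: "form_operator H Q u w" and t: "0 \<le> t"
  shows "form_operator H Q (T t u) (T t w)"
proof -
  have u: "u \<in> hcarrier H" and w: "w \<in> hcarrier H" using generator_carrier[OF op] by auto
  have "((\<lambda>h. hdist H (dquot (T t u) h) (T t w)) \<longlongrightarrow> 0) (at_right 0)"
  proof (rule Lim_null_comparison)
    show "((\<lambda>h. hdist H (dquot u h) w) \<longlongrightarrow> 0) (at_right 0)" using op u w by (simp add: generator)
    show "\<forall>\<^sub>F h in at_right 0. norm (hdist H (dquot (T t u) h) (T t w)) \<le> hdist H (dquot u h) w"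
      using eventually_at_right_less[of 0]
    proof eventually_elim
      case (elim h)
      have "T h (T t u) = T t (T h u)" using elim t u by (simp flip: T_plus add: add.commute)
      then have "dquot (T t u) h = T t (dquot u h)"
        using elim t u by (simp add: T_scale T_diff)
      then show ?case using elim t u w by (simp add: contraction)
    qed
  qed
  then show ?thesis using u w t by (simp add: generator)
qed

lemma T_modulus:
  assumes "0 \<le> r" "0 < h" "u \<in> hcarrier H"
  shows "hdist H (T (r + h) u) (T r u) \<le> hdist H (T h u) u"
  using assms by (simp add: T_plus contraction)

end

text \<open>Along an orbit of the generator domain, the distance of the two evolutions has upper right
  derivative at most zero.\<close>

lemma semigroups_intertwined_if_generators:
  assumes "semigroup_form H Q S" "semigroup_form K R T" and V: "hunitary H K V"
    and gen: "\<And>u w. form_operator H Q u w \<Longrightarrow> form_operator K R (V u) (V w)"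
    and dense: "\<And>u e. u \<in> hcarrier H \<Longrightarrow> e > 0 \<Longrightarrow> \<exists>v w. form_operator H Q v w \<and> hdist H u v < e"
    and t: "0 \<le> t" and u: "u \<in> hcarrier H"
  shows "V (S t u) = T t (V u)"
proof -
  interpret H: semigroup_form H Q S by fact
  interpret K: semigroup_form K R T by fact
  have V_closed [simp]: "V x \<in> hcarrier K" if "x \<in> hcarrier H" for x
    using V that by (auto simp: hunitary_def hlinear_def)
  have V_scale: "V (hscale H c x) = hscale K c (V x)" if "x \<in> hcarrier H" for x c
    using V that by (simp add: hunitary_def hlinear_def)
  have V_diff: "V (hdiff H x y) = hdiff K (V x) (V y)" if "x \<in> hcarrier H" "y \<in> hcarrier H" for x y
    using V that by (simp add: hdiff_def hunitary_def hlinear_def)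
  have V_dist: "hdist K (V x) (V y) = hdist H x y" if "x \<in> hcarrier H" "y \<in> hcarrier H" for x y
    using V that by (simp add: hdist_def hnorm_def hunitary_def flip: V_diff)
  have on_generator: "V (S t v) = T t (V v)" if op: "form_operator H Q v w" for v w
  proof -
    have v: "v \<in> hcarrier H" and w: "w \<in> hcarrier H" using H.generator_carrier[OF op] by auto
    define \<psi> where "\<psi> r = hdist K (T r (V v)) (V (S r v))" for r
    have cont: "continuous_on {0..} \<psi>"
    proof (rule continuous_on_if_modulus)
      show "((\<lambda>h. hdist K (T h (V v)) (V v) + hdist H (S h v) v) \<longlongrightarrow> 0) (at_right 0)"
        using tendsto_add[OF K.strong_continuity[of "V v"] H.strong_continuity[OF v]] v by simp
      fix r h :: real assume rh: "0 \<le> r" "0 < h"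
      define a b c d where "a = T (r + h) (V v)" and "b = V (S (r + h) v)" and "c = T r (V v)" and "d = V (S r v)"
      have abcd: "a \<in> hcarrier K" "b \<in> hcarrier K" "c \<in> hcarrier K" "d \<in> hcarrier K"
        using v rh by (auto simp: a_def b_def c_def d_def)
      have ac: "hdist K a c \<le> hdist K (T h (V v)) (V v)"
        unfolding a_def c_def by (rule K.T_modulus) (use rh v in auto)
      have bd: "hdist K b d \<le> hdist H (S h v) v"
        using H.T_modulus[OF rh v] rh v by (simp add: b_def d_def V_dist)
      have "\<bar>hdist K a b - hdist K c d\<bar> \<le> hdist K a c + hdist K b d"
        using K.dist_triangle[of a c b] K.dist_triangle[of c d b] K.dist_triangle[of c a d] K.dist_triangle[of a b d]
          K.dist_commute[of a c] K.dist_commute[of b d] abcd by linarith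
      then show "\<bar>\<psi> (r + h) - \<psi> r\<bar> \<le> hdist K (T h (V v)) (V v) + hdist H (S h v) v"
        using ac bd by (simp add: \<psi>_def a_def b_def c_def d_def)
    qed
    have "\<psi> t \<le> \<psi> 0"
    proof (rule Dini_nonincreasing[OF cont _ t])
      fix r e :: real assume r: "0 \<le> r" and e: "0 < e"
      \<comment> \<open>Over the next \<open>h\<close> the old gap is carried along by the
        contraction \<open>T h\<close>. The new gap is that of two orbits starting at the common
        point \<open>V y\<close> with the common derivative \<open>V y'\<close>; the two halves of
        \<open>e\<close> bound their deviations from it.\<close>
      define y where "y = S r v"
      define y' where "y' = S r w"
      have y: "y \<in> hcarrier H" "y' \<in> hcarrier H" using v w r by (auto simp: y_def y'_def)
      have op_y: "form_operator H Q y y'" unfolding y_def y'_def by (rule H.generator_invariant[OF op r])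
      have "((\<lambda>h. hdist H (H.dquot y h) y') \<longlongrightarrow> 0) (at_right 0)"
        using op_y y by (simp add: H.generator)
      then have ev1: "\<forall>\<^sub>F h in at_right 0. hdist H (H.dquot y h) y' < e / 2"
        by (rule order_tendstoD) (use e in simp)
      have "((\<lambda>h. hdist K (K.dquot (V y) h) (V y')) \<longlongrightarrow> 0) (at_right 0)"
        using gen[OF op_y] y by (simp add: K.generator)
      then have ev2: "\<forall>\<^sub>F h in at_right 0. hdist K (K.dquot (V y) h) (V y') < e / 2"
        by (rule order_tendstoD) (use e in simp)
      show "\<forall>\<^sub>F h in at_right 0. \<psi> (r + h) \<le> \<psi> r + e * h"
        using ev1 ev2 eventually_at_right_less[of 0]
      proof eventually_elim
        case (elim h)
        have Shy: "S h y \<in> hcarrier H" using y elim by simp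
        have "hdist K (K.dquot (V y) h) (V (H.dquot y h))
            \<le> hdist K (K.dquot (V y) h) (V y') + hdist K (V y') (V (H.dquot y h))"
          using y Shy elim by (intro K.dist_triangle) auto
        also have "hdist K (V y') (V (H.dquot y h)) = hdist H (H.dquot y h) y'"
          using y Shy by (simp add: V_dist H.dist_commute)
        finally have close: "hdist K (K.dquot (V y) h) (V (H.dquot y h)) \<le> e" using elim by linarith
        have "hdiff K (K.dquot (V y) h) (V (H.dquot y h)) = hscale K (1 / h) (hdiff K (T h (V y)) (V (S h y)))"
          using y Shy elim
          by (intro K.vec_eqI) (auto simp: V_scale V_diff algebra_simps)
        then have "hdist K (K.dquot (V y) h) (V (H.dquot y h)) = hdist K (T h (V y)) (V (S h y)) / h"
          using y Shy elim by (simp add: hdist_def K.norm_scale)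
        then have gap: "hdist K (T h (V y)) (V (S h y)) \<le> e * h"
          using close elim by (simp add: divide_le_eq)
        have "T (r + h) (V v) = T h (T r (V v))" "S (r + h) v = S h y"
          using r elim v K.T_plus[of h r "V v"] H.T_plus[of h r v] by (auto simp: y_def add.commute)
        then have "\<psi> (r + h) = hdist K (T h (T r (V v))) (V (S h y))" by (simp add: \<psi>_def)
        also have "\<dots> \<le> hdist K (T h (T r (V v))) (T h (V y)) + hdist K (T h (V y)) (V (S h y))"
          using y Shy elim r v by (intro K.dist_triangle) auto
        also have "\<dots> \<le> hdist K (T r (V v)) (V y) + e * h"
          using gap K.contraction[of h "T r (V v)" "V y"] elim r v y by simp
        finally show ?case by (simp add: \<psi>_def y_def)
      qed
    qed
    also have "\<psi> 0 = 0" using v by (simp add: \<psi>_def H.T_0 K.T_0)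
    finally have "hdist K (T t (V v)) (V (S t v)) \<le> 0" by (simp add: \<psi>_def)
    moreover have "0 \<le> hdist K (T t (V v)) (V (S t v))" using v t by (intro K.dist_nonneg) auto
    ultimately show ?thesis using K.dist_zeroD[of "T t (V v)" "V (S t v)"] v t by simp
  qed
  \<comment> \<open>Both \<open>V\<close> after \<open>S t\<close> and \<open>T t\<close> after
    \<open>V\<close> are contractions, so agreement on the dense domain of the generator extends to
    all vectors.\<close>
  have "hdist K (V (S t u)) (T t (V u)) \<le> 0 + e" if e: "e > 0" for e
  proof -
    obtain v w where vw: "form_operator H Q v w" "hdist H u v < e / 2"
      using dense[OF u, of "e / 2"] e by auto
    then have v: "v \<in> hcarrier H" using H.generator_carrier by blast
    have "hdist K (V (S t u)) (T t (V u)) \<le> hdist K (V (S t u)) (V (S t v)) + hdist K (T t (V v)) (T t (V u))"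
      using K.dist_triangle[of "V (S t u)" "V (S t v)" "T t (V u)"] on_generator[OF vw(1)] u v t by simp
    also have "\<dots> \<le> hdist H u v + hdist H v u"
      using H.contraction[OF t u v] K.contraction[OF t, of "V v" "V u"] u v t by (simp add: V_dist)
    also have "\<dots> \<le> e" using vw(2) u v by (simp add: H.dist_commute[of v u])
    finally show ?thesis by simp
  qed
  then have "hdist K (V (S t u)) (T t (V u)) \<le> 0" by (rule field_le_epsilon)
  moreover have "0 \<le> hdist K (V (S t u)) (T t (V u))" using u t by (intro K.dist_nonneg) auto
  ultimately show ?thesis using K.dist_zeroD[of "V (S t u)" "T t (V u)"] u t by simp
qed

text \<open>\<open>V\<close> is isometric and maps difference quotients to difference quotients, so
  both limits exist or fail together. Only positive times occur in the quotients, which is why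
  commutation for \<open>t > 0\<close> is enough.\<close>

lemma generators_intertwined_if_semigroups:
  assumes "semigroup_form H Q S" "semigroup_form K R T" and V: "hunitary H K V"
    and comm: "\<And>t u. t > 0 \<Longrightarrow> u \<in> hcarrier H \<Longrightarrow> T t (V u) = V (S t u)"
    and u: "u \<in> hcarrier H" and w: "w \<in> hcarrier H"
  shows "form_operator K R (V u) (V w) \<longleftrightarrow> form_operator H Q u w"
proof -
  interpret H: semigroup_form H Q S by fact
  interpret K: semigroup_form K R T by fact
  have V_closed [simp]: "V x \<in> hcarrier K" if "x \<in> hcarrier H" for x
    using V that by (auto simp: hunitary_def hlinear_def)
  have V_scale: "V (hscale H c x) = hscale K c (V x)" if "x \<in> hcarrier H" for x c
    using V that by (simp add: hunitary_def hlinear_def)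
  have V_diff: "V (hdiff H x y) = hdiff K (V x) (V y)" if "x \<in> hcarrier H" "y \<in> hcarrier H" for x y
    using V that by (simp add: hdiff_def hunitary_def hlinear_def)
  have V_dist: "hdist K (V x) (V y) = hdist H x y" if "x \<in> hcarrier H" "y \<in> hcarrier H" for x y
    using V that by (simp add: hdist_def hnorm_def hunitary_def flip: V_diff)
  have "\<forall>\<^sub>F h in at_right 0. hdist K (K.dquot (V u) h) (V w) = hdist H (H.dquot u h) w"
    using eventually_at_right_less[of 0]
  proof eventually_elim
    case (elim h)
    then have "K.dquot (V u) h = V (H.dquot u h)"
      using u by (simp add: comm V_scale V_diff)
    then show ?case using elim u w by (simp add: V_dist)
  qed
  then show ?thesis using u w by (simp add: H.generator K.generator tendsto_cong)
qed

text \<open>The rational combinations of a total sequence \<open>delta m (a n)\<close> are formed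
  twice: on every fibre, where they are dense in the form norm, and on the total space, where they
  stay in the linear space \<open>A\<close> and therefore in the domain of the direct integral
  form.\<close>

lemma compatible_form_field:
  fixes M :: "'x measure" and N :: "'z measure"
  assumes dis: "disintegration M N s m" and forms: "measurable_form_field N (\<lambda>z. L2 (m z)) SH E SQ"
    and compat: "compatible M N m SH E SQ"
  shows "\<exists>b D. form_field M N s m SH E SQ b D"
proof -
  interpret disintegration M N s m by fact
  let ?H = "\<lambda>z. form_space (L2 (m z)) (E z)"
  let ?Et = "L2_direct_integral_form N m SH E SQ"
  obtain A where A: "A \<subseteq> sq_integrable M" and A0: "(\<lambda>x. 0) \<in> A"
    and Aadd: "\<And>f g. f \<in> A \<Longrightarrow> g \<in> A \<Longrightarrow> (\<lambda>x. f x + g x) \<in> A"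
    and Ascale: "\<And>c f. f \<in> A \<Longrightarrow> (\<lambda>x. c * f x) \<in> A"
    and dense: "hdense (L2 M) (L2_class M ` A)"
    and gen: "field_generated_by N ?H (delta m ` A) SQ"
    and dom: "L2_class M ` A \<subseteq> form_dom (L2 M) ?Et"
    using compat unfolding compatible_def by auto
  interpret Q: hilbert_field N ?H SQ
    by standard (use forms in \<open>simp add: measurable_form_field_def\<close>)
  obtain w where w: "\<And>n::nat. w n \<in> delta m ` A" and total: "\<And>z. z \<in> space N \<Longrightarrow> htotal (?H z) (range (\<lambda>n. w n z))"
    using gen unfolding field_generated_by_def total_sequence_in_def by blast
  have wSQ: "w n \<in> SQ" for n using gen w[of n] by (auto simp: field_generated_by_def)
  from w have "\<forall>n. \<exists>f\<in>A. w n = delta m f" by blast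
  then obtain a where a: "\<And>n. a n \<in> A" "\<And>n. w n = delta m (a n)" by metis
  \<comment> \<open>The counterpart of \<open>rat_comb\<close> on functions, with the same
    codes.\<close>
  define c where "c xs = foldr (\<lambda>(q, n) f x. of_rat q * a n x + f x) xs (\<lambda>x. 0)" for xs :: "(rat \<times> nat) list"
  have c_simps: "c [] = (\<lambda>x. 0)" "c ((q, n) # xs) = (\<lambda>x. of_rat q * a n x + c xs x)" for q n xs
    by (auto simp: c_def)
  have cA: "c xs \<in> A" for xs
  proof (induction xs)
    case (Cons p xs)
    obtain q n where "p = (q, n)" by (cases p)
    then show ?case using Aadd[OF Ascale[OF a(1)[of n], of "of_rat q"] Cons.IH] by (simp add: c_simps)
  qed (simp add: c_simps A0)
  have rat_comb_c: "AE z in N. rat_comb (?H z) (\<lambda>n. w n z) xs = delta m (c xs) z" for xs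
  proof (induction xs)
    case Nil
    then show ?case by (simp add: c_simps form_space_def delta_eq sq_integrable_zero L2_zero)
  next
    case (Cons p xs)
    obtain q n where p: "p = (q, n)" by (cases p)
    have sq: "a n \<in> sq_integrable M" "(\<lambda>x. of_rat q * a n x) \<in> sq_integrable M" "c xs \<in> sq_integrable M"
      using A a cA by (auto intro: sq_integrable_scale)
    show ?case
      using Cons.IH delta_add[OF sq(2,3)] delta_scale[OF sq(1), of "of_rat q"]
      by eventually_elim (simp add: p c_simps a(2) form_space_def)
  qed
  define b where "b k = c (from_nat k)" for k
  define D where "D k z = rat_comb (?H z) (\<lambda>n. w n z) (from_nat k)" for k z
  have "form_field M N s m SH E SQ b D"
  proof (unfold_locales)
    show "measurable_form_field N (\<lambda>z. L2 (m z)) SH E SQ" by fact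
    show "b k \<in> sq_integrable M" "L2_class M (b k) \<in> form_dom (L2 M) ?Et" for k
      using cA A dom by (auto simp: b_def)
    show "D k \<in> SQ" for k unfolding D_def by (rule Q.rat_comb_mem[OF wSQ])
    show "AE z in N. D k z = delta m (b k) z" for k unfolding D_def b_def by (rule rat_comb_c)
    show "hdense (?H z) (range (\<lambda>k. D k z))" if z: "z \<in> space N" for z
    proof -
      have "range (\<lambda>k. D k z) = rat_comb (?H z) (\<lambda>n. w n z) ` range from_nat"
        unfolding D_def by (simp only: image_image)
      also have "\<dots> = range (rat_comb (?H z) (\<lambda>n. w n z))" by simp
      finally show ?thesis
        using pre_hilbert.rat_comb_dense[OF Q.pre[OF z], of "\<lambda>n. w n z"] Q.carrier[OF wSQ z] total[OF z] by simp
    qed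
    show "hdense (L2 M) (form_dom (L2 M) ?Et)"
      using dense dom unfolding hdense_def form_dom_def by blast
  qed
  then show ?thesis by blast
qed

section \<open>The direct integral of the unitaries\<close>

locale intertwined_fields =
  A: form_field M N s m1 SH1 E1 SQ1 b1 D1 + B: form_field M N s m2 SH2 E2 SQ2 b2 D2
  for M :: "'x measure" and N :: "'z measure" and s m1 SH1 E1 SQ1 b1 D1 m2 SH2 E2 SQ2 b2 D2 +
  fixes U :: "'z \<Rightarrow> ('x \<Rightarrow> real) set \<Rightarrow> ('x \<Rightarrow> real) set"
  assumes U_field: "measurable_operator_field N (\<lambda>z. L2 (m1 z)) SH1 (\<lambda>z. L2 (m2 z)) SH2 U"
    and U_unitary: "z \<in> space N \<Longrightarrow> hunitary (L2 (m1 z)) (L2 (m2 z)) (U z)"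
begin

abbreviation "Ut \<equiv> L2_direct_integral_operator M N m1 SH1 m2 SH2 U"

lemma U_mem: "u \<in> SH1 \<Longrightarrow> (\<lambda>z. U z (u z)) \<in> SH2"
  using U_field by (simp add: measurable_operator_field_def)

lemma U_norm: "z \<in> space N \<Longrightarrow> u \<in> hcarrier (L2 (m1 z)) \<Longrightarrow> hnorm (L2 (m2 z)) (U z u) = hnorm (L2 (m1 z)) u"
  using U_unitary[of z] by (simp add: hunitary_def hnorm_def)

lemma U_inj: "z \<in> space N \<Longrightarrow> inj_on (U z) (hcarrier (L2 (m1 z)))"
  using U_unitary[of z] by (simp add: hunitary_def bij_betw_def)

lemma U_sqint:
  assumes "u \<in> SH1"
  shows "square_integrable_field N (\<lambda>z. L2 (m2 z)) (\<lambda>z. U z (u z)) \<longleftrightarrow>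
    square_integrable_field N (\<lambda>z. L2 (m1 z)) u"
proof -
  have "(\<integral>\<^sup>+ z. ennreal ((hnorm (L2 (m2 z)) (U z (u z)))\<^sup>2) \<partial>completion N)
      = (\<integral>\<^sup>+ z. ennreal ((hnorm (L2 (m1 z)) (u z))\<^sup>2) \<partial>completion N)"
    using A.carrier[OF assms] by (intro nn_integral_cong) (simp add: U_norm)
  then show ?thesis by (simp add: square_integrable_field_def)
qed

text \<open>The field of images \<open>U z (fibre m1 F z)\<close> comes from some class
  \<open>G\<close> by surjectivity of the second identification, and the inverse in the definition
  of \<open>Ut\<close> returns \<open>G\<close>. All further properties of \<open>Ut\<close> are
  read off from its fibres.\<close>

lemma Ut_fib:
  assumes F: "F \<in> hcarrier (L2 M)"
  shows "Ut F \<in> hcarrier (L2 M)" "AE z in N. fibre m2 (Ut F) z = U z (fibre m1 F z)"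
proof -
  have "AE z in N. field_rep (L2_to_direct_integral N m1 SH1 F) z = fibre m1 F z"
    unfolding A.identification_class[OF F] by (rule A.field_rep_class[OF A.fibre_mem[OF F] A.fibre_sqint[OF F]])
  then have rep: "AE z in N. U z (field_rep (L2_to_direct_integral N m1 SH1 F) z) = U z (fibre m1 F z)"
    by eventually_elim simp
  obtain G where G: "G \<in> hcarrier (L2 M)" "AE z in N. fibre m2 G z = U z (fibre m1 F z)"
    using B.fibre_surj[OF U_mem[OF A.fibre_mem[OF F]]] U_sqint[OF A.fibre_mem[OF F]] A.fibre_sqint[OF F] by blast
  have "AE z in N. U z (field_rep (L2_to_direct_integral N m1 SH1 F) z) = fibre m2 G z"
    using rep G(2) by eventually_elim simp
  then have "direct_integral_operator N (\<lambda>z. L2 (m2 z)) SH2 U (L2_to_direct_integral N m1 SH1 F)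
      = L2_to_direct_integral N m2 SH2 G"
    unfolding direct_integral_operator_def B.identification_class[OF G(1)] by (rule B.field_class_AE)
  then have "Ut F = G"
    using the_inv_into_f_f[OF B.identification_inj G(1)] by (simp add: L2_direct_integral_operator_def)
  then show "Ut F \<in> hcarrier (L2 M)" "AE z in N. fibre m2 (Ut F) z = U z (fibre m1 F z)" using G by auto
qed

lemma Ut_eqI:
  assumes "F \<in> hcarrier (L2 M)" "G \<in> hcarrier (L2 M)" "AE z in N. fibre m2 G z = U z (fibre m1 F z)"
  shows "Ut F = G"
proof (rule B.fibre_inj[OF Ut_fib(1)[OF assms(1)] assms(2)])
  show "AE z in N. fibre m2 (Ut F) z = fibre m2 G z"
    using Ut_fib(2)[OF assms(1)] assms(3) by eventually_elim simp
qed

text \<open>The field of inverses is measurable by unitarity: the inner product of \<open>w\<close>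
  with the preimage of \<open>fibre m2 G\<close> equals that of the image of \<open>w\<close> with
  \<open>fibre m2 G\<close>, which is measurable.\<close>

lemma Ut_surj:
  assumes G: "G \<in> hcarrier (L2 M)"
  shows "\<exists>F\<in>hcarrier (L2 M). Ut F = G"
proof -
  define u where "u z = the_inv_into (hcarrier (L2 (m1 z))) (U z) (fibre m2 G z)" for z
  have u: "u z \<in> hcarrier (L2 (m1 z))" "U z (u z) = fibre m2 G z" if z: "z \<in> space N" for z
  proof -
    have img: "fibre m2 G z \<in> U z ` hcarrier (L2 (m1 z))"
      using U_unitary[OF z] by (simp add: hunitary_def bij_betw_def)
    show "u z \<in> hcarrier (L2 (m1 z))"
      unfolding u_def by (rule the_inv_into_into[OF U_inj[OF z] img order_refl])
    show "U z (u z) = fibre m2 G z"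
      unfolding u_def by (rule f_the_inv_into_f[OF U_inj[OF z] img])
  qed
  have "u \<in> SH1"
  proof (rule A.memI[OF u(1)])
    fix w assume w: "w \<in> SH1"
    have "(\<lambda>z. hinner (L2 (m2 z)) (U z (w z)) (fibre m2 G z)) \<in> borel_measurable (completion N)"
      by (rule B.inner_meas[OF U_mem[OF w] B.fibre_mem[OF G]])
    then show "(\<lambda>z. hinner (L2 (m1 z)) (w z) (u z)) \<in> borel_measurable (completion N)"
    proof (rule measurable_cong[THEN iffD1, rotated])
      fix z assume "z \<in> space (completion N)"
      then have z: "z \<in> space N" by simp
      show "hinner (L2 (m2 z)) (U z (w z)) (fibre m2 G z) = hinner (L2 (m1 z)) (w z) (u z)"
        using U_unitary[OF z] A.carrier[OF w z] u[OF z] by (simp add: hunitary_def flip: u(2)[OF z])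
    qed
  qed
  moreover have "square_integrable_field N (\<lambda>z. L2 (m2 z)) (\<lambda>z. U z (u z))"
    by (rule B.sqint_AE[OF B.fibre_sqint[OF G]]) (use AE_space in eventually_elim, simp add: u(2))
  ultimately obtain F where F: "F \<in> hcarrier (L2 M)" "AE z in N. fibre m1 F z = u z"
    using A.fibre_surj[of u] U_sqint[of u] by blast
  have "AE z in N. fibre m2 G z = U z (fibre m1 F z)"
    using F(2) AE_space by eventually_elim (simp add: u(2))
  then show ?thesis using Ut_eqI[OF F(1) G] F(1) by blast
qed

lemma Ut_inj: "inj_on Ut (hcarrier (L2 M))"
proof (rule inj_onI)
  fix F G assume F: "F \<in> hcarrier (L2 M)" and G: "G \<in> hcarrier (L2 M)" and eq: "Ut F = Ut G"
  have "AE z in N. fibre m1 F z = fibre m1 G z"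
    using Ut_fib(2)[OF F] Ut_fib(2)[OF G] AE_space
  proof eventually_elim
    case (elim z)
    then have "U z (fibre m1 F z) = U z (fibre m1 G z)" using eq by simp
    then show ?case by (rule inj_onD[OF U_inj[OF elim(3)]]) auto
  qed
  then show "F = G" by (rule A.fibre_inj[OF F G])
qed

lemma Ut_linear: "hlinear (L2 M) (L2 M) Ut"
proof -
  interpret L2: pre_hilbert "L2 M" by (rule pre_hilbert_L2)
  have U_lin: "hlinear (L2 (m1 z)) (L2 (m2 z)) (U z)" if "z \<in> space N" for z
    using U_unitary[OF that] by (simp add: hunitary_def)
  show ?thesis
    unfolding hlinear_def
  proof (intro conjI ballI allI)
    show "Ut \<in> hcarrier (L2 M) \<rightarrow> hcarrier (L2 M)" using Ut_fib(1) by blast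
    fix F G assume F: "F \<in> hcarrier (L2 M)" and G: "G \<in> hcarrier (L2 M)"
    show "Ut (hadd (L2 M) F G) = hadd (L2 M) (Ut F) (Ut G)"
    proof (rule Ut_eqI)
      show "AE z in N. fibre m2 (hadd (L2 M) (Ut F) (Ut G)) z = U z (fibre m1 (hadd (L2 M) F G) z)"
        using Ut_fib(2)[OF F] Ut_fib(2)[OF G] A.fibre_add[OF F G]
          B.fibre_add[OF Ut_fib(1)[OF F] Ut_fib(1)[OF G]] AE_space
        by eventually_elim (use U_lin in \<open>simp add: hlinear_def\<close>)
    qed (use F G Ut_fib(1) in auto)
  next
    fix c F assume F: "F \<in> hcarrier (L2 M)"
    show "Ut (hscale (L2 M) c F) = hscale (L2 M) c (Ut F)"
    proof (rule Ut_eqI)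
      show "AE z in N. fibre m2 (hscale (L2 M) c (Ut F)) z = U z (fibre m1 (hscale (L2 M) c F) z)"
        using Ut_fib(2)[OF F] A.fibre_scale[OF F, of c] B.fibre_scale[OF Ut_fib(1)[OF F], of c] AE_space
        by eventually_elim (use U_lin in \<open>simp add: hlinear_def\<close>)
    qed (use F Ut_fib(1) in auto)
  qed
qed

lemma Ut_bij: "bij_betw Ut (hcarrier (L2 M)) (hcarrier (L2 M))"
  using Ut_inj Ut_surj Ut_fib(1) by (auto simp: bij_betw_def)

lemma Ut_unitary: "hunitary (L2 M) (L2 M) Ut"
  unfolding hunitary_def
proof (intro conjI ballI Ut_linear Ut_bij)
  interpret L2: pre_hilbert "L2 M" by (rule pre_hilbert_L2)
  have "hnorm (L2 M) (Ut F) = hnorm (L2 M) F" if F: "F \<in> hcarrier (L2 M)" for F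
  proof -
    have "AE z in completion N. ennreal ((hnorm (L2 (m2 z)) (fibre m2 (Ut F) z))\<^sup>2)
        = ennreal ((hnorm (L2 (m1 z)) (fibre m1 F z))\<^sup>2)"
      using AE_completion[OF Ut_fib(2)[OF F]] AE_space by eventually_elim (simp add: U_norm)
    from nn_integral_cong_AE[OF this]
    have "ennreal ((hnorm (L2 M) (Ut F))\<^sup>2) = ennreal ((hnorm (L2 M) F)\<^sup>2)"
      by (simp only: A.fibre_norm_integral[OF F] B.fibre_norm_integral[OF Ut_fib(1)[OF F]])
    then show ?thesis using F Ut_fib(1)[OF F] by simp
  qed
  then show "hinner (L2 M) (Ut F) (Ut G) = hinner (L2 M) F G"
    if "F \<in> hcarrier (L2 M)" "G \<in> hcarrier (L2 M)" for F G
    using that by (intro unitary_imp_isometry[OF pre_hilbert_L2 pre_hilbert_L2 Ut_linear])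
qed

text \<open>Positivity is a fibrewise matter on both sides. For the inverse, writing
  \<open>G\<close> as \<open>Ut F\<close> identifies the fibres of \<open>F\<close> with the
  preimages under \<open>U z\<close> of those of \<open>G\<close>.\<close>

lemma Ut_order_isomorphism:
  assumes order: "\<And>z. z \<in> space N \<Longrightarrow> order_isomorphism (m1 z) (m2 z) (U z)"
  shows "order_isomorphism M M Ut"
  unfolding order_isomorphism_def
proof (intro conjI Ut_linear Ut_bij)
  show "order_preserving M M Ut"
    unfolding order_preserving_def
  proof (intro ballI impI)
    fix F assume F: "F \<in> hcarrier (L2 M)" and "L2_nonneg M F"
    then have "AE z in N. L2_nonneg (m1 z) (fibre m1 F z)" by (simp add: A.fibre_nonneg)
    then have "AE z in N. L2_nonneg (m2 z) (fibre m2 (Ut F) z)"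
      using Ut_fib(2)[OF F] AE_space
    proof eventually_elim
      case (elim z)
      then show ?case using order[OF elim(3)] by (simp add: order_isomorphism_def order_preserving_def)
    qed
    then show "L2_nonneg M (Ut F)" by (simp add: B.fibre_nonneg Ut_fib(1)[OF F])
  qed
  show "order_preserving M M (the_inv_into (hcarrier (L2 M)) Ut)"
    unfolding order_preserving_def
  proof (intro ballI impI)
    fix G assume G: "G \<in> hcarrier (L2 M)" and pos: "L2_nonneg M G"
    obtain F where F: "F \<in> hcarrier (L2 M)" "Ut F = G" using Ut_surj[OF G] by blast
    have "AE z in N. L2_nonneg (m2 z) (fibre m2 G z)" using pos B.fibre_nonneg[OF G] by simp
    then have "AE z in N. L2_nonneg (m1 z) (fibre m1 F z)"
      using Ut_fib(2)[OF F(1)] AE_space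
    proof eventually_elim
      case (elim z)
      have "the_inv_into (hcarrier (L2 (m1 z))) (U z) (fibre m2 G z) = fibre m1 F z"
        using elim(2) F(2) the_inv_into_f_f[OF U_inj[OF elim(3)], of "fibre m1 F z"] by simp
      then show ?case
        using order[OF elim(3)] elim(1) B.fibre_carrier[of G z]
        unfolding order_isomorphism_def order_preserving_def by metis
    qed
    then have "L2_nonneg M F" by (simp add: A.fibre_nonneg F)
    then show "L2_nonneg M (the_inv_into (hcarrier (L2 M)) Ut G)"
      using the_inv_into_f_f[OF Ut_inj F(1)] F(2) by simp
  qed
qed

text \<open>Down to the fibres, across by \<open>U z\<close>, and back up. An inclusion of
  generators is enough, since the comparison of the semigroups only follows orbits of the first
  generator.\<close>

lemma Ut_generators:
  assumes T1: "\<And>z. z \<in> space N \<Longrightarrow> form_semigroup (L2 (m1 z)) (E1 z) (T1 z)"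
    and T2: "\<And>z. z \<in> space N \<Longrightarrow> form_semigroup (L2 (m2 z)) (E2 z) (T2 z)"
    and comm: "\<And>z t F. z \<in> space N \<Longrightarrow> t > 0 \<Longrightarrow> F \<in> hcarrier (L2 (m1 z)) \<Longrightarrow>
      T2 z t (U z F) = U z (T1 z t F)"
    and op: "form_operator (L2 M) A.Et F W"
  shows "form_operator (L2 M) B.Et (Ut F) (Ut W)"
proof -
  have F: "F \<in> hcarrier (L2 M)" and W: "W \<in> hcarrier (L2 M)"
    using op by (auto simp: form_operator_def form_dom_def)
  show ?thesis
  proof (rule B.form_operator_if_fibres[OF Ut_fib(1)[OF F] Ut_fib(1)[OF W]])
    show "AE z in N. form_operator (L2 (m2 z)) (E2 z) (fibre m2 (Ut F) z) (fibre m2 (Ut W) z)"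
      using A.fibres_form_operator[OF op] Ut_fib(2)[OF F] Ut_fib(2)[OF W] AE_space
    proof eventually_elim
      case (elim z)
      have "semigroup_form (L2 (m1 z)) (E1 z) (T1 z)" "semigroup_form (L2 (m2 z)) (E2 z) (T2 z)"
        using T1[OF elim(4)] T2[OF elim(4)]
        by (simp_all add: semigroup_form_def semigroup_form_axioms_def pre_hilbert_L2)
      then have "form_operator (L2 (m2 z)) (E2 z) (U z (fibre m1 F z)) (U z (fibre m1 W z)) \<longleftrightarrow>
          form_operator (L2 (m1 z)) (E1 z) (fibre m1 F z) (fibre m1 W z)"
        by (rule generators_intertwined_if_semigroups[OF _ _ U_unitary[OF elim(4)]])
          (use comm elim(4) in auto)
      then show ?case using elim by simp
    qed
  qed
qed

end

theorem proposition4p8: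
  fixes M :: "'x::polish_space measure" and N :: "'z measure" and s :: "'x \<Rightarrow> 'z"
    and m1 m2 :: "'z \<Rightarrow> 'x measure"
    and E1 E2 :: "'z \<Rightarrow> ('x \<Rightarrow> real) set \<Rightarrow> ennreal"
    and SH1 SQ1 SH2 SQ2 :: "('z \<Rightarrow> ('x \<Rightarrow> real) set) set"
    and T1 T2 :: "'z \<Rightarrow> real \<Rightarrow> ('x \<Rightarrow> real) set \<Rightarrow> ('x \<Rightarrow> real) set"
    and U :: "'z \<Rightarrow> ('x \<Rightarrow> real) set \<Rightarrow> ('x \<Rightarrow> real) set"
  assumes "locally_compact_space (euclidean :: 'x topology)"
    and "radon_measure_space M"
    and "prob_space N" and "separable_measurable_space N" and "countably_generated N"
    and "s \<in> completion M \<rightarrow>\<^sub>M N"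
    and "pseudo_disintegration M N m1" and "separated s N m1"
    and "pseudo_disintegration M N m2" and "separated s N m2"
    and "measurable_form_field N (\<lambda>z. L2 (m1 z)) SH1 E1 SQ1"
    and "\<And>z. z \<in> space N \<Longrightarrow> dirichlet_form (m1 z) (E1 z)"
    and "compatible M N m1 SH1 E1 SQ1"
    and "measurable_form_field N (\<lambda>z. L2 (m2 z)) SH2 E2 SQ2"
    and "\<And>z. z \<in> space N \<Longrightarrow> dirichlet_form (m2 z) (E2 z)"
    and "compatible M N m2 SH2 E2 SQ2"
    and "\<And>z. z \<in> space N \<Longrightarrow> form_semigroup (L2 (m1 z)) (E1 z) (T1 z)"
    and "\<And>z. z \<in> space N \<Longrightarrow> form_semigroup (L2 (m2 z)) (E2 z) (T2 z)"
    and "measurable_operator_field N (\<lambda>z. L2 (m1 z)) SH1 (\<lambda>z. L2 (m2 z)) SH2 U"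
    and "\<And>z. z \<in> space N \<Longrightarrow> hunitary (L2 (m1 z)) (L2 (m2 z)) (U z)"
    and "\<And>z. z \<in> space N \<Longrightarrow> order_isomorphism (m1 z) (m2 z) (U z)"
    and "\<And>z t F. z \<in> space N \<Longrightarrow> t > 0 \<Longrightarrow> F \<in> hcarrier (L2 (m1 z)) \<Longrightarrow>
           T2 z t (U z F) = U z (T1 z t F)"
  shows "hunitary (L2 M) (L2 M) (L2_direct_integral_operator M N m1 SH1 m2 SH2 U) \<and>
    order_isomorphism M M (L2_direct_integral_operator M N m1 SH1 m2 SH2 U) \<and>
    (\<forall>S1 S2.
       form_semigroup (L2 M) (L2_direct_integral_form N m1 SH1 E1 SQ1) S1 \<longrightarrow>
       form_semigroup (L2 M) (L2_direct_integral_form N m2 SH2 E2 SQ2) S2 \<longrightarrow>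
       (\<forall>t\<ge>0. \<forall>F\<in>hcarrier (L2 M).
          L2_direct_integral_operator M N m1 SH1 m2 SH2 U (S1 t F) =
            S2 t (L2_direct_integral_operator M N m1 SH1 m2 SH2 U F)))"
proof -
  have "disintegration M N s m1" "disintegration M N s m2"
    using assms(6-10) by (simp_all add: disintegration_def)
  note ff = compatible_form_field[OF this(1) assms(11,13)] compatible_form_field[OF this(2) assms(14,16)]
  obtain b1 D1 where "form_field M N s m1 SH1 E1 SQ1 b1 D1" using ff(1) by blast
  moreover obtain b2 D2 where "form_field M N s m2 SH2 E2 SQ2 b2 D2" using ff(2) by blast
  ultimately interpret intertwined_fields M N s m1 SH1 E1 SQ1 b1 D1 m2 SH2 E2 SQ2 b2 D2 U
    using assms(19,20) by (simp add: intertwined_fields_def intertwined_fields_axioms_def)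
  show ?thesis
  proof (intro conjI allI impI ballI)
    show "hunitary (L2 M) (L2 M) Ut" by (rule Ut_unitary)
    show "order_isomorphism M M Ut" using assms(21) by (rule Ut_order_isomorphism)
    fix S1 S2 t F
    assume S: "form_semigroup (L2 M) A.Et S1" "form_semigroup (L2 M) B.Et S2"
      and t: "(0::real) \<le> t" and F: "F \<in> hcarrier (L2 M)"
    \<comment> \<open>\<open>S1\<close> and \<open>S2\<close> are arbitrary semigroups with the
      generators of the two forms; the identity rests on the intertwined generators and on the
      density of the domain of the first.\<close>
    show "Ut (S1 t F) = S2 t (Ut F)"
    proof (rule semigroups_intertwined_if_generators[OF _ _ Ut_unitary _ _ t F])
      show "semigroup_form (L2 M) A.Et S1" "semigroup_form (L2 M) B.Et S2"
        using S by (simp_all add: semigroup_form_def semigroup_form_axioms_def pre_hilbert_L2)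
      show "form_operator (L2 M) B.Et (Ut G) (Ut W)" if "form_operator (L2 M) A.Et G W" for G W
        using assms(17,18,22) that by (rule Ut_generators)
      show "\<exists>v w. form_operator (L2 M) A.Et v w \<and> hdist (L2 M) G v < e"
        if "G \<in> hcarrier (L2 M)" "0 < e" for G e
        using that by (rule A.generator_dense)
    qed
  qed
qed

end
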